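(* Let $(M^{2n+1},\Phi,\xi,\eta,g)$ be an ACR-manifold of the class of Kenmotsu type, with generalized curvature tensor $B$ with scalars $a_0,a_1,a_2$, where $a_0,a_1\ne0$. Then $M$ has constant generalized curvature $\kappa$ if and only if $M$ is an $\eta$-Einstein manifold, $r_{ij}=\lambda g_{ij}+\mu\eta_i\eta_j$, with $$\lambda=\frac1{a_1}(a_0+2na_1-2a_2s+\kappa),\qquad \mu=-(2n+\lambda),$$ and on the AG-structure space $$A^a_{bcd}=0,\qquad A^{ad}_{bc}=B^{ah}{}_cB_{bh}{}^d+\frac{a_1}{a_0}\mu\,\delta^a_c\delta^d_b,\qquad B^{ab}{}_{[cd]}=\frac{a_1}{a_0}\mu\,\delta^a_{[c}\delta^b_{d]}.$$
   Context: ACR-manifold: a smooth manifold $M^{2n+1}$ with an endomorphism $\Phi$ of $X(M)$ (smooth vector fields), $\xi\in X(M)$, a Riemannian metric $g$ and $\eta(\cdot)=g(\cdot,\xi)$ such that $\Phi\xi=0$, $\eta(\xi)=1$, $\eta\circ\Phi=0$, $\Phi^2=-\mathrm{id}+\eta\otimes\xi$, $g(\Phi X,\Phi Y)=g(X,Y)-\eta(X)\eta(Y)$. It is of the class of Kenmotsu type if $\nabla_X(\Phi)Y-\nabla_{\Phi X}(\Phi)\Phi Y=-\eta(Y)\Phi X$ for all $X,Y\in X(M)$ ($\nabla$ the Levi-Civita connection). It is $\eta$-Einstein if $r_{ij}=\lambda g_{ij}+\mu\eta_i\eta_j$ with scalars $\lambda,\mu$. A-frames and AG-structure space: $a,b,c,d,h\in\{1,\dots,n\}$,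 $\hat a=a+n$, $\hat{\hat a}=a$, $\hat 0=0$; $i,j,k,l\in\{0,1,\dots,2n\}$; repeated indices are summed. For an orthonormal frame $\{\xi,e_1,\dots,e_n,\Phi e_1,\dots,\Phi e_n\}$ set $\varepsilon_0=\xi$, $\varepsilon_a=\frac1{\sqrt2}(\mathrm{id}-\sqrt{-1}\Phi)e_a$, $\varepsilon_{\hat a}=\frac1{\sqrt2}(\mathrm{id}+\sqrt{-1}\Phi)e_a$. The set of all these (complex) frames is the AG-structure space, and components of tensors are taken in such frames: $g_{00}=1$, $g_{a0}=g_{ab}=g_{\hat a\hat b}=0$, $g_{\hat ab}=\delta^a_b$; $\Phi\varepsilon_a=\sqrt{-1}\varepsilon_a$, $\Phi\varepsilon_{\hat a}=-\sqrt{-1}\varepsilon_{\hat a}$. The conjugate of a component replaces each index $i$ by $\hat i$ and takes the complex conjugate. Brackets $[\,\cdot\,\cdot\,]$ denote antisymmetrization with factor $\frac12$. $R(X,Y)Z=R^i_{jkl}X^kY^lZ^j\varepsilon_i$ is the Riemann tensor; for a $(3,1)$-tensor $T$, $T(X,Y,Z,W)=g(T(Z,W)Y,X)$, so $R_{ijkl}=R^{\hat i}_{jkl}$. $r_{jl}=g^{ik}R_{ijkl}$ is the Ricci tensor and $s$ the scalar curvature. Generalized curvature tensor, with scalars $a_0,a_1,a_2$: $B_{ijkl}=a_0R_{ijkl}+a_1\{g_{ik}r_{jl}-g_{il}r_{jk}+r_{ik}g_{jl}-r_{il}g_{jk}\}+2a_2s\{g_{ik}g_{jl}-g_{il}g_{jk}\}$.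 $M$ has constant generalized curvature $\kappa$ if $B(X,Y,Z,W)=\kappa\{g(X,Z)g(Y,W)-g(X,W)g(Y,Z)\}$ for all $X,Y,Z,W\in X(M)$. Structure functions of the class of Kenmotsu type (distinct from the tensor $B_{ijkl}$): $B^{ab}{}_c$ (first Kirichenko tensor, $B^{ab}{}_c=-B^{ba}{}_c$), with conjugate $B_{ab}{}^c$, is determined in the dual coframe ($\omega=\omega^0$, $\omega_a=\omega^{\hat a}$) by $d\omega^a=\omega^a_b\wedge\omega^b+B^{ab}{}_c\,\omega^c\wedge\omega_b-\omega^a\wedge\omega$, $d\omega_a=-\omega^b_a\wedge\omega_b+B_{ab}{}^c\,\omega_c\wedge\omega^b-\omega_a\wedge\omega$, $d\omega=0$. The functions $A^a_{bcd}$ (antisymmetric in $c,d$), $A^{ad}_{bc}$, $B^{ab}{}_{cd}$, $B^{abd}{}_c$ come from the further structure equations and are related to the curvature by the known formulas $R^a_{0c0}=-\delta^a_c$; $R^a_{\hat bcd}=2(B^{ab}{}_{[cd]}-\delta^a_{[c}\delta^b_{d]})$; $R^a_{\hat bc\hat d}=B^{abd}{}_c-B^{ab}{}_hB^{hd}{}_c$; $R^a_{bcd}=2A^a_{bcd}$; $R^a_{bc\hat d}=A^{ad}_{bc}-B^{ah}{}_cB_{bh}{}^d-\delta^a_c\delta^d_b$; the remaining components of $R$ follow by the first Bianchi identity or conjugation or vanish identically. *)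

theory Defs
  imports "HOL-Analysis.Analysis" "HOL-Library.Function_Algebras"
begin

section \<open>Smooth manifolds, vector fields, one-forms\<close>

text \<open>\<open>C\<^sup>k\<close> maps; meant for open \<open>S\<close>.\<close>

primrec Ck_on :: "nat \<Rightarrow> ('a::real_normed_vector \<Rightarrow> 'b::real_normed_vector) \<Rightarrow> 'a set \<Rightarrow> bool" where
  "Ck_on 0 f S \<longleftrightarrow> continuous_on S f"
| "Ck_on (Suc k) f S \<longleftrightarrow>
     (\<forall>x\<in>S. f differentiable (at x)) \<and>
     (\<forall>v. Ck_on k (\<lambda>x. frechet_derivative f (at x) v) S)"

definition Cinf_on :: "('a::real_normed_vector \<Rightarrow> 'b::real_normed_vector) \<Rightarrow> 'a set \<Rightarrow> bool" where
  "Cinf_on f S \<longleftrightarrow> (\<forall>k. Ck_on k f S)"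

text \<open>
  The manifold is the whole point type \<open>'m\<close> (Hausdorff and second countable by its type class);
  a chart is a pair (domain, coordinate map). The atlas need not be maximal.
\<close>

type_synonym ('m, 'e) atlas = "('m set \<times> ('m \<Rightarrow> 'e)) set"

definition smooth_atlas ::
    "('m::{t2_space,second_countable_topology}, 'e::euclidean_space) atlas \<Rightarrow> bool" where
  "smooth_atlas A \<longleftrightarrow>
     (\<forall>(U, \<phi>)\<in>A. open U \<and> open (\<phi> ` U) \<and> homeomorphism U (\<phi> ` U) \<phi> (inv_into U \<phi>)) \<and>
     (\<Union>(U, \<phi>)\<in>A. U) = UNIV \<and>
     (\<forall>(U, \<phi>)\<in>A. \<forall>(V, \<psi>)\<in>A. Cinf_on (\<psi> \<circ> inv_into U \<phi>) (\<phi> ` (U \<inter> V)))"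

definition smooth_fns ::
    "('m::{t2_space,second_countable_topology}, 'e::euclidean_space) atlas \<Rightarrow> ('m \<Rightarrow> real) set" where
  "smooth_fns A = {f. \<forall>(U, \<phi>)\<in>A. Cinf_on (f \<circ> inv_into U \<phi>) (\<phi> ` U)}"

type_synonym 'm vfield = "('m \<Rightarrow> real) \<Rightarrow> ('m \<Rightarrow> real)"

text \<open>
  \<open>vfields A\<close> is \<open>X(M)\<close>: the derivations of \<open>C\<^sup>\<infinity>(M)\<close>. They are set to \<open>0\<close> off \<open>C\<^sup>\<infinity>(M)\<close>, so that
  equality of vector fields is equality of functions. Sums, products, \<open>0\<close> and \<open>1\<close> of functions
  (and of vector fields) are the pointwise ones of \<open>Function_Algebras\<close>.
\<close>

definition vfields ::
    "('m::{t2_space,second_countable_topology}, 'e::euclidean_space) atlas \<Rightarrow> 'm vfield set" where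
  "vfields A = {X.
     (\<forall>f\<in>smooth_fns A. X f \<in> smooth_fns A) \<and>
     (\<forall>f. f \<notin> smooth_fns A \<longrightarrow> X f = 0) \<and>
     (\<forall>f\<in>smooth_fns A. \<forall>h\<in>smooth_fns A. X (f + h) = X f + X h) \<and>
     (\<forall>c. \<forall>f\<in>smooth_fns A. X (\<lambda>p. c * f p) = (\<lambda>p. c * X f p)) \<and>
     (\<forall>f\<in>smooth_fns A. \<forall>h\<in>smooth_fns A. X (f * h) = f * X h + h * X f)}"

definition fmul :: "('m \<Rightarrow> real) \<Rightarrow> 'm vfield \<Rightarrow> 'm vfield" (infixr "\<odot>" 75) where
  "h \<odot> X = (\<lambda>f. h * X f)"

definition lie :: "'m vfield \<Rightarrow> 'm vfield \<Rightarrow> 'm vfield" where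
  "lie X Y = (\<lambda>f. X (Y f) - Y (X f))"

section \<open>Riemannian geometry\<close>

type_synonym 'm metric = "'m vfield \<Rightarrow> 'm vfield \<Rightarrow> 'm \<Rightarrow> real"
type_synonym 'm connection = "'m vfield \<Rightarrow> 'm vfield \<Rightarrow> 'm vfield"

text \<open>The tangent vector \<open>X\<^sub>p\<close> is the functional \<open>f \<mapsto> X f p\<close> on \<open>C\<^sup>\<infinity>(M)\<close>.\<close>

definition riemannian_metric ::
    "('m::{t2_space,second_countable_topology}, 'e::euclidean_space) atlas \<Rightarrow> 'm metric \<Rightarrow> bool" where
  "riemannian_metric A g \<longleftrightarrow>
     (\<forall>X\<in>vfields A. \<forall>Y\<in>vfields A. g X Y \<in> smooth_fns A \<and> g X Y = g Y X) \<and>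
     (\<forall>X\<in>vfields A. \<forall>Y\<in>vfields A. \<forall>Z\<in>vfields A. g (X + Y) Z = g X Z + g Y Z) \<and>
     (\<forall>h\<in>smooth_fns A. \<forall>X\<in>vfields A. \<forall>Y\<in>vfields A. g (h \<odot> X) Y = h * g X Y) \<and>
     (\<forall>X\<in>vfields A. \<forall>p. (\<exists>f\<in>smooth_fns A. X f p \<noteq> 0) \<longrightarrow> g X X p > 0)"

definition affine_connection ::
    "('m::{t2_space,second_countable_topology}, 'e::euclidean_space) atlas \<Rightarrow> 'm connection \<Rightarrow> bool" where
  "affine_connection A D \<longleftrightarrow>
     (\<forall>X\<in>vfields A. \<forall>Y\<in>vfields A. D X Y \<in> vfields A) \<and>
     (\<forall>X\<in>vfields A. \<forall>Y\<in>vfields A. \<forall>Z\<in>vfields A.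
        D (X + Y) Z = D X Z + D Y Z \<and> D X (Y + Z) = D X Y + D X Z) \<and>
     (\<forall>h\<in>smooth_fns A. \<forall>X\<in>vfields A. \<forall>Y\<in>vfields A.
        D (h \<odot> X) Y = h \<odot> D X Y \<and> D X (h \<odot> Y) = X h \<odot> Y + h \<odot> D X Y)"

definition levi_civita ::
    "('m::{t2_space,second_countable_topology}, 'e::euclidean_space) atlas
       \<Rightarrow> 'm metric \<Rightarrow> 'm connection \<Rightarrow> bool" where
  "levi_civita A g D \<longleftrightarrow>
     affine_connection A D \<and>
     (\<forall>X\<in>vfields A. \<forall>Y\<in>vfields A. D X Y - D Y X = lie X Y) \<and>
     (\<forall>X\<in>vfields A. \<forall>Y\<in>vfields A. \<forall>Z\<in>vfields A.
        Z (g X Y) = g (D Z X) Y + g X (D Z Y))"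

definition riem :: "'m connection \<Rightarrow> 'm vfield \<Rightarrow> 'm vfield \<Rightarrow> 'm vfield \<Rightarrow> 'm vfield" where
  "riem D X Y Z = D X (D Y Z) - D Y (D X Z) - D (lie X Y) Z"

definition Riem :: "'m metric \<Rightarrow> 'm connection \<Rightarrow>
    'm vfield \<Rightarrow> 'm vfield \<Rightarrow> 'm vfield \<Rightarrow> 'm vfield \<Rightarrow> 'm \<Rightarrow> real" where
  "Riem g D X Y Z W = g (riem D Z W Y) X"

text \<open>The first \<open>N\<close> members of \<open>E\<close> are orthonormal at the point \<open>p\<close>.\<close>

definition orthonormal_at ::
    "('m::{t2_space,second_countable_topology}, 'e::euclidean_space) atlas \<Rightarrow> 'm metric \<Rightarrow> 'm
       \<Rightarrow> nat \<Rightarrow> (nat \<Rightarrow> 'm vfield) \<Rightarrow> bool" where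
  "orthonormal_at A g p N E \<longleftrightarrow>
     (\<forall>i<N. E i \<in> vfields A) \<and>
     (\<forall>i<N. \<forall>j<N. g (E i) (E j) p = (if i = j then 1 else 0))"

definition some_frame_at ::
    "('m::{t2_space,second_countable_topology}, 'e::euclidean_space) atlas \<Rightarrow> 'm metric \<Rightarrow> 'm
       \<Rightarrow> nat \<Rightarrow> 'm vfield" where
  "some_frame_at A g p = (SOME E. orthonormal_at A g p DIM('e) E)"

text \<open>\<open>r\<^sub>j\<^sub>l = g\<^sup>i\<^sup>k R\<^sub>i\<^sub>j\<^sub>k\<^sub>l\<close>, the trace being taken in an orthonormal basis (any choice gives the
  same value).\<close>

definition Ric ::
    "('m::{t2_space,second_countable_topology}, 'e::euclidean_space) atlas \<Rightarrow> 'm metric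
       \<Rightarrow> 'm connection \<Rightarrow> 'm vfield \<Rightarrow> 'm vfield \<Rightarrow> 'm \<Rightarrow> real" where
  "Ric A g D Y W p =
     (\<Sum>i<DIM('e). Riem g D (some_frame_at A g p i) Y (some_frame_at A g p i) W p)"

definition scal ::
    "('m::{t2_space,second_countable_topology}, 'e::euclidean_space) atlas \<Rightarrow> 'm metric
       \<Rightarrow> 'm connection \<Rightarrow> 'm \<Rightarrow> real" where
  "scal A g D p = (\<Sum>i<DIM('e). Ric A g D (some_frame_at A g p i) (some_frame_at A g p i) p)"

definition gen_curv ::
    "('m::{t2_space,second_countable_topology}, 'e::euclidean_space) atlas \<Rightarrow> 'm metric
       \<Rightarrow> 'm connection \<Rightarrow> real \<Rightarrow> real \<Rightarrow> real
       \<Rightarrow> 'm vfield \<Rightarrow> 'm vfield \<Rightarrow> 'm vfield \<Rightarrow> 'm vfield \<Rightarrow> 'm \<Rightarrow> real" where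
  "gen_curv A g D a0 a1 a2 X Y Z W p =
     a0 * Riem g D X Y Z W p +
     a1 * (g X Z p * Ric A g D Y W p - g X W p * Ric A g D Y Z p
         + Ric A g D X Z p * g Y W p - Ric A g D X W p * g Y Z p) +
     2 * a2 * scal A g D p * (g X Z p * g Y W p - g X W p * g Y Z p)"

definition constant_gen_curv ::
    "('m::{t2_space,second_countable_topology}, 'e::euclidean_space) atlas \<Rightarrow> 'm metric
       \<Rightarrow> 'm connection \<Rightarrow> real \<Rightarrow> real \<Rightarrow> real \<Rightarrow> real \<Rightarrow> bool" where
  "constant_gen_curv A g D a0 a1 a2 \<kappa> \<longleftrightarrow>
     (\<forall>X\<in>vfields A. \<forall>Y\<in>vfields A. \<forall>Z\<in>vfields A. \<forall>W\<in>vfields A. \<forall>p.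
        gen_curv A g D a0 a1 a2 X Y Z W p = \<kappa> * (g X Z p * g Y W p - g X W p * g Y Z p))"

section \<open>Almost contact Riemannian manifolds of Kenmotsu type\<close>

definition acr_manifold ::
    "nat \<Rightarrow> ('m::{t2_space,second_countable_topology}, 'e::euclidean_space) atlas
       \<Rightarrow> ('m vfield \<Rightarrow> 'm vfield) \<Rightarrow> 'm vfield \<Rightarrow> ('m vfield \<Rightarrow> 'm \<Rightarrow> real) \<Rightarrow> 'm metric \<Rightarrow> bool" where
  "acr_manifold n A \<Phi> \<xi> \<eta> g \<longleftrightarrow>
     n \<ge> 1 \<and> DIM('e) = 2 * n + 1 \<and> smooth_atlas A \<and> riemannian_metric A g \<and>
     (\<forall>X\<in>vfields A. \<Phi> X \<in> vfields A) \<and>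
     (\<forall>X\<in>vfields A. \<forall>Y\<in>vfields A. \<Phi> (X + Y) = \<Phi> X + \<Phi> Y) \<and>
     (\<forall>h\<in>smooth_fns A. \<forall>X\<in>vfields A. \<Phi> (h \<odot> X) = h \<odot> \<Phi> X) \<and>
     \<xi> \<in> vfields A \<and>
     (\<forall>X\<in>vfields A. \<eta> X = g X \<xi>) \<and>
     \<Phi> \<xi> = 0 \<and> \<eta> \<xi> = 1 \<and>
     (\<forall>X\<in>vfields A. \<eta> (\<Phi> X) = 0) \<and>
     (\<forall>X\<in>vfields A. \<Phi> (\<Phi> X) = - X + \<eta> X \<odot> \<xi>) \<and>
     (\<forall>X\<in>vfields A. \<forall>Y\<in>vfields A. g (\<Phi> X) (\<Phi> Y) = g X Y - \<eta> X * \<eta> Y)"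

definition cov_Phi :: "'m connection \<Rightarrow> ('m vfield \<Rightarrow> 'm vfield)
    \<Rightarrow> 'm vfield \<Rightarrow> 'm vfield \<Rightarrow> 'm vfield" where
  "cov_Phi D \<Phi> X Y = D X (\<Phi> Y) - \<Phi> (D X Y)"

definition kenmotsu_type ::
    "('m::{t2_space,second_countable_topology}, 'e::euclidean_space) atlas
       \<Rightarrow> ('m vfield \<Rightarrow> 'm vfield) \<Rightarrow> ('m vfield \<Rightarrow> 'm \<Rightarrow> real) \<Rightarrow> 'm connection \<Rightarrow> bool" where
  "kenmotsu_type A \<Phi> \<eta> D \<longleftrightarrow>
     (\<forall>X\<in>vfields A. \<forall>Y\<in>vfields A.
        cov_Phi D \<Phi> X Y - cov_Phi D \<Phi> (\<Phi> X) (\<Phi> Y) = - (\<eta> Y \<odot> \<Phi> X))"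

text \<open>The coefficients \<open>l\<close>, \<open>m\<close> are functions on the manifold.\<close>

definition eta_Einstein ::
    "('m::{t2_space,second_countable_topology}, 'e::euclidean_space) atlas \<Rightarrow> 'm metric
       \<Rightarrow> ('m vfield \<Rightarrow> 'm \<Rightarrow> real) \<Rightarrow> 'm connection \<Rightarrow> ('m \<Rightarrow> real) \<Rightarrow> ('m \<Rightarrow> real) \<Rightarrow> bool" where
  "eta_Einstein A g \<eta> D l m \<longleftrightarrow>
     (\<forall>X\<in>vfields A. \<forall>Y\<in>vfields A. \<forall>p.
        Ric A g D X Y p = l p * g X Y p + m p * \<eta> X p * \<eta> Y p)"

section \<open>A-frames and structure functions\<close>

text \<open>
  A pair \<open>(X, Y)\<close> of vector fields stands for the complex vector field \<open>X + iY\<close>, and \<open>clin F\<close> is the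
  complex-linear extension of \<open>F\<close> to such fields.
\<close>

type_synonym 'm cvfield = "'m vfield \<times> 'm vfield"
type_synonym 'm form1 = "'m vfield \<Rightarrow> 'm \<Rightarrow> complex"

definition clin :: "'m form1 \<Rightarrow> 'm cvfield \<Rightarrow> 'm \<Rightarrow> complex" where
  "clin F Z p = F (fst Z) p + \<i> * F (snd Z) p"

definition csmooth_fns ::
    "('m::{t2_space,second_countable_topology}, 'e::euclidean_space) atlas \<Rightarrow> ('m \<Rightarrow> complex) set" where
  "csmooth_fns A = {f. (\<lambda>p. Re (f p)) \<in> smooth_fns A \<and> (\<lambda>p. Im (f p)) \<in> smooth_fns A}"

text \<open>\<open>cder X f\<close> is \<open>X f = df(X)\<close> for complex-valued \<open>f\<close>.\<close>

definition cder :: "'m vfield \<Rightarrow> ('m \<Rightarrow> complex) \<Rightarrow> 'm \<Rightarrow> complex" where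
  "cder X f p = Complex (X (\<lambda>q. Re (f q)) p) (X (\<lambda>q. Im (f q)) p)"

definition one_form ::
    "('m::{t2_space,second_countable_topology}, 'e::euclidean_space) atlas \<Rightarrow> 'm form1 \<Rightarrow> bool" where
  "one_form A \<alpha> \<longleftrightarrow>
     (\<forall>X\<in>vfields A. \<alpha> X \<in> csmooth_fns A) \<and>
     (\<forall>X\<in>vfields A. \<forall>Y\<in>vfields A. \<alpha> (X + Y) = \<alpha> X + \<alpha> Y) \<and>
     (\<forall>h\<in>smooth_fns A. \<forall>X\<in>vfields A. \<alpha> (h \<odot> X) = (\<lambda>p. of_real (h p) * \<alpha> X p))"

definition ext_d :: "'m form1 \<Rightarrow> 'm vfield \<Rightarrow> 'm vfield \<Rightarrow> 'm \<Rightarrow> complex" where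
  "ext_d \<alpha> X Y p = cder X (\<alpha> Y) p - cder Y (\<alpha> X) p - \<alpha> (lie X Y) p"

definition wedge :: "'m form1 \<Rightarrow> 'm form1 \<Rightarrow> 'm vfield \<Rightarrow> 'm vfield \<Rightarrow> 'm \<Rightarrow> complex" where
  "wedge \<alpha> \<beta> X Y p = \<alpha> X p * \<beta> Y p - \<alpha> Y p * \<beta> X p"

definition hat :: "nat \<Rightarrow> nat \<Rightarrow> nat" where
  "hat n i = (if i = 0 then 0 else if i \<le> n then i + n else i - n)"

definition kdelta :: "nat \<Rightarrow> nat \<Rightarrow> complex" where
  "kdelta i j = (if i = j then 1 else 0)"

definition real_frame :: "nat \<Rightarrow> ('m vfield \<Rightarrow> 'm vfield) \<Rightarrow> 'm vfield \<Rightarrow> (nat \<Rightarrow> 'm vfield)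
    \<Rightarrow> nat \<Rightarrow> 'm vfield" where
  "real_frame n \<Phi> \<xi> e i = (if i = 0 then \<xi> else if i \<le> n then e i else \<Phi> (e (i - n)))"

definition A_frame :: "nat \<Rightarrow> ('m vfield \<Rightarrow> 'm vfield) \<Rightarrow> 'm vfield \<Rightarrow> (nat \<Rightarrow> 'm vfield)
    \<Rightarrow> nat \<Rightarrow> 'm cvfield" where
  "A_frame n \<Phi> \<xi> e i =
     (if i = 0 then (\<xi>, 0)
      else if i \<le> n then ((\<lambda>_. 1 / sqrt 2) \<odot> e i, (\<lambda>_. - 1 / sqrt 2) \<odot> \<Phi> (e i))
      else ((\<lambda>_. 1 / sqrt 2) \<odot> e (i - n), (\<lambda>_. 1 / sqrt 2) \<odot> \<Phi> (e (i - n))))"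

text \<open>
  A local section over the open set \<open>U\<close> of the AG-structure space, given by \<open>e 1, \<dots>, e n\<close>. The
  fields are globally defined but required to be orthonormal over \<open>U\<close> only; as every local field
  agrees near each point with a global one, each A-frame at a point extends to such a section.
\<close>

definition AG_section ::
    "nat \<Rightarrow> ('m::{t2_space,second_countable_topology}, 'e::euclidean_space) atlas
       \<Rightarrow> ('m vfield \<Rightarrow> 'm vfield) \<Rightarrow> 'm vfield \<Rightarrow> 'm metric \<Rightarrow> 'm set \<Rightarrow> (nat \<Rightarrow> 'm vfield) \<Rightarrow> bool" where
  "AG_section n A \<Phi> \<xi> g U e \<longleftrightarrow>
     open U \<and> (\<forall>p\<in>U. orthonormal_at A g p (2 * n + 1) (real_frame n \<Phi> \<xi> e))"

text \<open>The dual coframe: \<open>w a = \<omega>\<^sup>a\<close>, \<open>w (hat n a) = \<omega>\<^sub>a\<close> for \<open>1 \<le> a \<le> n\<close>, and \<open>w 0 = \<omega>\<close>.\<close>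

definition dual_coframe ::
    "nat \<Rightarrow> ('m::{t2_space,second_countable_topology}, 'e::euclidean_space) atlas
       \<Rightarrow> ('m vfield \<Rightarrow> 'm vfield) \<Rightarrow> 'm vfield \<Rightarrow> 'm set \<Rightarrow> (nat \<Rightarrow> 'm vfield)
       \<Rightarrow> (nat \<Rightarrow> 'm form1) \<Rightarrow> bool" where
  "dual_coframe n A \<Phi> \<xi> U e w \<longleftrightarrow>
     (\<forall>i\<le>2 * n. one_form A (w i)) \<and>
     (\<forall>i\<le>2 * n. \<forall>j\<le>2 * n. \<forall>p\<in>U. clin (w i) (A_frame n \<Phi> \<xi> e j) p = kdelta i j)"

text \<open>
  First group of structure equations, over \<open>U\<close>:
    \<open>d\<omega>\<^sup>a = \<omega>\<^sup>a\<^sub>b \<and> \<omega>\<^sup>b + B\<^sup>a\<^sup>b\<^sub>c \<omega>\<^sup>c \<and> \<omega>\<^sub>b - \<omega>\<^sup>a \<and> \<omega>\<close>,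
    \<open>d\<omega>\<^sub>a = -\<omega>\<^sup>b\<^sub>a \<and> \<omega>\<^sub>b + B\<^sub>a\<^sub>b\<^sup>c \<omega>\<^sub>c \<and> \<omega>\<^sup>b - \<omega>\<^sub>a \<and> \<omega>\<close>,
    \<open>d\<omega> = 0\<close>,
  with \<open>w1 a b = \<omega>\<^sup>a\<^sub>b\<close>, \<open>B a b c = B\<^sup>a\<^sup>b\<^sub>c\<close> antisymmetric in \<open>a, b\<close>, and \<open>B\<^sub>a\<^sub>b\<^sup>c\<close> the conjugate of
  \<open>B\<^sup>a\<^sup>b\<^sub>c\<close>. Over \<open>U\<close> they determine \<open>\<omega>\<^sup>a\<^sub>b\<close> and \<open>B\<^sup>a\<^sup>b\<^sub>c\<close> uniquely; in particular \<open>\<omega>\<^sup>b\<^sub>a\<close> is minus the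
  conjugate of \<open>\<omega>\<^sup>a\<^sub>b\<close>, and \<open>-\<omega>\<^sup>a\<^sub>b\<close> is the component of the Levi-Civita connection form.
\<close>

definition structure_eqs1 ::
    "nat \<Rightarrow> ('m::{t2_space,second_countable_topology}, 'e::euclidean_space) atlas \<Rightarrow> 'm set
       \<Rightarrow> (nat \<Rightarrow> 'm form1) \<Rightarrow> (nat \<Rightarrow> nat \<Rightarrow> 'm form1)
       \<Rightarrow> (nat \<Rightarrow> nat \<Rightarrow> nat \<Rightarrow> 'm \<Rightarrow> complex) \<Rightarrow> bool" where
  "structure_eqs1 n A U w w1 B \<longleftrightarrow>
     (\<forall>a\<in>{1..n}. \<forall>b\<in>{1..n}. one_form A (w1 a b)) \<and>
     (\<forall>a\<in>{1..n}. \<forall>b\<in>{1..n}. \<forall>c\<in>{1..n}. B a b c \<in> csmooth_fns A) \<and>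
     (\<forall>p\<in>U.
       (\<forall>a\<in>{1..n}. \<forall>b\<in>{1..n}. \<forall>c\<in>{1..n}. B a b c p = - B b a c p) \<and>
       (\<forall>X\<in>vfields A. \<forall>Y\<in>vfields A.
          (\<forall>a\<in>{1..n}.
             ext_d (w a) X Y p =
               (\<Sum>b=1..n. wedge (w1 a b) (w b) X Y p)
               + (\<Sum>b=1..n. \<Sum>c=1..n. B a b c p * wedge (w c) (w (hat n b)) X Y p)
               - wedge (w a) (w 0) X Y p) \<and>
          (\<forall>a\<in>{1..n}.
             ext_d (w (hat n a)) X Y p =
               - (\<Sum>b=1..n. wedge (w1 b a) (w (hat n b)) X Y p)
               + (\<Sum>b=1..n. \<Sum>c=1..n. cnj (B a b c p) * wedge (w (hat n c)) (w b) X Y p)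
               - wedge (w (hat n a)) (w 0) X Y p) \<and>
          ext_d (w 0) X Y p = 0))"

text \<open>
  Second group, over \<open>U\<close>:
    \<open>d\<omega>\<^sup>a\<^sub>b = \<omega>\<^sup>a\<^sub>c \<and> \<omega>\<^sup>c\<^sub>b - A\<^sup>a\<^sub>b\<^sub>c\<^sub>d \<omega>\<^sup>c \<and> \<omega>\<^sup>d - A\<^sup>a\<^sup>d\<^sub>b\<^sub>c \<omega>\<^sup>c \<and> \<omega>\<^sub>d + A\<^sub>b\<^sup>a\<^sup>c\<^sup>d \<omega>\<^sub>c \<and> \<omega>\<^sub>d\<close>,
    \<open>dB\<^sup>a\<^sup>b\<^sub>c + B\<^sup>a\<^sup>b\<^sub>h \<omega>\<^sup>h\<^sub>c - B\<^sup>h\<^sup>b\<^sub>c \<omega>\<^sup>a\<^sub>h - B\<^sup>a\<^sup>h\<^sub>c \<omega>\<^sup>b\<^sub>h = B\<^sup>a\<^sup>b\<^sub>c\<^sub>d \<omega>\<^sup>d + B\<^sup>a\<^sup>b\<^sup>d\<^sub>c \<omega>\<^sub>d - B\<^sup>a\<^sup>b\<^sub>c \<omega>\<close>,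
  with \<open>A1 a b c d = A\<^sup>a\<^sub>b\<^sub>c\<^sub>d\<close> antisymmetric in \<open>c, d\<close> and conjugate \<open>A\<^sub>a\<^sup>b\<^sup>c\<^sup>d\<close>, \<open>A2 a d b c = A\<^sup>a\<^sup>d\<^sub>b\<^sub>c\<close>,
  \<open>B2 a b c d = B\<^sup>a\<^sup>b\<^sub>c\<^sub>d\<close>, \<open>B3 a b d c = B\<^sup>a\<^sup>b\<^sup>d\<^sub>c\<close>. So \<open>A1\<close>, \<open>A2\<close> are the curvature coefficients of the unitary
  connection \<open>-\<omega>\<^sup>a\<^sub>b\<close>, and \<open>B2\<close>, \<open>B3\<close> those of the covariant differential of \<open>B\<^sup>a\<^sup>b\<^sub>c\<close>. With these signs,
  writing \<open>R(i;j,k,l)\<close> for \<open>R\<^sup>i\<^sub>j\<^sub>k\<^sub>l\<close>,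
    \<open>R(a;b,c,d) = 2 A\<^sup>a\<^sub>b\<^sub>c\<^sub>d\<close>,
    \<open>R(a;b,c,hat n d) = A\<^sup>a\<^sup>d\<^sub>b\<^sub>c - B\<^sup>a\<^sup>h\<^sub>c B\<^sub>b\<^sub>h\<^sup>d - \<delta>\<^sup>a\<^sub>c \<delta>\<^sup>d\<^sub>b\<close>,
    \<open>R(a;hat n b,c,d) = 2 (B\<^sup>a\<^sup>b\<^sub>[\<^sub>c\<^sub>d\<^sub>] - \<delta>\<^sup>a\<^sub>[\<^sub>c \<delta>\<^sup>b\<^sub>d\<^sub>])\<close>,
    \<open>R(a;hat n b,c,hat n d) = B\<^sup>a\<^sup>b\<^sup>d\<^sub>c - B\<^sup>a\<^sup>b\<^sub>h B\<^sup>h\<^sup>d\<^sub>c\<close>.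
\<close>

definition structure_eqs2 ::
    "nat \<Rightarrow> ('m::{t2_space,second_countable_topology}, 'e::euclidean_space) atlas \<Rightarrow> 'm set
       \<Rightarrow> (nat \<Rightarrow> 'm form1) \<Rightarrow> (nat \<Rightarrow> nat \<Rightarrow> 'm form1)
       \<Rightarrow> (nat \<Rightarrow> nat \<Rightarrow> nat \<Rightarrow> 'm \<Rightarrow> complex)
       \<Rightarrow> (nat \<Rightarrow> nat \<Rightarrow> nat \<Rightarrow> nat \<Rightarrow> 'm \<Rightarrow> complex) \<Rightarrow> (nat \<Rightarrow> nat \<Rightarrow> nat \<Rightarrow> nat \<Rightarrow> 'm \<Rightarrow> complex)
       \<Rightarrow> (nat \<Rightarrow> nat \<Rightarrow> nat \<Rightarrow> nat \<Rightarrow> 'm \<Rightarrow> complex) \<Rightarrow> (nat \<Rightarrow> nat \<Rightarrow> nat \<Rightarrow> nat \<Rightarrow> 'm \<Rightarrow> complex)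
       \<Rightarrow> bool" where
  "structure_eqs2 n A U w w1 B A1 A2 B2 B3 \<longleftrightarrow>
     (\<forall>p\<in>U.
       (\<forall>a\<in>{1..n}. \<forall>b\<in>{1..n}. \<forall>c\<in>{1..n}. \<forall>d\<in>{1..n}. A1 a b c d p = - A1 a b d c p) \<and>
       (\<forall>X\<in>vfields A. \<forall>Y\<in>vfields A. \<forall>a\<in>{1..n}. \<forall>b\<in>{1..n}.
          ext_d (w1 a b) X Y p =
            (\<Sum>c=1..n. wedge (w1 a c) (w1 c b) X Y p)
            - (\<Sum>c=1..n. \<Sum>d=1..n. A1 a b c d p * wedge (w c) (w d) X Y p)
            - (\<Sum>c=1..n. \<Sum>d=1..n. A2 a d b c p * wedge (w c) (w (hat n d)) X Y p)
            + (\<Sum>c=1..n. \<Sum>d=1..n. cnj (A1 b a c d p) * wedge (w (hat n c)) (w (hat n d)) X Y p)) \<and>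
       (\<forall>X\<in>vfields A. \<forall>a\<in>{1..n}. \<forall>b\<in>{1..n}. \<forall>c\<in>{1..n}.
          cder X (B a b c) p
            + (\<Sum>h=1..n. B a b h p * w1 h c X p)
            - (\<Sum>h=1..n. B h b c p * w1 a h X p)
            - (\<Sum>h=1..n. B a h c p * w1 b h X p) =
            (\<Sum>d=1..n. B2 a b c d p * w d X p)
            + (\<Sum>d=1..n. B3 a b d c p * w (hat n d) X p)
            - B a b c p * w 0 X p))"

definition structure_functions ::
    "nat \<Rightarrow> ('m::{t2_space,second_countable_topology}, 'e::euclidean_space) atlas
       \<Rightarrow> ('m vfield \<Rightarrow> 'm vfield) \<Rightarrow> 'm vfield \<Rightarrow> 'm metric \<Rightarrow> 'm set \<Rightarrow> (nat \<Rightarrow> 'm vfield)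
       \<Rightarrow> (nat \<Rightarrow> nat \<Rightarrow> nat \<Rightarrow> 'm \<Rightarrow> complex)
       \<Rightarrow> (nat \<Rightarrow> nat \<Rightarrow> nat \<Rightarrow> nat \<Rightarrow> 'm \<Rightarrow> complex) \<Rightarrow> (nat \<Rightarrow> nat \<Rightarrow> nat \<Rightarrow> nat \<Rightarrow> 'm \<Rightarrow> complex)
       \<Rightarrow> (nat \<Rightarrow> nat \<Rightarrow> nat \<Rightarrow> nat \<Rightarrow> 'm \<Rightarrow> complex) \<Rightarrow> (nat \<Rightarrow> nat \<Rightarrow> nat \<Rightarrow> nat \<Rightarrow> 'm \<Rightarrow> complex)
       \<Rightarrow> bool" where
  "structure_functions n A \<Phi> \<xi> g U e B A1 A2 B2 B3 \<longleftrightarrow>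
     AG_section n A \<Phi> \<xi> g U e \<and>
     (\<exists>w w1. dual_coframe n A \<Phi> \<xi> U e w \<and> structure_eqs1 n A U w w1 B \<and>
             structure_eqs2 n A U w w1 B A1 A2 B2 B3)"

definition alt2 :: "(nat \<Rightarrow> nat \<Rightarrow> complex) \<Rightarrow> nat \<Rightarrow> nat \<Rightarrow> complex" where
  "alt2 T c d = (T c d - T d c) / 2"

end

theory Submission
  imports Defs
begin

text \<open>
  The class condition determines the connection forms of the A-frame: \<open>\<nabla>\<^sub>X \<xi> = X - \<eta>(X) \<xi>\<close>, and the mixed
  forms are \<open>-B\<^sup>a\<^sup>b\<^sub>c \<omega>\<^sup>c\<close>. The first structure equations therefore have a solution, and a comparison of
  coefficients shows that it is the only one. Cartan's second structure equation then turns \<open>A\<^sup>a\<^sub>b\<^sub>c\<^sub>d\<close>,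
  \<open>A\<^sup>a\<^sup>d\<^sub>b\<^sub>c\<close>, \<open>B\<^sup>a\<^sup>b\<^sub>[\<^sub>c\<^sub>d\<^sub>]\<close> into components of the Riemann tensor; together with \<open>R(X, Y)\<xi>\<close>, the pair symmetry and
  conjugation they give all of it. Taking \<open>\<xi>\<close> in two arguments of the condition on the generalized curvature
  yields the Ricci tensor, after which the condition prescribes the Riemann tensor.

  As vector fields are derivations of the global smooth functions, bump functions and Hadamard's lemma are
  needed to see that the tangent spaces have the right dimension and that adapted frames exist near
  every point.
\<close>

section \<open>Smooth maps between Euclidean spaces\<close>

lemma Ck_on_cong:
  assumes "open S" "\<And>x. x \<in> S \<Longrightarrow> f x = g x"
  shows "Ck_on k f S \<longleftrightarrow> Ck_on k g S"
  using assms(2)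
proof (induction k arbitrary: f g)
  case 0
  then show ?case by (simp cong: continuous_on_cong)
next
  case (Suc k)
  have "(f has_derivative f') (at x) \<longleftrightarrow> (g has_derivative f') (at x)" if "x \<in> S" for x f'
    using has_derivative_transform_within_open[OF _ \<open>open S\<close> that] Suc.prems by metis
  then have *: "f differentiable (at x) \<longleftrightarrow> g differentiable (at x)"
      "frechet_derivative f (at x) = frechet_derivative g (at x)" if "x \<in> S" for x
    using that by (simp_all add: differentiable_def frechet_derivative_def)
  have "Ck_on k (\<lambda>x. frechet_derivative f (at x) v) S
      \<longleftrightarrow> Ck_on k (\<lambda>x. frechet_derivative g (at x) v) S" for v
    by (rule Suc.IH) (simp add: *)
  then show ?case by (simp add: *)
qed

lemma Ck_on_subset: "Ck_on k f S \<Longrightarrow> T \<subseteq> S \<Longrightarrow> Ck_on k f T"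
  by (induction k arbitrary: f) (auto intro: continuous_on_subset)

lemma Ck_on_SucI:
  assumes "open S" "\<And>x. x \<in> S \<Longrightarrow> (f has_derivative f' x) (at x)"
    "\<And>v. Ck_on k (\<lambda>x. f' x v) S"
  shows "Ck_on (Suc k) f S"
proof -
  have "frechet_derivative f (at x) = f' x" if "x \<in> S" for x
    using frechet_derivative_at[OF assms(2)[OF that]] by simp
  then have "Ck_on k (\<lambda>x. frechet_derivative f (at x) v) S" for v
    by (subst Ck_on_cong[OF assms(1), of _ "\<lambda>x. f' x v"]) (simp_all add: assms(3))
  then show ?thesis using assms(2) by (auto simp: differentiable_def)
qed

lemma Ck_on_SucD:
  assumes "Ck_on (Suc k) f S"
  shows "x \<in> S \<Longrightarrow> (f has_derivative frechet_derivative f (at x)) (at x)"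
    and "Ck_on k (\<lambda>x. frechet_derivative f (at x) v) S"
  using assms by (auto simp: frechet_derivative_works)

lemma Ck_on_Suc_imp: "Ck_on (Suc k) f S \<Longrightarrow> Ck_on k f S"
proof (induction k arbitrary: f)
  case 0
  then have "\<forall>x\<in>S. isCont f x"
    by (auto intro: differentiable_imp_continuous_within)
  then show ?case by (simp add: continuous_at_imp_continuous_on)
next
  case (Suc k)
  have "f differentiable at x" if "x \<in> S" for x using Suc.prems that by simp
  moreover have "Ck_on k (\<lambda>x. frechet_derivative f (at x) v) S" for v
    by (rule Suc.IH) (use Suc.prems Ck_on.simps(2)[of "Suc k"] in blast)
  ultimately show ?case using Ck_on.simps(2) by blast
qed

lemma Ck_on_union:
  assumes "\<And>x. x \<in> S \<Longrightarrow> \<exists>T. open T \<and> x \<in> T \<and> Ck_on k f T"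
  shows "Ck_on k f S"
  using assms
proof (induction k arbitrary: f)
  case 0
  have "continuous (at x) f" if "x \<in> S" for x
    using 0[OF that] by (auto simp: continuous_on_eq_continuous_at)
  then show ?case by (simp add: continuous_at_imp_continuous_on)
next
  case (Suc k)
  have "f differentiable (at x)" if "x \<in> S" for x
    using Suc.prems[OF that] by auto
  moreover have "Ck_on k (\<lambda>x. frechet_derivative f (at x) v) S" for v
    by (rule Suc.IH) (use Suc.prems in \<open>force\<close>)
  ultimately show ?case by simp
qed

lemma Ck_on_const: "Ck_on k (\<lambda>x. c) S"
proof (induction k arbitrary: c)
  case (Suc k)
  then show ?case by (simp add: frechet_derivative_const)
qed simp

lemma Ck_on_bounded_linear:
  assumes "bounded_linear h"
  shows "Ck_on k h S"
proof (cases k)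
  case 0
  then show ?thesis
    using assms by (simp add: bounded_linear.linear linear_continuous_on)
next
  case (Suc j)
  have "(h has_derivative h) (at x)" for x
    using bounded_linear_imp_has_derivative[OF assms] .
  then have "h differentiable (at x)" "frechet_derivative h (at x) = h" for x
    using frechet_derivative_at[of h h x] by (auto simp: differentiable_def)
  then show ?thesis by (simp add: Suc Ck_on_const)
qed

lemma Ck_on_add:
  assumes "open S" "Ck_on k f S" "Ck_on k g S"
  shows "Ck_on k (\<lambda>x. f x + g x) S"
  using assms(2,3)
proof (induction k arbitrary: f g)
  case (Suc k)
  note f = Ck_on_SucD[OF Suc.prems(1)] and g = Ck_on_SucD[OF Suc.prems(2)]
  show ?case
    by (rule Ck_on_SucI[OF \<open>open S\<close> has_derivative_add[OF f(1) g(1)] Suc.IH[OF f(2) g(2)]])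
qed (simp add: continuous_intros)

lemma Ck_on_sum:
  assumes "open S" "\<And>i. i \<in> I \<Longrightarrow> Ck_on k (f i) S"
  shows "Ck_on k (\<lambda>x. \<Sum>i\<in>I. f i x) S"
  using assms(2)
proof (induction I rule: infinite_finite_induct)
  case (insert i I)
  then show ?case by (simp add: Ck_on_add[OF assms(1)])
qed (simp_all add: Ck_on_const)

lemma Ck_on_mult:
  fixes f g :: "'a::real_normed_vector \<Rightarrow> real"
  assumes "open S" "Ck_on k f S" "Ck_on k g S"
  shows "Ck_on k (\<lambda>x. f x * g x) S"
  using assms(2,3)
proof (induction k arbitrary: f g)
  case (Suc k)
  note f = Ck_on_SucD[OF Suc.prems(1)] and g = Ck_on_SucD[OF Suc.prems(2)]
  note f0 = Suc.prems(1)[THEN Ck_on_Suc_imp] and g0 = Suc.prems(2)[THEN Ck_on_Suc_imp]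
  show ?case
    by (rule Ck_on_SucI[OF \<open>open S\<close> has_derivative_mult[OF f(1) g(1)]
          Ck_on_add[OF \<open>open S\<close> Suc.IH[OF f0 g(2)] Suc.IH[OF f(2) g0]]])
qed (simp add: continuous_intros)

lemma Ck_on_bounded_linear_comp:
  assumes "open S" "bounded_linear h" "Ck_on k f S"
  shows "Ck_on k (\<lambda>x. h (f x)) S"
  using assms(3)
proof (induction k arbitrary: f)
  case (Suc k)
  note f = Ck_on_SucD[OF Suc.prems]
  show ?case
    by (rule Ck_on_SucI[OF \<open>open S\<close> bounded_linear.has_derivative[OF assms(2) f(1)] Suc.IH[OF f(2)]])
qed (use assms(2) in \<open>simp add: bounded_linear.continuous_on\<close>)

lemma Ck_on_compose:
  fixes f :: "'b::euclidean_space \<Rightarrow> real"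
  assumes "open S" "open T" "h ` S \<subseteq> T" "Ck_on k f T" "Ck_on k h S"
  shows "Ck_on k (\<lambda>x. f (h x)) S"
  using assms(4,5)
proof (induction k arbitrary: f)
  case 0
  then show ?case using assms(3) by (auto intro: continuous_on_compose2)
next
  case (Suc k)
  note f = Ck_on_SucD[OF Suc.prems(1)] and h = Ck_on_SucD[OF Suc.prems(2)]
  show ?case
  proof (rule Ck_on_SucI[OF \<open>open S\<close>])
    fix x assume x: "x \<in> S"
    then have hx: "h x \<in> T" using assms(3) by auto
    have lin: "linear (frechet_derivative f (at (h x)))"
      using f(1)[OF hx] has_derivative_linear by blast
    have "((\<lambda>x. f (h x)) has_derivative
        (\<lambda>v. frechet_derivative f (at (h x)) (frechet_derivative h (at x) v))) (at x)"
      using has_derivative_compose[OF h(1)[OF x] f(1)[OF hx]] .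
    moreover have "frechet_derivative f (at (h x)) w
        = (\<Sum>b\<in>Basis. frechet_derivative f (at (h x)) b * (w \<bullet> b))" for w
    proof -
      have "frechet_derivative f (at (h x)) w
          = frechet_derivative f (at (h x)) (\<Sum>b\<in>Basis. (w \<bullet> b) *\<^sub>R b)"
        by (simp only: euclidean_representation)
      then show ?thesis
        by (simp add: linear_sum[OF lin] linear_scale[OF lin] mult.commute)
    qed
    then have "(\<lambda>v. frechet_derivative f (at (h x)) (frechet_derivative h (at x) v)) =
        (\<lambda>v. \<Sum>b\<in>Basis. frechet_derivative f (at (h x)) b * (frechet_derivative h (at x) v \<bullet> b))"
      by (rule ext)
    ultimately show "((\<lambda>x. f (h x)) has_derivative (\<lambda>v. \<Sum>b\<in>Basis.
        frechet_derivative f (at (h x)) b * (frechet_derivative h (at x) v \<bullet> b))) (at x)"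
      by (rule has_derivative_eq_rhs)
  next
    fix v
    show "Ck_on k (\<lambda>x. \<Sum>b\<in>Basis.
        frechet_derivative f (at (h x)) b * (frechet_derivative h (at x) v \<bullet> b)) S"
      by (intro Ck_on_sum Ck_on_mult Suc.IH f h Ck_on_Suc_imp[OF Suc.prems(2)]
          Ck_on_bounded_linear_comp[OF _ bounded_linear_inner_left] assms(1))
  qed
qed

lemma Ck_on_powr:
  fixes f :: "'a::real_normed_vector \<Rightarrow> real"
  assumes "open S" "\<And>x. x \<in> S \<Longrightarrow> f x > 0" "Ck_on k f S"
  shows "Ck_on k (\<lambda>x. f x powr r) S"
  using assms(3)
proof (induction k arbitrary: r)
  case 0
  have "\<forall>x\<in>S. f x \<noteq> 0" using assms(2) by force
  with 0 show ?case by (simp add: continuous_on_powr)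
next
  case (Suc k)
  note f = Ck_on_SucD[OF Suc.prems]
  show ?case
  proof (rule Ck_on_SucI[OF \<open>open S\<close>])
    fix x assume x: "x \<in> S"
    have "((\<lambda>y. y powr r) has_derivative (\<lambda>v. r * f x powr (r - 1) * v)) (at (f x))"
      using has_real_derivative_powr[OF assms(2)[OF x], of r]
      by (simp add: has_field_derivative_def)
    from has_derivative_compose[OF f(1)[OF x] this]
    show "((\<lambda>x. f x powr r) has_derivative
        (\<lambda>v. r * f x powr (r - 1) * frechet_derivative f (at x) v)) (at x)" .
  next
    fix v
    show "Ck_on k (\<lambda>x. r * f x powr (r - 1) * frechet_derivative f (at x) v) S"
      by (intro Ck_on_mult f Suc.IH Ck_on_const Ck_on_Suc_imp[OF Suc.prems] assms(1))
  qed
qed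

lemma Cinf_on_imp_differentiable: "Cinf_on f S \<Longrightarrow> x \<in> S \<Longrightarrow> f differentiable (at x)"
  unfolding Cinf_on_def using Ck_on.simps(2) by blast

lemma Cinf_on_frechet_derivative:
  "Cinf_on f S \<Longrightarrow> Cinf_on (\<lambda>x. frechet_derivative f (at x) v) S"
  unfolding Cinf_on_def using Ck_on.simps(2) by blast

lemma Cinf_on_cong:
  "open S \<Longrightarrow> (\<And>x. x \<in> S \<Longrightarrow> f x = g x) \<Longrightarrow> Cinf_on f S \<longleftrightarrow> Cinf_on g S"
  unfolding Cinf_on_def using Ck_on_cong by blast

lemma Cinf_on_subset: "Cinf_on f S \<Longrightarrow> T \<subseteq> S \<Longrightarrow> Cinf_on f T"
  unfolding Cinf_on_def using Ck_on_subset by blast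

lemma Cinf_on_union:
  "(\<And>x. x \<in> S \<Longrightarrow> \<exists>T. open T \<and> x \<in> T \<and> Cinf_on f T) \<Longrightarrow> Cinf_on f S"
  unfolding Cinf_on_def by (meson Ck_on_union)

lemma Cinf_on_const: "Cinf_on (\<lambda>x. c) S"
  by (simp add: Cinf_on_def Ck_on_const)

lemma Cinf_on_bounded_linear: "bounded_linear h \<Longrightarrow> Cinf_on h S"
  by (simp add: Cinf_on_def Ck_on_bounded_linear)

lemma Cinf_on_add: "open S \<Longrightarrow> Cinf_on f S \<Longrightarrow> Cinf_on g S \<Longrightarrow> Cinf_on (\<lambda>x. f x + g x) S"
  by (simp add: Cinf_on_def Ck_on_add)

lemma Cinf_on_sum:
  "open S \<Longrightarrow> (\<And>i. i \<in> I \<Longrightarrow> Cinf_on (f i) S) \<Longrightarrow> Cinf_on (\<lambda>x. \<Sum>i\<in>I. f i x) S"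
  by (simp add: Cinf_on_def Ck_on_sum)

lemma Cinf_on_mult:
  fixes f g :: "'a::real_normed_vector \<Rightarrow> real"
  shows "open S \<Longrightarrow> Cinf_on f S \<Longrightarrow> Cinf_on g S \<Longrightarrow> Cinf_on (\<lambda>x. f x * g x) S"
  by (simp add: Cinf_on_def Ck_on_mult)

lemma Cinf_on_diff:
  fixes f g :: "'a::real_normed_vector \<Rightarrow> real"
  assumes "open S" "Cinf_on f S" "Cinf_on g S"
  shows "Cinf_on (\<lambda>x. f x - g x) S"
  using Cinf_on_add[OF assms(1,2) Cinf_on_mult[OF assms(1) Cinf_on_const[of "-1"] assms(3)]] by simp

lemma Cinf_on_compose:
  fixes f :: "'b::euclidean_space \<Rightarrow> real"
  shows "open S \<Longrightarrow> open T \<Longrightarrow> h ` S \<subseteq> T \<Longrightarrow> Cinf_on f T \<Longrightarrow> Cinf_on h S \<Longrightarrow> Cinf_on (\<lambda>x. f (h x)) S"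
  by (simp add: Cinf_on_def Ck_on_compose)

lemma Cinf_on_powr:
  fixes f :: "'a::real_normed_vector \<Rightarrow> real"
  shows "open S \<Longrightarrow> (\<And>x. x \<in> S \<Longrightarrow> f x > 0) \<Longrightarrow> Cinf_on f S \<Longrightarrow> Cinf_on (\<lambda>x. f x powr r) S"
  by (simp add: Cinf_on_def Ck_on_powr)


definition flat_exp :: "nat \<Rightarrow> real \<Rightarrow> real" where
  "flat_exp k t = (if t > 0 then inverse t ^ k * exp (- inverse t) else 0)"

lemma flat_exp_tendsto_0: "(flat_exp k \<longlongrightarrow> 0) (at_right 0)"
proof -
  have "((\<lambda>t::real. inverse t ^ k / exp (inverse t)) \<longlongrightarrow> 0) (at_right 0)"
    by (rule filterlim_compose[OF tendsto_power_div_exp_0 filterlim_inverse_at_top_right])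
  moreover have "\<forall>\<^sub>F t in at_right 0. inverse t ^ k / exp (inverse t) = flat_exp k t"
    by (auto simp: eventually_at_right_field flat_exp_def exp_minus divide_inverse intro!: exI[of _ 1])
  ultimately show ?thesis by (rule Lim_transform_eventually)
qed

lemma flat_exp_has_real_derivative:
  "(flat_exp k has_real_derivative flat_exp (k + 2) t - real k * flat_exp (k + 1) t) (at t)"
proof (cases t "0::real" rule: linorder_cases)
  case less
  have "((\<lambda>_. 0) has_real_derivative 0) (at t)" by simp
  then have "(flat_exp k has_real_derivative 0) (at t)"
    by (rule has_field_derivative_transform_within_open[of _ _ _ "{..<0}"])
      (use less in \<open>auto simp: flat_exp_def\<close>)
  with less show ?thesis by (simp add: flat_exp_def)
next
  case equal
  have "((\<lambda>h. (flat_exp k (0 + h) - flat_exp k 0) / h) \<longlongrightarrow> 0) (at 0)"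
  proof (rule filterlim_split_at_real)
    have "\<forall>\<^sub>F h in at_left 0. 0 = (flat_exp k (0 + h) - flat_exp k 0) / h"
      by (auto simp: eventually_at_left_field flat_exp_def intro!: exI[of _ "-1"])
    then show "((\<lambda>h. (flat_exp k (0 + h) - flat_exp k 0) / h) \<longlongrightarrow> 0) (at_left 0)"
      by (rule Lim_transform_eventually[OF tendsto_const])
    have "\<forall>\<^sub>F h in at_right 0. flat_exp (k + 1) h = (flat_exp k (0 + h) - flat_exp k 0) / h"
      by (auto simp: eventually_at_right_field flat_exp_def divide_inverse intro!: exI[of _ 1])
    then show "((\<lambda>h. (flat_exp k (0 + h) - flat_exp k 0) / h) \<longlongrightarrow> 0) (at_right 0)"
      by (rule Lim_transform_eventually[OF flat_exp_tendsto_0])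
  qed
  with equal show ?thesis by (simp add: DERIV_def flat_exp_def)
next
  case greater
  have "((\<lambda>t. inverse t ^ k * exp (- inverse t)) has_real_derivative
      flat_exp (k + 2) t - real k * flat_exp (k + 1) t) (at t)"
    using greater
    by (auto intro!: derivative_eq_intros simp: flat_exp_def power2_eq_square field_simps)
      (cases k; simp add: field_simps)+
  then show ?thesis
    by (rule has_field_derivative_transform_within_open[of _ _ _ "{0<..}"])
      (use greater in \<open>auto simp: flat_exp_def\<close>)
qed

lemma Ck_on_flat_exp: "Ck_on m (flat_exp k) UNIV"
proof (induction m arbitrary: k)
  case 0
  show ?case
    using DERIV_isCont[OF flat_exp_has_real_derivative] by (simp add: continuous_at_imp_continuous_on)
next
  case (Suc m)
  have mult: "Ck_on m (\<lambda>t. c * flat_exp j t) UNIV" for c j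
    by (intro Ck_on_mult Suc.IH Ck_on_const open_UNIV)
  show ?case
  proof (rule Ck_on_SucI[OF open_UNIV])
    show "(flat_exp k has_derivative
        (\<lambda>v. (1 * flat_exp (k + 2) t + - real k * flat_exp (k + 1) t) * v)) (at t)" for t
      using flat_exp_has_real_derivative[of k t] by (simp add: has_field_derivative_def)
  qed (intro Ck_on_mult[OF _ Ck_on_add] mult Ck_on_const open_UNIV)
qed

lemma bump_function:
  fixes c :: "'a::euclidean_space"
  assumes "r > 0"
  obtains \<beta> :: "'a \<Rightarrow> real" where "Cinf_on \<beta> UNIV"
    "\<forall>x\<in>ball c (r / 2). \<beta> x = 1" "\<forall>x. x \<notin> cball c r \<longrightarrow> \<beta> x = 0"
proof
  define h where "h = flat_exp 0"
  define q where "q x = (x - c) \<bullet> (x - c)" for x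
  define \<beta> where "\<beta> x = h (r\<^sup>2 - q x) * (h (r\<^sup>2 - q x) + h (q x - (r / 2)\<^sup>2)) powr - 1" for x
  have h_pos: "t > 0 \<Longrightarrow> h t > 0" and h_0: "t \<le> 0 \<Longrightarrow> h t = 0" and h_nonneg: "h t \<ge> 0" for t
    by (auto simp: h_def flat_exp_def)
  have q: "q x = (dist c x)\<^sup>2" for x
    by (simp add: q_def dist_norm norm_minus_commute[of c] power2_norm_eq_inner)
  have "q = (\<lambda>x. \<Sum>b\<in>Basis. (x \<bullet> b - c \<bullet> b) * (x \<bullet> b - c \<bullet> b))"
    unfolding q_def by (subst euclidean_inner) (simp only: inner_diff_left)
  then have Cq: "Cinf_on q UNIV"
    by (simp only:) (intro Cinf_on_sum Cinf_on_mult Cinf_on_diff Cinf_on_const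
        Cinf_on_bounded_linear[OF bounded_linear_inner_left] open_UNIV)
  have Ch: "Cinf_on h T" for T
    using Ck_on_subset[OF Ck_on_flat_exp subset_UNIV] by (simp add: h_def Cinf_on_def)
  have Chq: "Cinf_on (\<lambda>x. h (r\<^sup>2 - q x)) UNIV" "Cinf_on (\<lambda>x. h (q x - (r / 2)\<^sup>2)) UNIV"
    by (intro Cinf_on_compose[OF _ open_UNIV _ Ch] Cinf_on_diff Cinf_on_const Cq open_UNIV subset_UNIV)+
  have pos: "h (r\<^sup>2 - q x) + h (q x - (r / 2)\<^sup>2) > 0" for x
  proof (cases "q x < r\<^sup>2")
    case True
    then show ?thesis using h_pos[of "r\<^sup>2 - q x"] h_nonneg by (simp add: add_pos_nonneg)
  next
    case False
    then have "q x > (r / 2)\<^sup>2" using mult_pos_pos[OF assms assms] by (simp add: power2_eq_square)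
    then show ?thesis using h_pos[of "q x - (r / 2)\<^sup>2"] h_nonneg by (simp add: add_nonneg_pos)
  qed
  show "Cinf_on \<beta> UNIV"
    unfolding \<beta>_def by (intro Cinf_on_mult Cinf_on_powr Cinf_on_add Chq open_UNIV pos)
  show "\<forall>x\<in>ball c (r / 2). \<beta> x = 1"
  proof
    fix x assume "x \<in> ball c (r / 2)"
    then have "q x \<le> (r / 2)\<^sup>2" using assms by (simp add: q)
    then have "h (q x - (r / 2)\<^sup>2) = 0" by (simp add: h_0)
    moreover from this have "h (r\<^sup>2 - q x) > 0" using pos[of x] by simp
    ultimately show "\<beta> x = 1" by (simp add: \<beta>_def powr_minus)
  qed
  show "\<forall>x. x \<notin> cball c r \<longrightarrow> \<beta> x = 0"
    using assms by (simp add: \<beta>_def q h_0)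
qed

text \<open>Differentiation under the integral sign; the factor \<open>t ^ j\<close> makes the class of integrals
  closed under it.\<close>

lemma Ck_on_segment_integral:
  fixes F :: "'a::euclidean_space \<Rightarrow> real"
  assumes "open S" "convex S" "y \<in> S" "Ck_on k F S"
  shows "Ck_on k (\<lambda>x. integral (cbox 0 1) (\<lambda>t. t ^ j * F (y + t *\<^sub>R (x - y)))) S"
  using assms(4)
proof (induction k arbitrary: F j)
  case 0
  have seg: "y + t *\<^sub>R (x - y) \<in> S" if "x \<in> S" "t \<in> cbox 0 1" for x t
    using convexD_alt[OF assms(2,3) that(1), of t] that(2) by (simp add: algebra_simps)
  have "continuous_on (S \<times> cbox 0 1) (\<lambda>(x, t). t ^ j * F (y + t *\<^sub>R (x - y)))"
    using 0 seg by (auto simp: split_beta intro!: continuous_intros continuous_on_compose2[of S F])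
  from integral_continuous_on_param[OF this] show ?case by simp
next
  case (Suc k)
  have seg: "y + t *\<^sub>R (x - y) \<in> S" if "x \<in> S" "t \<in> cbox 0 1" for x t
    using convexD_alt[OF assms(2,3) that(1), of t] that(2) by (simp add: algebra_simps)
  note F = Ck_on_SucD[OF Suc.prems]
  have cont: "continuous_on S F"
    using F(1) by (meson continuous_at_imp_continuous_on has_derivative_continuous)
  have contD: "continuous_on S (\<lambda>x. frechet_derivative F (at x) v)" for v
    using F(2) by (induction k) (auto intro: Ck_on_Suc_imp simp del: Ck_on.simps(2))
  define D where "D x t = (\<Sum>b\<in>Basis. (t ^ Suc j * frechet_derivative F (at (y + t *\<^sub>R (x - y))) b)
      *\<^sub>R blinfun_inner_left b)" for x and t :: real
  have D: "((\<lambda>x. t ^ j * F (y + t *\<^sub>R (x - y))) has_derivative blinfun_apply (D x t)) (at x)"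
    if "x \<in> S" "t \<in> cbox 0 1" for x t
  proof -
    let ?D = "frechet_derivative F (at (y + t *\<^sub>R (x - y)))"
    have lin: "linear ?D" using F(1)[OF seg[OF that]] has_derivative_linear by blast
    have "((\<lambda>x. y + t *\<^sub>R (x - y)) has_derivative (\<lambda>v. t *\<^sub>R v)) (at x)"
      by (auto intro!: derivative_eq_intros)
    from has_derivative_compose[OF this F(1)[OF seg[OF that]]]
    have "((\<lambda>x. t ^ j * F (y + t *\<^sub>R (x - y))) has_derivative (\<lambda>v. t ^ j * ?D (t *\<^sub>R v))) (at x)"
      by (intro has_derivative_mult_right)
    moreover have "t ^ j * ?D (t *\<^sub>R v) = blinfun_apply (D x t) v" for v
    proof -
      have "?D v = ?D (\<Sum>b\<in>Basis. (v \<bullet> b) *\<^sub>R b)" by (simp only: euclidean_representation)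
      then have "?D v = (\<Sum>b\<in>Basis. (v \<bullet> b) * ?D b)"
        by (simp add: linear_sum[OF lin] linear_scale[OF lin])
      then show ?thesis
        unfolding linear_scale[OF lin]
        by (simp add: D_def blinfun.sum_left blinfun.scaleR_left sum_distrib_left algebra_simps)
    qed
    ultimately show ?thesis by (metis (no_types, lifting) ext has_derivative_eq_rhs)
  qed
  have cD: "continuous_on (S \<times> cbox 0 1) (\<lambda>(x, t). D x t)"
    unfolding D_def split_beta
    by (intro continuous_intros continuous_on_compose2[OF contD]) (auto intro!: seg simp del: mem_box)
  show ?case
  proof (rule Ck_on_SucI[OF \<open>open S\<close>])
    fix x assume x: "x \<in> S"
    have "continuous_on (cbox 0 1) (\<lambda>t. t ^ j * F (y + t *\<^sub>R (x - y)))" if "x \<in> S" for x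
      by (intro continuous_intros continuous_on_compose2[OF cont]) (auto intro!: seg[OF that] simp del: mem_box)
    then have "((\<lambda>x. integral (cbox 0 1) (\<lambda>t. t ^ j * F (y + t *\<^sub>R (x - y)))) has_derivative
        blinfun_apply (integral (cbox 0 1) (D x))) (at x within S)"
      by (intro leibniz_rule[OF _ _ cD x assms(2)] has_derivative_at_withinI[OF D] integrable_continuous)
    then show "((\<lambda>x. integral (cbox 0 1) (\<lambda>t. t ^ j * F (y + t *\<^sub>R (x - y)))) has_derivative
        blinfun_apply (integral (cbox 0 1) (D x))) (at x)"
      by (simp add: at_within_open[OF x \<open>open S\<close>])
  next
    fix v
    have "blinfun_apply (integral (cbox 0 1) (D x)) v = (\<Sum>b\<in>Basis. integral (cbox 0 1)
        (\<lambda>t. t ^ Suc j * frechet_derivative F (at (y + t *\<^sub>R (x - y))) b) * (v \<bullet> b))"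
      if x: "x \<in> S" for x
    proof -
      have c: "continuous_on (cbox 0 1) (\<lambda>t. frechet_derivative F (at (y + t *\<^sub>R (x - y))) b)" for b
        by (intro continuous_intros continuous_on_compose2[OF contD]) (auto intro!: seg[OF x] simp del: mem_box)
      have "integral (cbox 0 1) (D x) = (\<Sum>b\<in>Basis. integral (cbox 0 1)
        (\<lambda>t. t ^ Suc j * frechet_derivative F (at (y + t *\<^sub>R (x - y))) b) *\<^sub>R blinfun_inner_left b)"
        unfolding D_def
        by (intro integral_unique has_integral_sum has_integral_scaleR_left integrable_integral
            integrable_continuous continuous_intros c finite_Basis)
      then show ?thesis by (simp add: blinfun.sum_left blinfun.scaleR_left)
    qed
    then show "Ck_on k (\<lambda>x. blinfun_apply (integral (cbox 0 1) (D x)) v) S"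
      by (subst Ck_on_cong[OF \<open>open S\<close>], assumption)
        (intro Ck_on_sum Ck_on_mult Suc.IH F(2) Ck_on_const \<open>open S\<close>)
  qed
qed

lemma Hadamard:
  fixes f :: "'a::euclidean_space \<Rightarrow> real"
  assumes "open S" "convex S" "y \<in> S" "Cinf_on f S"
  obtains G where "\<And>b. Cinf_on (G b) S" "\<And>b. G b y = frechet_derivative f (at y) b"
    "\<And>x. x \<in> S \<Longrightarrow> f x = f y + (\<Sum>b\<in>Basis. ((x - y) \<bullet> b) * G b x)"
proof
  let ?g = "\<lambda>b x. frechet_derivative f (at x) b"
  let ?G = "\<lambda>b x. integral (cbox 0 1) (\<lambda>t. t ^ 0 * ?g b (y + t *\<^sub>R (x - y)))"
  show "Cinf_on (?G b) S" for b
    using Cinf_on_frechet_derivative[OF assms(4), of b]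
    unfolding Cinf_on_def by (intro allI Ck_on_segment_integral assms) simp
  show "?G b y = frechet_derivative f (at y) b" for b by simp
  show "f x = f y + (\<Sum>b\<in>Basis. ((x - y) \<bullet> b) * ?G b x)" if x: "x \<in> S" for x
  proof -
    have seg: "y + t *\<^sub>R (x - y) \<in> S" if "t \<in> cbox 0 1" for t
      using convexD_alt[OF assms(2,3) x, of t] that by (simp add: algebra_simps)
    have Df: "(f has_derivative frechet_derivative f (at z)) (at z)" if "z \<in> S" for z
      using Cinf_on_imp_differentiable[OF assms(4) that] by (simp add: frechet_derivative_works)
    have cont: "continuous_on S (?g b)" for b
      using Cinf_on_frechet_derivative[OF assms(4), of b] by (metis Cinf_on_def Ck_on.simps(1))
    have c: "continuous_on (cbox 0 1) (\<lambda>t. ?g b (y + t *\<^sub>R (x - y)))" for b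
      by (intro continuous_intros continuous_on_compose2[OF cont]) (auto intro!: seg simp del: mem_box)
    have "((\<lambda>t. f (y + t *\<^sub>R (x - y))) has_vector_derivative
        (\<Sum>b\<in>Basis. ((x - y) \<bullet> b) * ?g b (y + t *\<^sub>R (x - y)))) (at t within {0..1})"
      if "t \<in> {0..1}" for t
    proof -
      let ?D = "frechet_derivative f (at (y + t *\<^sub>R (x - y)))"
      have D: "(f has_derivative ?D) (at (y + t *\<^sub>R (x - y)))" using that by (intro Df seg) simp
      have lin: "linear ?D" using D has_derivative_linear by blast
      have "((\<lambda>t. y + t *\<^sub>R (x - y)) has_derivative (\<lambda>s. s *\<^sub>R (x - y))) (at t within {0..1})"
        by (auto intro!: derivative_eq_intros)
      from has_derivative_compose[OF this D]
      have "((\<lambda>t. f (y + t *\<^sub>R (x - y))) has_derivative (\<lambda>s. s *\<^sub>R ?D (x - y))) (at t within {0..1})"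
        by (simp add: linear_scale[OF lin])
      moreover have "?D (x - y) = ?D (\<Sum>b\<in>Basis. ((x - y) \<bullet> b) *\<^sub>R b)"
        by (simp only: euclidean_representation)
      moreover have "\<dots> = (\<Sum>b\<in>Basis. ((x - y) \<bullet> b) * ?D b)"
        by (simp add: linear_sum[OF lin] linear_scale[OF lin])
      ultimately show ?thesis by (simp add: has_vector_derivative_def)
    qed
    then have "((\<lambda>t. \<Sum>b\<in>Basis. ((x - y) \<bullet> b) * ?g b (y + t *\<^sub>R (x - y))) has_integral
        f (y + 1 *\<^sub>R (x - y)) - f (y + 0 *\<^sub>R (x - y))) {0..1}"
      by (intro fundamental_theorem_of_calculus) auto
    then have "f x - f y = integral (cbox 0 1) (\<lambda>t. \<Sum>b\<in>Basis. ((x - y) \<bullet> b) * ?g b (y + t *\<^sub>R (x - y)))"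
      by (simp add: integral_unique)
    also have "\<dots> = (\<Sum>b\<in>Basis. integral (cbox 0 1) (\<lambda>t. ((x - y) \<bullet> b) * ?g b (y + t *\<^sub>R (x - y))))"
      by (intro integral_sum integrable_continuous continuous_intros c finite_Basis)
    finally show ?thesis by simp
  qed
qed

section \<open>Functions and vector fields on a manifold\<close>

locale smooth_manifold =
  fixes A :: "('m::{t2_space,second_countable_topology}, 'e::euclidean_space) atlas"
  assumes atlas: "smooth_atlas A"
begin

abbreviation "CM \<equiv> smooth_fns A"
abbreviation "XM \<equiv> vfields A"

lemma chart:
  assumes "(U, \<phi>) \<in> A"
  shows "open U" "open (\<phi> ` U)" "homeomorphism U (\<phi> ` U) \<phi> (inv_into U \<phi>)"
  using atlas assms unfolding smooth_atlas_def by fast+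

lemma chart_at: obtains U \<phi> where "(U, \<phi>) \<in> A" "p \<in> U"
  using atlas unfolding smooth_atlas_def by blast

lemma chart_inverse:
  assumes "(U, \<phi>) \<in> A"
  shows "x \<in> U \<Longrightarrow> inv_into U \<phi> (\<phi> x) = x"
    and "y \<in> \<phi> ` U \<Longrightarrow> \<phi> (inv_into U \<phi> y) = y"
    and "y \<in> \<phi> ` U \<Longrightarrow> inv_into U \<phi> y \<in> U"
  using chart(3)[OF assms] by (auto simp: homeomorphism_def inv_into_into)

lemma chart_transition:
  "(U, \<phi>) \<in> A \<Longrightarrow> (V, \<psi>) \<in> A \<Longrightarrow> Cinf_on (\<psi> \<circ> inv_into U \<phi>) (\<phi> ` (U \<inter> V))"
  using atlas unfolding smooth_atlas_def by fast

lemma open_chart_image: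
  assumes "(U, \<phi>) \<in> A" "open W" "W \<subseteq> U"
  shows "open (\<phi> ` W)"
proof -
  have "openin (top_of_set (\<phi> ` U)) (\<phi> ` W)"
    by (rule homeomorphism_imp_open_map[OF chart(3)[OF assms(1)] open_subset[OF assms(3,2)]])
  then show ?thesis using chart(2)[OF assms(1)] by (rule openin_open_trans)
qed

lemma smooth_fnsD: "f \<in> CM \<Longrightarrow> (U, \<phi>) \<in> A \<Longrightarrow> Cinf_on (\<lambda>x. f (inv_into U \<phi> x)) (\<phi> ` U)"
  by (force simp: smooth_fns_def comp_def)

lemma smooth_fnsI: "(\<And>U \<phi>. (U, \<phi>) \<in> A \<Longrightarrow> Cinf_on (\<lambda>x. f (inv_into U \<phi> x)) (\<phi> ` U)) \<Longrightarrow> f \<in> CM"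
  by (auto simp: smooth_fns_def comp_def)

lemma smooth_const [simp, intro]: "(\<lambda>p. c) \<in> CM"
  by (intro smooth_fnsI Cinf_on_const)

lemma smooth_0 [simp, intro]: "0 \<in> CM" and smooth_1 [simp, intro]: "1 \<in> CM"
  by (simp_all add: zero_fun_def one_fun_def)

lemma smooth_add' [simp, intro]: "f \<in> CM \<Longrightarrow> h \<in> CM \<Longrightarrow> (\<lambda>p. f p + h p) \<in> CM"
  by (intro smooth_fnsI Cinf_on_add) (auto intro: chart smooth_fnsD)

lemma smooth_mult' [simp, intro]: "f \<in> CM \<Longrightarrow> h \<in> CM \<Longrightarrow> (\<lambda>p. f p * h p) \<in> CM"
  by (intro smooth_fnsI Cinf_on_mult) (auto intro: chart smooth_fnsD)

lemma smooth_minus' [simp, intro]: "f \<in> CM \<Longrightarrow> (\<lambda>p. - f p) \<in> CM"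
  using smooth_mult'[OF smooth_const[of "-1"], of f] by simp

lemma smooth_diff' [simp, intro]: "f \<in> CM \<Longrightarrow> h \<in> CM \<Longrightarrow> (\<lambda>p. f p - h p) \<in> CM"
  using smooth_add'[OF _ smooth_minus', of f h] by simp

lemma smooth_sum' [intro]: "(\<And>i. i \<in> I \<Longrightarrow> f i \<in> CM) \<Longrightarrow> (\<lambda>p. \<Sum>i\<in>I. f i p) \<in> CM"
  by (induction I rule: infinite_finite_induct) simp_all

lemma smooth_add [simp, intro]: "f \<in> CM \<Longrightarrow> h \<in> CM \<Longrightarrow> f + h \<in> CM"
  and smooth_mult [simp, intro]: "f \<in> CM \<Longrightarrow> h \<in> CM \<Longrightarrow> f * h \<in> CM"
  and smooth_minus [simp, intro]: "f \<in> CM \<Longrightarrow> - f \<in> CM"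
  and smooth_diff [simp, intro]: "f \<in> CM \<Longrightarrow> h \<in> CM \<Longrightarrow> f - h \<in> CM"
  by (simp_all add: plus_fun_def times_fun_def fun_Compl_def fun_diff_def)

lemma smooth_continuous:
  assumes "f \<in> CM" shows "continuous_on UNIV f"
proof -
  have "continuous_on U f" if U: "(U, \<phi>) \<in> A" for U \<phi>
  proof -
    have "continuous_on (\<phi> ` U) (\<lambda>x. f (inv_into U \<phi> x))"
      using smooth_fnsD[OF assms U] by (metis Cinf_on_def Ck_on.simps(1))
    moreover have "continuous_on U \<phi>" using chart(3)[OF U] by (simp add: homeomorphism_def)
    ultimately have "continuous_on U (\<lambda>q. f (inv_into U \<phi> (\<phi> q)))"
      by (rule continuous_on_compose2) simp
    then show ?thesis by (simp add: chart_inverse[OF U] cong: continuous_on_cong)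
  qed
  then have "\<exists>U. open U \<and> p \<in> U \<and> continuous_on U f" for p
    using chart_at[of p] chart(1) by metis
  then have "isCont f p" for p
    by (metis continuous_on_eq_continuous_at)
  then show ?thesis by (simp add: continuous_at_imp_continuous_on)
qed

lemma open_smooth_pos: "f \<in> CM \<Longrightarrow> open {q. f q > 0}"
  by (rule open_Collect_less) (simp_all add: smooth_continuous)

lemma smooth_extend_by_0:
  assumes "(U, \<phi>) \<in> A" "open W" "W \<subseteq> U" "closed K" "K \<subseteq> W" "\<And>q. q \<notin> K \<Longrightarrow> F q = 0"
    "Cinf_on (\<lambda>x. F (inv_into U \<phi> x)) (\<phi> ` W)"
  shows "F \<in> CM"
proof (rule smooth_fnsI)
  fix V \<psi> assume V: "(V, \<psi>) \<in> A"
  let ?i = "inv_into V \<psi>"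
  show "Cinf_on (\<lambda>x. F (?i x)) (\<psi> ` V)"
  proof (rule Cinf_on_union)
    fix x assume "x \<in> \<psi> ` V"
    then obtain q where q: "q \<in> V" "x = \<psi> q" by auto
    show "\<exists>T. open T \<and> x \<in> T \<and> Cinf_on (\<lambda>x. F (?i x)) T"
    proof (cases "q \<in> W")
      case True
      let ?T = "\<psi> ` (V \<inter> W)"
      have T: "open ?T" by (rule open_chart_image[OF V]) (use chart(1)[OF V] assms(2) in auto)
      have i: "?i y \<in> V \<inter> W" if "y \<in> ?T" for y
        using that chart_inverse[OF V] by auto
      have "Cinf_on (\<lambda>x. \<phi> (?i x)) ?T"
        using Cinf_on_subset[OF chart_transition[OF V assms(1)] image_mono[OF Int_mono[OF order_refl assms(3)]]]
        by (simp add: comp_def)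
      then have "Cinf_on (\<lambda>x. F (inv_into U \<phi> (\<phi> (?i x)))) ?T"
        by (intro Cinf_on_compose[OF T open_chart_image[OF assms(1-3)] _ assms(7)]) (use i in auto)
      moreover have "F (inv_into U \<phi> (\<phi> (?i y))) = F (?i y)" if "y \<in> ?T" for y
        using i[OF that] assms(3) by (auto simp: chart_inverse[OF assms(1)])
      ultimately have "Cinf_on (\<lambda>x. F (?i x)) ?T"
        by (subst Cinf_on_cong[OF T, symmetric]) auto
      with T True q show ?thesis by blast
    next
      case False
      let ?T = "\<psi> ` (V - K)"
      have T: "open ?T" by (rule open_chart_image[OF V]) (use chart(1)[OF V] assms(4) in auto)
      have "Cinf_on (\<lambda>x. F (?i x)) ?T"
        by (subst Cinf_on_cong[OF T, of _ "\<lambda>_. 0"])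
          (auto simp: chart_inverse[OF V] assms(6) Cinf_on_const)
      with T False q assms(5) show ?thesis by blast
    qed
  qed
qed

lemma chart_bump:
  assumes "(U, \<phi>) \<in> A" "p \<in> U" "open W" "p \<in> W"
  obtains \<zeta> r K where "\<zeta> \<in> CM" "r > 0" "ball (\<phi> p) r \<subseteq> \<phi> ` (U \<inter> W)"
    "closed K" "K \<subseteq> U \<inter> W" "\<forall>q. q \<notin> K \<longrightarrow> \<zeta> q = 0"
    "\<forall>q\<in>U. \<phi> q \<in> ball (\<phi> p) r \<longrightarrow> \<zeta> q = 1"
proof -
  let ?i = "inv_into U \<phi>"
  have "open (\<phi> ` (U \<inter> W))" using open_chart_image[OF assms(1)] chart(1)[OF assms(1)] assms(3) by auto
  moreover have "\<phi> p \<in> \<phi> ` (U \<inter> W)" using assms(2,4) by blast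
  ultimately obtain r where r: "r > 0" "cball (\<phi> p) r \<subseteq> \<phi> ` (U \<inter> W)"
    unfolding open_contains_cball by blast
  obtain \<beta> where \<beta>: "Cinf_on \<beta> UNIV" "\<forall>x\<in>ball (\<phi> p) (r / 2). \<beta> x = 1"
      "\<forall>x. x \<notin> cball (\<phi> p) r \<longrightarrow> \<beta> x = (0::real)"
    by (rule bump_function[OF r(1), of "\<phi> p"])
  let ?K = "?i ` cball (\<phi> p) r"
  let ?\<zeta> = "\<lambda>q. if q \<in> U then \<beta> (\<phi> q) else 0"
  have "continuous_on (cball (\<phi> p) r) ?i"
    using chart(3)[OF assms(1)] r(2) by (auto simp: homeomorphism_def intro: continuous_on_subset)
  then have K: "closed ?K" by (intro compact_imp_closed compact_continuous_image compact_cball)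
  have KUW: "?K \<subseteq> U \<inter> W"
  proof clarify
    fix x assume "x \<in> cball (\<phi> p) r"
    then obtain q where "q \<in> U \<inter> W" "x = \<phi> q" using r(2) by blast
    then show "?i x \<in> U \<inter> W" using chart_inverse(1)[OF assms(1)] by simp
  qed
  have 0: "?\<zeta> q = 0" if "q \<notin> ?K" for q
  proof (cases "q \<in> U")
    case True
    then have "\<phi> q \<notin> cball (\<phi> p) r"
      using that chart_inverse(1)[OF assms(1) True] by force
    then show ?thesis by (simp add: \<beta>)
  qed simp
  have "?\<zeta> \<in> CM"
  proof (rule smooth_extend_by_0[OF assms(1) chart(1)[OF assms(1)] order_refl K _ 0])
    show "?K \<subseteq> U" using KUW by blast
    have "Cinf_on \<beta> (\<phi> ` U)" by (rule Cinf_on_subset[OF \<beta>(1) subset_UNIV])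
    then show "Cinf_on (\<lambda>x. ?\<zeta> (?i x)) (\<phi> ` U)"
      by (subst Cinf_on_cong[OF chart(2)[OF assms(1)], of _ \<beta>]) (auto simp: chart_inverse[OF assms(1)])
  qed
  then show thesis
    by (rule that[of ?\<zeta> "r / 2" ?K]) (use r K KUW 0 \<beta>(2) in \<open>auto simp: subset_iff\<close>)
qed

lemma bump:
  assumes "open W" "p \<in> W"
  obtains \<zeta> where "\<zeta> \<in> CM" "\<zeta> p = 1" "\<forall>q. q \<notin> W \<longrightarrow> \<zeta> q = 0"
proof -
  obtain U \<phi> where U: "(U, \<phi>) \<in> A" "p \<in> U" by (rule chart_at)
  obtain \<zeta> r K where "\<zeta> \<in> CM" "r > 0" "K \<subseteq> U \<inter> W" "\<forall>q. q \<notin> K \<longrightarrow> \<zeta> q = 0"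
    "\<forall>q\<in>U. \<phi> q \<in> ball (\<phi> p) r \<longrightarrow> \<zeta> q = 1"
    by (rule chart_bump[OF U assms])
  then show thesis by (intro that[of \<zeta>]) (use U in auto)
qed

lemma smooth_cutoff:
  assumes "(U, \<phi>) \<in> A" "open W" "W \<subseteq> U" "closed K" "K \<subseteq> W"
    "\<zeta> \<in> CM" "\<forall>q. q \<notin> K \<longrightarrow> \<zeta> q = 0" "Cinf_on h (\<phi> ` W)"
  shows "(\<lambda>q. if q \<in> W then \<zeta> q * h (\<phi> q) else 0) \<in> CM" (is "?F \<in> _")
proof (rule smooth_extend_by_0[OF assms(1-5)])
  show "?F q = 0" if "q \<notin> K" for q using that assms(7) by simp
  let ?i = "inv_into U \<phi>"
  note op = open_chart_image[OF assms(1-3)]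
  have "Cinf_on (\<lambda>x. \<zeta> (?i x)) (\<phi> ` W)"
    by (rule Cinf_on_subset[OF smooth_fnsD[OF assms(6,1)] image_mono[OF assms(3)]])
  then have "Cinf_on (\<lambda>x. \<zeta> (?i x) * h x) (\<phi> ` W)"
    by (intro Cinf_on_mult op assms)
  moreover have "?F (?i x) = \<zeta> (?i x) * h x" if "x \<in> \<phi> ` W" for x
    using that assms(3) by (auto simp: chart_inverse[OF assms(1)] subset_iff)
  ultimately show "Cinf_on (\<lambda>x. ?F (?i x)) (\<phi> ` W)"
    by (subst Cinf_on_cong[OF op]) auto
qed

lemma smooth_local_powr:
  assumes "f \<in> CM" "open W" "p \<in> W" "\<And>q. q \<in> W \<Longrightarrow> f q > 0"
  obtains \<rho> V where "\<rho> \<in> CM" "open V" "p \<in> V" "\<forall>q\<in>V. \<rho> q = f q powr c"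
proof -
  obtain U \<phi> where U: "(U, \<phi>) \<in> A" "p \<in> U" by (rule chart_at)
  obtain \<zeta> r K where \<zeta>: "\<zeta> \<in> CM" "r > 0" "ball (\<phi> p) r \<subseteq> \<phi> ` (U \<inter> W)"
    "closed K" "K \<subseteq> U \<inter> W" "\<forall>q. q \<notin> K \<longrightarrow> \<zeta> q = 0"
    "\<forall>q\<in>U. \<phi> q \<in> ball (\<phi> p) r \<longrightarrow> \<zeta> q = 1"
    by (rule chart_bump[OF U assms(2,3)])
  let ?i = "inv_into U \<phi>"
  have op: "open (U \<inter> W)" using chart(1)[OF U(1)] assms(2) by auto
  have "Cinf_on (\<lambda>x. f (?i x)) (\<phi> ` (U \<inter> W))"
    by (rule Cinf_on_subset[OF smooth_fnsD[OF assms(1) U(1)] image_mono[OF Int_lower1]])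
  then have "Cinf_on (\<lambda>x. f (?i x) powr c) (\<phi> ` (U \<inter> W))"
    by (rule Cinf_on_powr[OF open_chart_image[OF U(1) op Int_lower1], rotated])
      (auto simp: chart_inverse[OF U(1)] assms(4))
  from smooth_cutoff[OF U(1) op Int_lower1 \<zeta>(4,5,1,6) this]
  have *: "(\<lambda>q. if q \<in> U \<inter> W then \<zeta> q * f (?i (\<phi> q)) powr c else 0) \<in> CM" .
  let ?V = "U \<inter> \<phi> -` ball (\<phi> p) r"
  have cont: "continuous_on U \<phi>" using chart(3)[OF U(1)] by (simp add: homeomorphism_def)
  have "open ?V"
    by (rule continuous_open_preimage[OF cont chart(1)[OF U(1)] open_ball])
  moreover have "?V \<subseteq> W"
  proof
    fix q assume q: "q \<in> ?V"
    then obtain q' where "q' \<in> U \<inter> W" "\<phi> q = \<phi> q'" using \<zeta>(3) by blast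
    with q chart_inverse(1)[OF U(1), of q] chart_inverse(1)[OF U(1), of q'] show "q \<in> W" by auto
  qed
  ultimately show thesis
    by (intro that[OF *, of ?V]) (use U \<zeta> chart_inverse[OF U(1)] in auto)
qed


lemma
  assumes "X \<in> XM"
  shows vf_smooth: "f \<in> CM \<Longrightarrow> X f \<in> CM"
    and vf_off: "f \<notin> CM \<Longrightarrow> X f = 0"
    and vf_add: "f \<in> CM \<Longrightarrow> h \<in> CM \<Longrightarrow> X (f + h) = X f + X h"
    and vf_cmult: "f \<in> CM \<Longrightarrow> X (\<lambda>p. c * f p) = (\<lambda>p. c * X f p)"
    and vf_mult: "f \<in> CM \<Longrightarrow> h \<in> CM \<Longrightarrow> X (f * h) = f * X h + h * X f"
  using assms unfolding vfields_def by blast+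

lemma vfieldI:
  assumes "\<And>f. f \<in> CM \<Longrightarrow> X f \<in> CM" "\<And>f. f \<notin> CM \<Longrightarrow> X f = 0"
    "\<And>f h p. f \<in> CM \<Longrightarrow> h \<in> CM \<Longrightarrow> X (f + h) p = X f p + X h p"
    "\<And>c f p. f \<in> CM \<Longrightarrow> X (\<lambda>p. c * f p) p = c * X f p"
    "\<And>f h p. f \<in> CM \<Longrightarrow> h \<in> CM \<Longrightarrow> X (f * h) p = f p * X h p + h p * X f p"
  shows "X \<in> XM"
  using assms unfolding vfields_def by (auto simp: fun_eq_iff)

lemma vf_uminus: "X \<in> XM \<Longrightarrow> f \<in> CM \<Longrightarrow> X (- f) = - X f"
  using vf_cmult[of X f "-1"] by (simp add: fun_Compl_def)

lemma vf_diff: "X \<in> XM \<Longrightarrow> f \<in> CM \<Longrightarrow> h \<in> CM \<Longrightarrow> X (f - h) = X f - X h"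
  using vf_add[of X f "- h"] by (simp add: vf_uminus fun_eq_iff)

lemma vf_pointwise:
  assumes "X \<in> XM" "f \<in> CM" "h \<in> CM"
  shows "X (\<lambda>p. f p + h p) q = X f q + X h q"
    and "X (\<lambda>p. f p - h p) q = X f q - X h q"
    and "X (\<lambda>p. f p * h p) q = f q * X h q + h q * X f q"
  using vf_add[OF assms] vf_diff[OF assms] vf_mult[OF assms]
  by (simp_all add: plus_fun_def fun_diff_def times_fun_def)

lemma vf_minus: "X \<in> XM \<Longrightarrow> f \<in> CM \<Longrightarrow> X (\<lambda>p. - f p) q = - X f q"
  using vf_cmult[of X f "-1"] by simp

lemma vf_const: assumes "X \<in> XM" shows "X (\<lambda>p. c) = 0"
proof -
  have "X 1 = 0" using vf_mult[OF assms, of 1 1] by simp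
  then show ?thesis using vf_cmult[OF assms, of 1 c] by (simp add: fun_eq_iff)
qed

lemma vf_sum:
  assumes "X \<in> XM" "\<And>i. i \<in> I \<Longrightarrow> f i \<in> CM"
  shows "X (\<lambda>p. \<Sum>i\<in>I. f i p) = (\<lambda>p. \<Sum>i\<in>I. X (f i) p)"
  using assms(2)
proof (induction I rule: infinite_finite_induct)
  case (insert i I)
  have "X (\<lambda>p. \<Sum>i\<in>insert i I. f i p) = X (f i + (\<lambda>p. \<Sum>i\<in>I. f i p))"
    using insert by (simp add: plus_fun_def)
  also have "\<dots> = X (f i) + X (\<lambda>p. \<Sum>i\<in>I. f i p)"
    using insert.prems by (intro vf_add[OF assms(1)] smooth_sum') auto
  finally show ?case using insert by (simp add: fun_eq_iff)
qed (simp_all add: vf_const[OF assms(1)] fun_eq_iff)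

lemma vf_local:
  assumes "X \<in> XM" "f \<in> CM" "h \<in> CM" "open W" "p \<in> W" "\<And>q. q \<in> W \<Longrightarrow> f q = h q"
  shows "X f p = X h p"
proof -
  obtain \<zeta> where \<zeta>: "\<zeta> \<in> CM" "\<zeta> p = 1" "\<forall>q. q \<notin> W \<longrightarrow> \<zeta> q = 0"
    by (rule bump[OF assms(4,5)])
  have "\<zeta> * (f - h) = (\<lambda>p. 0)" using \<zeta>(3) assms(6) by (auto simp: fun_eq_iff)
  then have "X (\<zeta> * (f - h)) p = 0" using vf_const[OF assms(1)] by simp
  then show ?thesis
    using assms \<zeta> by (simp add: vf_mult vf_diff)
qed

lemma XM_0 [simp, intro]: "0 \<in> XM"
  by (rule vfieldI) auto

lemma XM_add [simp, intro]: "X \<in> XM \<Longrightarrow> Y \<in> XM \<Longrightarrow> X + Y \<in> XM"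
  by (rule vfieldI) (auto simp: vf_smooth vf_off vf_add vf_cmult vf_mult algebra_simps)

lemma XM_fmul [simp, intro]: "h \<in> CM \<Longrightarrow> X \<in> XM \<Longrightarrow> h \<odot> X \<in> XM"
  by (rule vfieldI) (auto simp: fmul_def vf_smooth vf_off vf_add vf_cmult vf_mult algebra_simps)

lemma fmul_minus1: "(\<lambda>p. - 1) \<odot> X = - X"
  by (simp add: fmul_def fun_eq_iff)

lemma XM_minus [simp, intro]: "X \<in> XM \<Longrightarrow> - X \<in> XM"
  using XM_fmul[OF smooth_const[of "-1"]] by (simp add: fmul_minus1)

lemma XM_diff [simp, intro]: "X \<in> XM \<Longrightarrow> Y \<in> XM \<Longrightarrow> X - Y \<in> XM"
  using XM_add[of X "- Y"] by simp

lemma XM_sum [intro]: "(\<And>i. i \<in> I \<Longrightarrow> X i \<in> XM) \<Longrightarrow> (\<Sum>i\<in>I. X i) \<in> XM"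
  by (induction I rule: infinite_finite_induct) simp_all

lemma vf_mult2:
  assumes "X \<in> XM" "Y \<in> XM" "f \<in> CM" "h \<in> CM"
  shows "X (Y (f * h)) p = f p * X (Y h) p + Y h p * X f p + (h p * X (Y f) p + Y f p * X h p)"
proof -
  note Y = vf_smooth[OF assms(2)]
  have "X (Y (f * h)) = X (f * Y h + h * Y f)" by (simp only: vf_mult[OF assms(2-4)])
  also have "\<dots> = X (f * Y h) + X (h * Y f)"
    by (rule vf_add[OF assms(1) smooth_mult[OF assms(3) Y] smooth_mult[OF assms(4) Y]]) (fact assms)+
  also have "\<dots> = (f * X (Y h) + Y h * X f) + (h * X (Y f) + Y f * X h)"
    by (simp only: vf_mult[OF assms(1)] assms Y)
  finally show ?thesis by simp
qed

lemma XM_lie [simp, intro]: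
  assumes "X \<in> XM" "Y \<in> XM" shows "lie X Y \<in> XM"
proof (rule vfieldI)
  fix f assume "f \<notin> CM"
  then show "lie X Y f = 0"
    using assms by (simp add: lie_def vf_off zero_fun_def vf_const)
next
  fix f h p assume "f \<in> CM" "h \<in> CM"
  then show "lie X Y (f * h) p = f p * lie X Y h p + h p * lie X Y f p"
    using assms by (simp add: lie_def vf_mult2 right_diff_distrib)
qed (use assms in \<open>simp_all add: lie_def vf_smooth vf_add vf_cmult vf_pointwise algebra_simps\<close>)

text \<open>By Hadamard's lemma a derivation is, near \<open>p\<close>, the combination of the coordinate fields with
  its values on the coordinates as coefficients.\<close>

lemma coordinate_fields:
  obtains E :: "'e \<Rightarrow> 'm vfield" and x :: "'e \<Rightarrow> 'm \<Rightarrow> real" and N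
  where "open N" "p \<in> N" "\<forall>b. E b \<in> XM" "\<forall>b. x b \<in> CM"
    "\<forall>X\<in>XM. \<forall>f\<in>CM. \<forall>q\<in>N. X f q = (\<Sum>b\<in>Basis. X (x b) q * E b f q)"
    "\<forall>b. \<forall>b'. \<forall>q\<in>N. E b (x b') q = b \<bullet> b'"
proof -
  obtain U \<phi> where U: "(U, \<phi>) \<in> A" "p \<in> U" by (rule chart_at)
  obtain \<zeta> r K where \<zeta>: "\<zeta> \<in> CM" "r > 0" "ball (\<phi> p) r \<subseteq> \<phi> ` (U \<inter> UNIV)"
    "closed K" "K \<subseteq> U \<inter> UNIV" "\<forall>q. q \<notin> K \<longrightarrow> \<zeta> q = 0"
    "\<forall>q\<in>U. \<phi> q \<in> ball (\<phi> p) r \<longrightarrow> \<zeta> q = 1"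
    by (rule chart_bump[OF U open_UNIV UNIV_I])
  let ?i = "inv_into U \<phi>"
  define F where "F f y = f (?i y)" for f :: "'m \<Rightarrow> real" and y
  define Df where "Df f y = frechet_derivative (F f) (at y)" for f y
  define E where "E b f = (if f \<in> CM then (\<lambda>q. if q \<in> U then \<zeta> q * Df f (\<phi> q) b else 0) else 0)" for b f
  define x where "x b = (\<lambda>q. if q \<in> U then \<zeta> q * (\<phi> q \<bullet> b) else 0)" for b
  define N where "N = U \<inter> \<phi> -` ball (\<phi> p) r"
  have F: "Cinf_on (F f) (\<phi> ` U)" if "f \<in> CM" for f
    using smooth_fnsD[OF that U(1)] by (simp add: F_def[abs_def])
  have Df: "(F f has_derivative Df f (\<phi> q)) (at (\<phi> q))" if "f \<in> CM" "q \<in> U" for f q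
    unfolding Df_def frechet_derivative_works[symmetric]
    using Cinf_on_imp_differentiable[OF F[OF that(1)]] that(2) by blast
  have Df_eq: "Df f (\<phi> q) = D" if "(F f has_derivative D) (at (\<phi> q))" for f q D
    using frechet_derivative_at[OF that] by (simp add: Df_def)
  have KU: "K \<subseteq> U" using \<zeta>(5) by simp
  have cut: "(\<lambda>q. if q \<in> U then \<zeta> q * h (\<phi> q) else 0) \<in> CM" if "Cinf_on h (\<phi> ` U)" for h
    by (rule smooth_cutoff[OF U(1) chart(1)[OF U(1)] order_refl \<zeta>(4) KU \<zeta>(1) _ that])
      (use \<zeta>(6) in blast)
  have cont: "continuous_on U \<phi>" using chart(3)[OF U(1)] by (simp add: homeomorphism_def)
  have N: "open N" unfolding N_def
    by (rule continuous_open_preimage[OF cont chart(1)[OF U(1)] open_ball])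
  have pN: "p \<in> N" using U \<zeta>(2) by (simp add: N_def)
  have xN: "x b q = \<phi> q \<bullet> b" if "q \<in> N" for b q
    using that \<zeta>(7) by (auto simp: x_def N_def)
  have ECM: "E b f \<in> CM" if "f \<in> CM" for b f
    using cut[OF Cinf_on_frechet_derivative[OF F[OF that]], of b] that
    by (simp add: E_def Df_def cong: if_cong)
  have EXM: "E b \<in> XM" for b
  proof (rule vfieldI)
    show "E b (f + h) p = E b f p + E b h p" if "f \<in> CM" "h \<in> CM" for f h p
    proof (cases "p \<in> U")
      case True
      have "F (f + h) = (\<lambda>y. F f y + F h y)" by (simp add: F_def fun_eq_iff)
      then have "Df (f + h) (\<phi> p) = (\<lambda>v. Df f (\<phi> p) v + Df h (\<phi> p) v)"
        using has_derivative_add[OF Df[OF that(1) True] Df[OF that(2) True]] by (intro Df_eq) simp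
      with True that show ?thesis by (simp add: E_def algebra_simps)
    qed (use that in \<open>simp add: E_def\<close>)
    show "E b (f * h) p = f p * E b h p + h p * E b f p" if "f \<in> CM" "h \<in> CM" for f h p
    proof (cases "p \<in> U")
      case True
      have "F (f * h) = (\<lambda>y. F f y * F h y)" by (simp add: F_def fun_eq_iff)
      then have "Df (f * h) (\<phi> p) = (\<lambda>v. F f (\<phi> p) * Df h (\<phi> p) v + Df f (\<phi> p) v * F h (\<phi> p))"
        using has_derivative_mult[OF Df[OF that(1) True] Df[OF that(2) True]] by (intro Df_eq) simp
      with True that show ?thesis
        by (simp add: E_def F_def chart_inverse[OF U(1)] algebra_simps)
    qed (use that in \<open>simp add: E_def\<close>)
    show "E b (\<lambda>p. c * f p) p = c * E b f p" if "f \<in> CM" for c f p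
    proof (cases "p \<in> U")
      case True
      have "F (\<lambda>p. c * f p) = (\<lambda>y. c * F f y)" by (simp add: F_def fun_eq_iff)
      then have "Df (\<lambda>p. c * f p) (\<phi> p) = (\<lambda>v. c * Df f (\<phi> p) v)"
        using has_derivative_mult_right[OF Df[OF that True], of c] by (intro Df_eq) simp
      with True that smooth_mult'[OF smooth_const that] show ?thesis by (simp add: E_def)
    qed (use that smooth_mult'[OF smooth_const that] in \<open>simp add: E_def\<close>)
  qed (use ECM in \<open>auto simp: E_def\<close>)
  have xCM: "x b \<in> CM" for b
    unfolding x_def by (rule cut[OF Cinf_on_bounded_linear[OF bounded_linear_inner_left]])
  have exp: "X f q = (\<Sum>b\<in>Basis. X (x b) q * E b f q)" if X: "X \<in> XM" and f: "f \<in> CM" and q: "q \<in> N" for X f q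
  proof -
    have qU: "q \<in> U" "\<phi> q \<in> ball (\<phi> p) r" using q by (auto simp: N_def)
    have "ball (\<phi> p) r \<subseteq> \<phi> ` U" using \<zeta>(3) by simp
    from Cinf_on_subset[OF F[OF f] this] obtain G where
      G: "\<And>b. Cinf_on (G b) (ball (\<phi> p) r)" "\<And>b. G b (\<phi> q) = Df f (\<phi> q) b"
        "\<And>y. y \<in> ball (\<phi> p) r \<Longrightarrow> F f y = F f (\<phi> q) + (\<Sum>b\<in>Basis. ((y - \<phi> q) \<bullet> b) * G b y)"
      unfolding Df_def using Hadamard[OF open_ball convex_ball qU(2), of "F f"] by metis
    obtain \<zeta>' r' K' where \<zeta>': "\<zeta>' \<in> CM" "r' > 0" "ball (\<phi> q) r' \<subseteq> \<phi> ` (U \<inter> N)"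
      "closed K'" "K' \<subseteq> U \<inter> N" "\<forall>q. q \<notin> K' \<longrightarrow> \<zeta>' q = 0"
      "\<forall>q'\<in>U. \<phi> q' \<in> ball (\<phi> q) r' \<longrightarrow> \<zeta>' q' = 1"
      by (rule chart_bump[OF U(1) qU(1) N q])
    have \<zeta>'q: "\<zeta>' q = 1" using \<zeta>'(2,7) qU(1) by simp
    define C where "C b = (\<lambda>q'. if q' \<in> N then \<zeta>' q' * G b (\<phi> q') else 0)" for b
    have C: "C b \<in> CM" for b
      unfolding C_def
    proof (rule smooth_cutoff[OF U(1) N _ \<zeta>'(4) _ \<zeta>'(1)])
      show "Cinf_on (G b) (\<phi> ` N)"
        by (rule Cinf_on_subset[OF G(1)]) (auto simp: N_def)
    qed (use \<zeta>'(5,6) in \<open>auto simp: N_def\<close>)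
    have eq: "\<zeta>' * f = (\<lambda>p. f q * \<zeta>' p) + (\<lambda>q'. \<Sum>b\<in>Basis. ((x b - (\<lambda>p. x b q)) * C b) q')"
    proof
      fix q'
      show "(\<zeta>' * f) q' = ((\<lambda>p. f q * \<zeta>' p) + (\<lambda>q'. \<Sum>b\<in>Basis. ((x b - (\<lambda>p. x b q)) * C b) q')) q'"
      proof (cases "q' \<in> N")
        case True
        then have q': "q' \<in> U" "\<phi> q' \<in> ball (\<phi> p) r" by (auto simp: N_def)
        have "f q' = f q + (\<Sum>b\<in>Basis. ((\<phi> q' - \<phi> q) \<bullet> b) * G b (\<phi> q'))"
          using G(3)[OF q'(2)] q'(1) qU(1) by (simp add: F_def chart_inverse[OF U(1)])
        with True q show ?thesis
          by (simp add: C_def xN inner_diff_left sum_distrib_left algebra_simps)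
      next
        case False
        then have "\<zeta>' q' = 0" using \<zeta>'(5,6) by blast
        with False show ?thesis by (simp add: C_def)
      qed
    qed
    have xC: "(x b - (\<lambda>p. x b q)) * C b \<in> CM" for b
      using xCM C by blast
    have "X (\<zeta>' * f) q = X f q + f q * X \<zeta>' q"
      using \<zeta>'q by (simp add: vf_mult[OF X \<zeta>'(1) f])
    moreover have "X (\<zeta>' * f) q = f q * X \<zeta>' q + (\<Sum>b\<in>Basis. X ((x b - (\<lambda>p. x b q)) * C b) q)"
      unfolding eq using xC \<zeta>'(1) smooth_sum'[of Basis "\<lambda>b. (x b - (\<lambda>p. x b q)) * C b"]
      by (simp only: vf_add[OF X] vf_cmult[OF X] vf_sum[OF X] smooth_mult'[OF smooth_const] plus_fun_apply)
    moreover have "X ((x b - (\<lambda>p. x b q)) * C b) q = X (x b) q * E b f q" for b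
    proof -
      have "X ((x b - (\<lambda>p. x b q)) * C b) q = C b q * X (x b) q"
        using xCM C by (simp add: vf_mult[OF X] vf_diff[OF X] vf_const[OF X])
      moreover have "C b q = E b f q"
        using q qU f \<zeta>'q \<zeta>(7) by (simp add: C_def E_def G(2))
      ultimately show ?thesis by simp
    qed
    ultimately show ?thesis by simp
  qed
  have "E b (x b') q = b \<bullet> b'" if "q \<in> N" for b b' q
  proof -
    have q: "q \<in> U" "\<phi> q \<in> ball (\<phi> p) r" using that by (auto simp: N_def)
    have "((\<lambda>y. y \<bullet> b') has_derivative (\<lambda>v. v \<bullet> b')) (at (\<phi> q))"
      by (auto intro!: derivative_eq_intros)
    moreover have "y \<bullet> b' = F (x b') y" if "y \<in> ball (\<phi> p) r" for y
    proof -
      have y: "y \<in> \<phi> ` U" using that \<zeta>(3) by auto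
      then have "?i y \<in> N" using that by (simp add: N_def chart_inverse[OF U(1)])
      then show ?thesis by (simp add: F_def xN chart_inverse(2)[OF U(1) y])
    qed
    ultimately have "(F (x b') has_derivative (\<lambda>v. v \<bullet> b')) (at (\<phi> q))"
      using has_derivative_transform_within_open[OF _ open_ball q(2)] by metis
    from Df_eq[OF this] show ?thesis
      using q \<zeta>(7) xCM by (simp add: E_def)
  qed
  then have "\<forall>b. \<forall>b'. \<forall>q\<in>N. E b (x b') q = b \<bullet> b'" by blast
  moreover have "\<forall>b. E b \<in> XM" "\<forall>b. x b \<in> CM" using EXM xCM by blast+
  moreover have "\<forall>X\<in>XM. \<forall>f\<in>CM. \<forall>q\<in>N. X f q = (\<Sum>b\<in>Basis. X (x b) q * E b f q)"
    by (intro ballI exp)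
  ultimately show thesis by (intro that[OF N pN])
qed

end

section \<open>Riemannian metrics\<close>

locale riemannian_manifold = smooth_manifold +
  fixes g :: "'a metric"
  assumes metric: "riemannian_metric A g"
begin

lemma g_smooth [simp, intro]: "X \<in> XM \<Longrightarrow> Y \<in> XM \<Longrightarrow> g X Y \<in> CM"
  and g_commute: "X \<in> XM \<Longrightarrow> Y \<in> XM \<Longrightarrow> g X Y = g Y X"
  and g_pos: "X \<in> XM \<Longrightarrow> f \<in> CM \<Longrightarrow> X f p \<noteq> 0 \<Longrightarrow> g X X p > 0"
  using metric unfolding riemannian_metric_def by blast+

lemma g_add_left [simp]:
  assumes "X \<in> XM" "Y \<in> XM" "Z \<in> XM" shows "g (X + Y) Z p = g X Z p + g Y Z p"
proof -
  have "g (X + Y) Z = g X Z + g Y Z" using metric assms unfolding riemannian_metric_def by blast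
  then show ?thesis by simp
qed

lemma g_fmul_left [simp]:
  assumes "h \<in> CM" "X \<in> XM" "Y \<in> XM" shows "g (h \<odot> X) Y p = h p * g X Y p"
proof -
  have "g (h \<odot> X) Y = h * g X Y" using metric assms unfolding riemannian_metric_def by blast
  then show ?thesis by simp
qed

lemma g_add_right [simp]: "X \<in> XM \<Longrightarrow> Y \<in> XM \<Longrightarrow> Z \<in> XM \<Longrightarrow> g Z (X + Y) p = g Z X p + g Z Y p"
  using g_add_left[of X Y Z p] g_commute[of Z X] g_commute[of Z Y] g_commute[of Z "X + Y"] by simp

lemma g_fmul_right [simp]: "h \<in> CM \<Longrightarrow> X \<in> XM \<Longrightarrow> Y \<in> XM \<Longrightarrow> g X (h \<odot> Y) p = h p * g X Y p"
  using g_fmul_left[of h Y X p] g_commute[of X Y] g_commute[of X "h \<odot> Y"] by simp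

lemma g_minus_left [simp]: "X \<in> XM \<Longrightarrow> Y \<in> XM \<Longrightarrow> g (- X) Y p = - g X Y p"
  using g_fmul_left[OF smooth_const[of "-1"], of X Y p] by (simp add: fmul_minus1)

lemma g_minus_right [simp]: "X \<in> XM \<Longrightarrow> Y \<in> XM \<Longrightarrow> g X (- Y) p = - g X Y p"
  using g_fmul_right[OF smooth_const[of "-1"], of X Y p] by (simp add: fmul_minus1)

lemma g_diff_left [simp]: "X \<in> XM \<Longrightarrow> Y \<in> XM \<Longrightarrow> Z \<in> XM \<Longrightarrow> g (X - Y) Z p = g X Z p - g Y Z p"
  using g_add_left[of X "- Y" Z p] by simp

lemma g_diff_right [simp]: "X \<in> XM \<Longrightarrow> Y \<in> XM \<Longrightarrow> Z \<in> XM \<Longrightarrow> g Z (X - Y) p = g Z X p - g Z Y p"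
  using g_add_right[of X "- Y" Z p] by simp

lemma g_0_left [simp]: "Y \<in> XM \<Longrightarrow> g 0 Y p = 0"
  using g_diff_left[of Y Y Y p] by simp

lemma g_0_right [simp]: "Y \<in> XM \<Longrightarrow> g Y 0 p = 0"
  using g_diff_right[of Y Y Y p] by simp

lemma g_sum_left: "(\<And>i. i \<in> I \<Longrightarrow> X i \<in> XM) \<Longrightarrow> Y \<in> XM \<Longrightarrow> g (\<Sum>i\<in>I. X i) Y p = (\<Sum>i\<in>I. g (X i) Y p)"
  by (induction I rule: infinite_finite_induct) (simp_all add: XM_sum)

lemma g_sum_right: "(\<And>i. i \<in> I \<Longrightarrow> X i \<in> XM) \<Longrightarrow> Y \<in> XM \<Longrightarrow> g Y (\<Sum>i\<in>I. X i) p = (\<Sum>i\<in>I. g Y (X i) p)"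
  by (induction I rule: infinite_finite_induct) (simp_all add: XM_sum)

lemma g_sum_sum:
  assumes "\<And>i. i \<in> I \<Longrightarrow> X i \<in> XM" "\<And>j. j \<in> J \<Longrightarrow> Y j \<in> XM"
  shows "g (\<Sum>i\<in>I. X i) (\<Sum>j\<in>J. Y j) p = (\<Sum>i\<in>I. \<Sum>j\<in>J. g (X i) (Y j) p)"
proof -
  have "g (\<Sum>i\<in>I. X i) (\<Sum>j\<in>J. Y j) p = (\<Sum>i\<in>I. g (X i) (\<Sum>j\<in>J. Y j) p)"
    by (intro g_sum_left XM_sum assms)
  also have "\<dots> = (\<Sum>i\<in>I. \<Sum>j\<in>J. g (X i) (Y j) p)"
    by (intro sum.cong refl g_sum_right assms)
  finally show ?thesis .
qed

lemma g_definite: assumes "X \<in> XM" "\<And>p. g X X p = 0" shows "X = 0"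
proof (rule ext, rule ext)
  fix f p
  have "X f p = 0" if "f \<in> CM" using g_pos[OF assms(1) that] assms(2) by force
  then show "X f p = 0 f p" by (cases "f \<in> CM") (simp_all add: vf_off[OF assms(1)])
qed

lemma metric_coordinates:
  obtains V :: "'a vfield \<Rightarrow> 'b" and G :: "'b \<Rightarrow> 'b \<Rightarrow> real"
  where "\<forall>u. linear (G u)" "\<forall>u. linear (\<lambda>v. G v u)"
    "\<forall>X\<in>XM. \<forall>Y\<in>XM. g X Y p = G (V X) (V Y)"
    "\<forall>X\<in>XM. \<forall>Y\<in>XM. V (X + Y) = V X + V Y"
    "\<forall>h\<in>CM. \<forall>X\<in>XM. V (h \<odot> X) = h p *\<^sub>R V X"
    "\<forall>b\<in>Basis. \<exists>Y\<in>XM. V Y = b"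
    "\<forall>X\<in>XM. V X \<noteq> 0 \<longrightarrow> g X X p > 0"
proof -
  obtain E :: "'b \<Rightarrow> 'a vfield" and x N where N: "open N" "p \<in> N"
    and EXM: "\<forall>b. E b \<in> XM" and xCM: "\<forall>b. x b \<in> CM"
    and exp: "\<forall>X\<in>XM. \<forall>f\<in>CM. \<forall>q\<in>N. X f q = (\<Sum>b\<in>Basis. X (x b) q * E b f q)"
    and dual: "\<forall>b. \<forall>b'. \<forall>q\<in>N. E b (x b') q = b \<bullet> b'"
    by (rule coordinate_fields)
  define V where "V X = (\<Sum>b\<in>Basis. X (x b) p *\<^sub>R b)" for X :: "'a vfield"
  define G where "G u v = (\<Sum>b\<in>Basis. \<Sum>b'\<in>Basis. (u \<bullet> b) * (v \<bullet> b') * g (E b) (E b') p)" for u v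
  obtain \<zeta> where \<zeta>: "\<zeta> \<in> CM" "\<zeta> p = 1" "\<forall>q. q \<notin> N \<longrightarrow> \<zeta> q = 0"
    by (rule bump[OF N])
  have Vb: "V X \<bullet> b = X (x b) p" if "b \<in> Basis" for X b
    using that by (simp add: V_def inner_sum_left inner_Basis if_distrib cong: if_cong)
  have coef: "\<zeta> * X (x b) \<in> CM" if "X \<in> XM" for X b
    using smooth_mult[OF \<zeta>(1) vf_smooth[OF that]] xCM by blast
  have local: "\<zeta> \<odot> X = (\<Sum>b\<in>Basis. (\<zeta> * X (x b)) \<odot> E b)" if X: "X \<in> XM" for X
  proof (rule ext, rule ext)
    fix f q
    have sum: "(\<Sum>b\<in>Basis. (\<zeta> * X (x b)) \<odot> E b) f q = (\<Sum>b\<in>Basis. \<zeta> q * X (x b) q * E b f q)"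
      for f q
    proof -
      have "(\<Sum>b\<in>J. (\<zeta> * X (x b)) \<odot> E b) f q = (\<Sum>b\<in>J. \<zeta> q * X (x b) q * E b f q)" for J
        by (induction J rule: infinite_finite_induct) (simp_all add: fmul_def)
      then show ?thesis .
    qed
    show "(\<zeta> \<odot> X) f q = (\<Sum>b\<in>Basis. (\<zeta> * X (x b)) \<odot> E b) f q"
    proof (cases "q \<in> N \<and> f \<in> CM")
      case True
      then have "X f q = (\<Sum>b\<in>Basis. X (x b) q * E b f q)" using exp X by blast
      then show ?thesis unfolding sum by (simp add: fmul_def sum_distrib_left mult.assoc)
    next
      case False
      then have "\<zeta> q = 0 \<or> X f = 0 \<and> (\<forall>b. E b f = 0)"
        using \<zeta>(3) vf_off[OF X] vf_off[of "E _"] EXM by blast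
      then show ?thesis unfolding sum by (auto simp: fmul_def)
    qed
  qed
  have 1: "g X Y p = G (V X) (V Y)" if X: "X \<in> XM" and Y: "Y \<in> XM" for X Y
  proof -
    have "g X Y p = g (\<zeta> \<odot> X) (\<zeta> \<odot> Y) p" using X Y \<zeta> by simp
    also have "\<dots> = (\<Sum>b\<in>Basis. \<Sum>b'\<in>Basis. g ((\<zeta> * X (x b)) \<odot> E b) ((\<zeta> * Y (x b')) \<odot> E b') p)"
      unfolding local[OF X] local[OF Y]
      by (rule g_sum_sum) (use EXM coef[OF X] coef[OF Y] in auto)
    also have "\<dots> = G (V X) (V Y)"
      unfolding G_def
      by (intro sum.cong refl) (use EXM coef[OF X] coef[OF Y] \<zeta> in \<open>simp add: Vb\<close>)
    finally show ?thesis .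
  qed
  have 2: "linear (G u)" "linear (\<lambda>v. G v u)" for u
    by (auto intro!: linearI simp: G_def inner_add_left algebra_simps sum.distrib sum_distrib_left)
  have 3: "V (X + Y) = V X + V Y" for X Y
    by (simp add: V_def algebra_simps sum.distrib)
  have 4: "V (h \<odot> X) = h p *\<^sub>R V X" for h X
    by (simp add: V_def fmul_def scaleR_sum_right)
  have 5: "V (E b) = b" if "b \<in> Basis" for b
    using dual N(2) by (simp add: V_def euclidean_representation)
  have 6: "g X X p > 0" if X: "X \<in> XM" and "V X \<noteq> 0" for X
  proof -
    obtain b where "X (x b) p \<noteq> 0"
      using \<open>V X \<noteq> 0\<close> unfolding V_def by (metis (no_types, lifting) scaleR_zero_left sum.neutral)
    then show ?thesis using g_pos[OF X] xCM by blast
  qed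
  show thesis
  proof (rule that[of G V])
    show "\<forall>b\<in>Basis. \<exists>Y\<in>XM. V Y = b" using 5 EXM by blast
    show "\<forall>X\<in>XM. V X \<noteq> 0 \<longrightarrow> g X X p > 0" using 6 by blast
  qed (simp_all add: 1 2 3 4)
qed

lemma Parseval:
  assumes E: "orthonormal_at A g p DIM('b) E" and X: "X \<in> XM" and Y: "Y \<in> XM"
  shows "g X Y p = (\<Sum>i<DIM('b). g X (E i) p * g Y (E i) p)"
proof -
  obtain V :: "'a vfield \<Rightarrow> 'b" and G :: "'b \<Rightarrow> 'b \<Rightarrow> real" where
    lin: "\<forall>u. linear (G u)" "\<forall>u. linear (\<lambda>v. G v u)"
    and gG: "\<forall>X\<in>XM. \<forall>Y\<in>XM. g X Y p = G (V X) (V Y)"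
    by (rule metric_coordinates)
  let ?I = "{..<DIM('b)}"
  define v where "v i = V (E i)" for i
  have EXM: "E i \<in> XM" if "i \<in> ?I" for i
    using E that by (simp add: orthonormal_at_def)
  have gE: "g Z (E i) p = G (V Z) (v i)" if "Z \<in> XM" "i \<in> ?I" for Z i
    using gG EXM that by (simp add: v_def)
  have Gv: "G (v i) (v j) = (if i = j then 1 else 0)" if "i \<in> ?I" "j \<in> ?I" for i j
    using E that gG EXM by (simp add: orthonormal_at_def v_def)
  have inj: "inj_on v ?I"
    by (rule inj_onI) (use Gv in \<open>metis zero_neq_one\<close>)
  have coef: "G (\<Sum>w\<in>v ` ?I. u w *\<^sub>R w) (v j) = u (v j)" if "j \<in> ?I" for u j
  proof -
    have "G (\<Sum>w\<in>v ` ?I. u w *\<^sub>R w) (v j) = (\<Sum>i\<in>?I. u (v i) * G (v i) (v j))"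
      using lin(2) by (simp add: linear_sum[where f="\<lambda>w. G w (v j)"] linear_scale[where f="\<lambda>w. G w (v j)"]
          sum.reindex[OF inj])
    also have "\<dots> = (\<Sum>i\<in>?I. if i = j then u (v i) else 0)"
      using that by (intro sum.cong) (simp_all add: Gv)
    finally show ?thesis using that by simp
  qed
  have "independent (v ` ?I)"
  proof (rule independent_if_scalars_zero)
    fix u w assume *: "(\<Sum>x\<in>v ` ?I. u x *\<^sub>R x) = 0" "w \<in> v ` ?I"
    then obtain j where j: "j \<in> ?I" "w = v j" by auto
    have "G 0 (v j) = 0" using lin(2) linear_0 by blast
    then show "u w = 0" using coef[OF j(1), of u] * j by simp
  qed simp
  moreover have "card (v ` ?I) = DIM('b)" by (simp add: card_image[OF inj])
  ultimately have "V X \<in> span (v ` ?I)"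
    using card_ge_dim_independent[of "v ` ?I" UNIV] by (auto simp: dim_UNIV)
  then obtain u where u: "V X = (\<Sum>w\<in>v ` ?I. u w *\<^sub>R w)"
    by (auto simp: span_finite)
  have "g X Y p = G (V X) (V Y)" using gG X Y by blast
  also have "\<dots> = (\<Sum>i\<in>?I. u (v i) * G (v i) (V Y))"
    unfolding u using lin(2) by (simp add: linear_sum[where f="\<lambda>w. G w (V Y)"] linear_scale[where f="\<lambda>w. G w (V Y)"]
          sum.reindex[OF inj])
  also have "\<dots> = (\<Sum>i\<in>?I. g X (E i) p * g Y (E i) p)"
  proof (rule sum.cong[OF refl])
    fix i assume i: "i \<in> ?I"
    have "G (v i) (V Y) = g (E i) Y p" using gG EXM[OF i] Y by (simp add: v_def)
    then show "u (v i) * G (v i) (V Y) = g X (E i) p * g Y (E i) p"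
      using coef[OF i, of u] gE[OF X i] u EXM[OF i] Y by (simp add: g_commute)
  qed
  finally show ?thesis .
qed

lemma vfield_outside_span:
  assumes "finite I" "card I < DIM('b)" "\<forall>i\<in>I. F i \<in> XM"
  obtains Y where "Y \<in> XM" "\<forall>h. (\<forall>i\<in>I. h i \<in> CM) \<longrightarrow>
    g (Y - (\<Sum>i\<in>I. h i \<odot> F i)) (Y - (\<Sum>i\<in>I. h i \<odot> F i)) p > 0"
proof -
  obtain V :: "'a vfield \<Rightarrow> 'b" and G :: "'b \<Rightarrow> 'b \<Rightarrow> real" where
    V_add: "\<forall>X\<in>XM. \<forall>Y\<in>XM. V (X + Y) = V X + V Y"
    and V_scale: "\<forall>h\<in>CM. \<forall>X\<in>XM. V (h \<odot> X) = h p *\<^sub>R V X"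
    and V_Basis: "\<forall>b\<in>Basis. \<exists>Y\<in>XM. V Y = b"
    and V_pos: "\<forall>X\<in>XM. V X \<noteq> 0 \<longrightarrow> g X X p > 0"
    by (rule metric_coordinates)
  let ?S = "V ` F ` I"
  have "card ?S < DIM('b)"
    using assms card_image_le[of I F] card_image_le[of "F ` I" V] by simp
  moreover have "dim (span ?S) \<le> card ?S" using assms(1) by (simp add: dim_le_card')
  ultimately have "span ?S \<noteq> UNIV" by (metis dim_UNIV not_le)
  then have "\<not> Basis \<subseteq> span ?S"
    by (metis span_Basis span_mono span_span top.extremum_uniqueI)
  then obtain b Y where b: "b \<notin> span ?S" and Y: "Y \<in> XM" "V Y = b" using V_Basis by blast
  have V_0: "V 0 = 0" using V_add XM_0 by fastforce
  have "g (Y - (\<Sum>i\<in>I. h i \<odot> F i)) (Y - (\<Sum>i\<in>I. h i \<odot> F i)) p > 0"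
    if h: "\<forall>i\<in>I. h i \<in> CM" for h
  proof -
    have "V (\<Sum>i\<in>J. h i \<odot> F i) \<in> span ?S" if "J \<subseteq> I" for J
      using finite_subset[OF that assms(1)] that
    proof (induction J rule: finite_induct)
      case (insert i J)
      then have "V (\<Sum>i\<in>insert i J. h i \<odot> F i) = h i p *\<^sub>R V (F i) + V (\<Sum>i\<in>J. h i \<odot> F i)"
        using V_add V_scale assms(3) h by (simp add: XM_sum subset_iff)
      moreover have "h i p *\<^sub>R V (F i) + V (\<Sum>i\<in>J. h i \<odot> F i) \<in> span ?S"
        by (intro span_add[OF span_scale[OF span_base]]) (use insert in auto)
      ultimately show ?case by simp
    qed (simp add: V_0 span_zero)
    then have W: "V (\<Sum>i\<in>I. h i \<odot> F i) \<in> span ?S" by blast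
    have sXM: "(\<Sum>i\<in>I. h i \<odot> F i) \<in> XM" using assms(3) h by (auto intro: XM_sum)
    let ?Z = "Y - (\<Sum>i\<in>I. h i \<odot> F i)"
    have Z: "?Z \<in> XM" using Y(1) sXM by simp
    have "V (?Z + (\<Sum>i\<in>I. h i \<odot> F i)) = V ?Z + V (\<Sum>i\<in>I. h i \<odot> F i)"
      using V_add Z sXM by blast
    then have "V ?Z \<noteq> 0" using b W Y(2) by auto
    then show ?thesis using V_pos Z by blast
  qed
  with Y(1) that show thesis by blast
qed

end

section \<open>The Levi-Civita connection and its curvature\<close>

locale levi_civita_manifold = riemannian_manifold +
  fixes D :: "'a connection"
  assumes LC: "levi_civita A g D"
begin

lemma D_XM [simp, intro]: "X \<in> XM \<Longrightarrow> Y \<in> XM \<Longrightarrow> D X Y \<in> XM"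
  and D_add_left: "X \<in> XM \<Longrightarrow> Y \<in> XM \<Longrightarrow> Z \<in> XM \<Longrightarrow> D (X + Y) Z = D X Z + D Y Z"
  and D_add_right: "X \<in> XM \<Longrightarrow> Y \<in> XM \<Longrightarrow> Z \<in> XM \<Longrightarrow> D X (Y + Z) = D X Y + D X Z"
  and D_fmul_left: "h \<in> CM \<Longrightarrow> X \<in> XM \<Longrightarrow> Y \<in> XM \<Longrightarrow> D (h \<odot> X) Y = h \<odot> D X Y"
  and D_fmul_right: "h \<in> CM \<Longrightarrow> X \<in> XM \<Longrightarrow> Y \<in> XM \<Longrightarrow> D X (h \<odot> Y) = X h \<odot> Y + h \<odot> D X Y"
  and D_torsion: "X \<in> XM \<Longrightarrow> Y \<in> XM \<Longrightarrow> D X Y - D Y X = lie X Y"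
  and D_metric: "X \<in> XM \<Longrightarrow> Y \<in> XM \<Longrightarrow> Z \<in> XM \<Longrightarrow> Z (g X Y) = g (D Z X) Y + g X (D Z Y)"
  using LC unfolding levi_civita_def affine_connection_def by blast+

lemma fmul_minus_const: "(\<lambda>_. - 1) \<odot> X = - X" "(\<lambda>_. 1) \<odot> X = X" "(\<lambda>_. 0) \<odot> X = 0"
  by (simp_all add: fmul_def fun_eq_iff)

lemma fmul_0 [simp]: "0 \<odot> X = 0"
  by (simp add: fmul_def fun_eq_iff)

lemma D_minus_left: "X \<in> XM \<Longrightarrow> Y \<in> XM \<Longrightarrow> D (- X) Y = - D X Y"
  using D_fmul_left[OF smooth_const[of "-1"], of X Y] by (simp add: fmul_minus_const)

lemma D_minus_right: "X \<in> XM \<Longrightarrow> Y \<in> XM \<Longrightarrow> D X (- Y) = - D X Y"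
  using D_fmul_right[OF smooth_const[of "-1"], of X Y]
  by (simp add: fmul_minus_const vf_const)

lemma D_diff_left: "X \<in> XM \<Longrightarrow> Y \<in> XM \<Longrightarrow> Z \<in> XM \<Longrightarrow> D (X - Y) Z = D X Z - D Y Z"
  using D_add_left[of X "- Y" Z] by (simp add: D_minus_left)

lemma D_diff_right: "X \<in> XM \<Longrightarrow> Y \<in> XM \<Longrightarrow> Z \<in> XM \<Longrightarrow> D X (Y - Z) = D X Y - D X Z"
  using D_add_right[of X Y "- Z"] by (simp add: D_minus_right)

lemma D_0_left [simp]: "Y \<in> XM \<Longrightarrow> D 0 Y = 0"
  using D_diff_left[of Y Y Y] by simp

lemma D_0_right [simp]: "Y \<in> XM \<Longrightarrow> D Y 0 = 0"
  using D_diff_right[of Y Y Y] by simp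

lemma g_D_product: "X \<in> XM \<Longrightarrow> Y \<in> XM \<Longrightarrow> Z \<in> XM \<Longrightarrow> g (D Z X) Y p = Z (g X Y) p - g X (D Z Y) p"
  by (simp add: D_metric)

lemma lie_commute: "lie Y X = - lie X Y"
  by (simp add: lie_def fun_eq_iff)

lemma riem_XM [simp, intro]: "X \<in> XM \<Longrightarrow> Y \<in> XM \<Longrightarrow> Z \<in> XM \<Longrightarrow> riem D X Y Z \<in> XM"
  by (simp add: riem_def)

lemma riem_skew: "X \<in> XM \<Longrightarrow> Y \<in> XM \<Longrightarrow> Z \<in> XM \<Longrightarrow> riem D Y X Z = - riem D X Y Z"
  by (simp add: riem_def lie_commute[of Y X] D_minus_left)

lemma Jacobi:
  assumes "X \<in> XM" "Y \<in> XM" "Z \<in> XM"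
  shows "lie X (lie Y Z) + lie Y (lie Z X) + lie Z (lie X Y) = 0"
proof (rule ext)
  fix f
  show "(lie X (lie Y Z) + lie Y (lie Z X) + lie Z (lie X Y)) f = 0 f"
  proof (cases "f \<in> CM")
    case True
    have 1: "U (V (W f) - W (V f)) = U (V (W f)) - U (W (V f))" if "U \<in> XM" "V \<in> XM" "W \<in> XM" for U V W
      using that True by (intro vf_diff) (auto intro: vf_smooth)
    show ?thesis using assms by (simp add: lie_def 1 fun_eq_iff)
  next
    case False
    then show ?thesis using vf_off[OF XM_lie False] assms by simp
  qed
qed

lemma riem_Bianchi:
  assumes "X \<in> XM" "Y \<in> XM" "Z \<in> XM"
  shows "riem D X Y Z + riem D Y Z X + riem D Z X Y = 0"
proof -
  have 1: "D U (D V W) = D U (D W V) + D U (lie V W)" if "U \<in> XM" "V \<in> XM" "W \<in> XM" for U V W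
    using that by (simp add: D_torsion[symmetric] D_diff_right)
  have 2: "D U (lie V W) - D (lie V W) U = lie U (lie V W)" if "U \<in> XM" "V \<in> XM" "W \<in> XM" for U V W
    using that by (simp add: D_torsion)
  have "riem D X Y Z + riem D Y Z X + riem D Z X Y
      = lie X (lie Y Z) + lie Y (lie Z X) + lie Z (lie X Y)"
    using assms 1[of X Y Z] 1[of Y Z X] 1[of Z X Y]
    by (simp add: riem_def 2[symmetric] algebra_simps)
  then show ?thesis using Jacobi[OF assms] by simp
qed

lemma D2_metric:
  assumes "X \<in> XM" "Y \<in> XM" "Z \<in> XM" "W \<in> XM"
  shows "Z (W (g X Y)) p = g (D Z (D W X)) Y p + g (D W X) (D Z Y) p + g (D Z X) (D W Y) p + g X (D Z (D W Y)) p"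
proof -
  have "Z (W (g X Y)) = Z (g (D W X) Y + g X (D W Y))" by (simp only: D_metric[OF assms(1,2,4)])
  also have "\<dots> = Z (g (D W X) Y) + Z (g X (D W Y))" using assms by (intro vf_add) auto
  finally show ?thesis using assms by (simp add: D_metric)
qed

lemma riem_metric:
  assumes "X \<in> XM" "Y \<in> XM" "Z \<in> XM" "W \<in> XM"
  shows "g (riem D Z W X) Y p = - g X (riem D Z W Y) p"
proof -
  have "lie Z W (g X Y) p = Z (W (g X Y)) p - W (Z (g X Y)) p" by (simp add: lie_def)
  moreover have "lie Z W (g X Y) p = g (D (lie Z W) X) Y p + g X (D (lie Z W) Y) p"
    using assms by (simp add: D_metric)
  ultimately show ?thesis using assms by (simp add: D2_metric riem_def)
qed

lemma Riem_skew12: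
  "X \<in> XM \<Longrightarrow> Y \<in> XM \<Longrightarrow> Z \<in> XM \<Longrightarrow> W \<in> XM \<Longrightarrow> Riem g D Y X Z W p = - Riem g D X Y Z W p"
  using g_commute[of X "riem D Z W Y"] by (simp add: Riem_def riem_metric)

lemma Riem_skew34:
  "X \<in> XM \<Longrightarrow> Y \<in> XM \<Longrightarrow> Z \<in> XM \<Longrightarrow> W \<in> XM \<Longrightarrow> Riem g D X Y W Z p = - Riem g D X Y Z W p"
  by (simp add: Riem_def riem_skew[of Z W])

lemma Riem_Bianchi:
  assumes "X \<in> XM" "Y \<in> XM" "Z \<in> XM" "W \<in> XM"
  shows "Riem g D X Y Z W p + Riem g D X Z W Y p + Riem g D X W Y Z p = 0"
proof -
  have "g (riem D Z W Y + riem D W Y Z + riem D Y Z W) X p = 0"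
    using assms riem_Bianchi[of Z W Y] by simp
  then show ?thesis using assms by (simp add: Riem_def)
qed

lemma Riem_pair:
  assumes "X \<in> XM" "Y \<in> XM" "Z \<in> XM" "W \<in> XM"
  shows "Riem g D X Y Z W p = Riem g D Z W X Y p"
proof -
  let ?R = "\<lambda>X Y Z W. Riem g D X Y Z W p"
  note B = Riem_Bianchi[where p=p]
  have "?R X Y Z W + ?R X Z W Y + ?R X W Y Z = 0" using assms by (intro B)
  moreover have "?R X Y Z W + ?R W Y X Z + ?R Y Z X W = 0"
    using B[of Y Z W X] Riem_skew34[of Y Z X W p] Riem_skew12[of W Y X Z p] Riem_skew12[of X Y Z W p] assms
    by simp
  moreover have "?R Z W X Y + ?R X Z W Y + ?R Y Z X W = 0"
    using B[of Z W X Y] Riem_skew34[of Z X W Y p] Riem_skew12[of X Z W Y p]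
      Riem_skew34[of Z Y X W p] Riem_skew12[of Y Z X W p] assms
    by simp
  moreover have "?R Z W X Y + ?R W Y X Z + ?R X W Y Z = 0"
    using B[of W X Y Z] Riem_skew34[of W Y X Z p] Riem_skew12[of Z W X Y p] Riem_skew12[of X W Y Z p] assms
    by simp
  ultimately show ?thesis by linarith
qed

lemma Riem_add1: "X \<in> XM \<Longrightarrow> X' \<in> XM \<Longrightarrow> Y \<in> XM \<Longrightarrow> Z \<in> XM \<Longrightarrow> W \<in> XM \<Longrightarrow>
    Riem g D (X + X') Y Z W p = Riem g D X Y Z W p + Riem g D X' Y Z W p"
  and Riem_fmul1: "h \<in> CM \<Longrightarrow> X \<in> XM \<Longrightarrow> Y \<in> XM \<Longrightarrow> Z \<in> XM \<Longrightarrow> W \<in> XM \<Longrightarrow>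
    Riem g D (h \<odot> X) Y Z W p = h p * Riem g D X Y Z W p"
  by (simp_all add: Riem_def)

lemma Riem_add2: "X \<in> XM \<Longrightarrow> Y' \<in> XM \<Longrightarrow> Y \<in> XM \<Longrightarrow> Z \<in> XM \<Longrightarrow> W \<in> XM \<Longrightarrow>
    Riem g D X (Y + Y') Z W p = Riem g D X Y Z W p + Riem g D X Y' Z W p"
  and Riem_fmul2: "h \<in> CM \<Longrightarrow> X \<in> XM \<Longrightarrow> Y \<in> XM \<Longrightarrow> Z \<in> XM \<Longrightarrow> W \<in> XM \<Longrightarrow>
    Riem g D X (h \<odot> Y) Z W p = h p * Riem g D X Y Z W p"
  by (simp_all add: Riem_skew12[of _ X] Riem_add1 Riem_fmul1)

end

section \<open>Manifolds of Kenmotsu type\<close>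

locale kenmotsu_manifold = levi_civita_manifold +
  fixes n :: nat and \<Phi> :: "'a vfield \<Rightarrow> 'a vfield" and \<xi> :: "'a vfield" and \<eta> :: "'a vfield \<Rightarrow> 'a \<Rightarrow> real"
  assumes acr: "acr_manifold n A \<Phi> \<xi> \<eta> g"
    and kenmotsu: "kenmotsu_type A \<Phi> \<eta> D"
begin

lemma dim: "DIM('b) = 2 * n + 1"
  using acr unfolding acr_manifold_def by blast

lemma xi_XM [simp, intro]: "\<xi> \<in> XM"
  and eta: "X \<in> XM \<Longrightarrow> \<eta> X = g X \<xi>"
  and Phi_XM [simp, intro]: "X \<in> XM \<Longrightarrow> \<Phi> X \<in> XM"
  and Phi_add: "X \<in> XM \<Longrightarrow> Y \<in> XM \<Longrightarrow> \<Phi> (X + Y) = \<Phi> X + \<Phi> Y"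
  and Phi_fmul: "h \<in> CM \<Longrightarrow> X \<in> XM \<Longrightarrow> \<Phi> (h \<odot> X) = h \<odot> \<Phi> X"
  and Phi_xi [simp]: "\<Phi> \<xi> = 0"
  using acr unfolding acr_manifold_def by blast+

lemma g_xi_xi [simp]: "g \<xi> \<xi> p = 1"
  using acr eta[OF xi_XM] unfolding acr_manifold_def by simp

lemma g_Phi_xi [simp]: assumes "X \<in> XM" shows "g (\<Phi> X) \<xi> p = 0" "g \<xi> (\<Phi> X) p = 0"
proof -
  have "\<eta> (\<Phi> X) = 0" using acr assms unfolding acr_manifold_def by blast
  then show "g (\<Phi> X) \<xi> p = 0" using eta[of "\<Phi> X"] assms by simp
  then show "g \<xi> (\<Phi> X) p = 0" using g_commute[of \<xi> "\<Phi> X"] assms by simp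
qed

lemma Phi_Phi: assumes "X \<in> XM" shows "\<Phi> (\<Phi> X) = - X + g X \<xi> \<odot> \<xi>"
proof -
  have "\<Phi> (\<Phi> X) = - X + \<eta> X \<odot> \<xi>" using acr assms unfolding acr_manifold_def by blast
  then show ?thesis by (simp only: eta[OF assms])
qed

lemma g_Phi_Phi:
  assumes "X \<in> XM" "Y \<in> XM" shows "g (\<Phi> X) (\<Phi> Y) p = g X Y p - g X \<xi> p * g Y \<xi> p"
proof -
  have "g (\<Phi> X) (\<Phi> Y) = g X Y - \<eta> X * \<eta> Y" using acr assms unfolding acr_manifold_def by blast
  then show ?thesis by (simp add: eta assms)
qed

lemma g_Phi_skew:
  assumes "X \<in> XM" "Y \<in> XM" shows "g (\<Phi> X) Y p = - g X (\<Phi> Y) p"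
  using g_Phi_Phi[of "\<Phi> X" Y p] g_Phi_xi[of Y p] assms by (simp add: Phi_Phi)

lemma Phi_0 [simp]: "\<Phi> 0 = 0"
  using Phi_fmul[of 0 \<xi>] by simp

lemma Phi_minus: "X \<in> XM \<Longrightarrow> \<Phi> (- X) = - \<Phi> X"
  using Phi_fmul[OF smooth_const[of "-1"], of X] by (simp add: fmul_minus1)

lemma Phi_diff: "X \<in> XM \<Longrightarrow> Y \<in> XM \<Longrightarrow> \<Phi> (X - Y) = \<Phi> X - \<Phi> Y"
  using Phi_add[of X "- Y"] by (simp add: Phi_minus)

lemma kenmotsu_eq:
  assumes "X \<in> XM" "Y \<in> XM"
  shows "cov_Phi D \<Phi> X Y - cov_Phi D \<Phi> (\<Phi> X) (\<Phi> Y) = - (g Y \<xi> \<odot> \<Phi> X)"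
  using kenmotsu eta assms unfolding kenmotsu_type_def by simp

lemma fmul_1 [simp]: "1 \<odot> X = X"
  by (simp add: fmul_def fun_eq_iff)

lemma g_xi_xi_fun: "g \<xi> \<xi> = 1"
  by (simp add: fun_eq_iff)

lemma g_D_xi_xi: assumes "X \<in> XM" shows "g (D X \<xi>) \<xi> p = 0"
proof -
  have "X (g \<xi> \<xi>) = 0" unfolding g_xi_xi_fun one_fun_def by (rule vf_const[OF assms])
  then have "g (D X \<xi>) \<xi> p + g \<xi> (D X \<xi>) p = 0"
    using D_metric[OF xi_XM xi_XM assms] by (metis plus_fun_apply zero_fun_apply)
  then show ?thesis using g_commute[OF xi_XM D_XM[OF assms xi_XM]] by simp
qed

lemma D_xi: assumes "X \<in> XM" shows "D X \<xi> = X - g X \<xi> \<odot> \<xi>"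
proof -
  have "\<Phi> (D X \<xi>) = \<Phi> X"
    using kenmotsu_eq[OF assms xi_XM] assms by (simp add: cov_Phi_def g_xi_xi_fun)
  then have "- D X \<xi> + g (D X \<xi>) \<xi> \<odot> \<xi> = - X + g X \<xi> \<odot> \<xi>"
    using Phi_Phi[of "D X \<xi>"] Phi_Phi[of X] assms by simp
  moreover have "g (D X \<xi>) \<xi> = 0" using g_D_xi_xi[OF assms] by (simp add: fun_eq_iff)
  ultimately have "- D X \<xi> = - X + g X \<xi> \<odot> \<xi>" by simp
  then have "- (- D X \<xi>) = - (- X + g X \<xi> \<odot> \<xi>)" by (rule arg_cong)
  then show ?thesis by simp
qed

lemma g_D_xi: "X \<in> XM \<Longrightarrow> Y \<in> XM \<Longrightarrow> g (D X Y) \<xi> p = X (g Y \<xi>) p - g X Y p + g X \<xi> p * g Y \<xi> p"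
  using g_D_product[of Y \<xi> X p] g_commute[of X Y] by (simp add: D_xi)

lemma g_lie_xi:
  assumes "X \<in> XM" "Y \<in> XM"
  shows "X (g Y \<xi>) p - Y (g X \<xi>) p = g (lie X Y) \<xi> p"
  using assms g_commute[of X Y] by (simp add: D_torsion[symmetric] g_D_xi)

lemma riem_xi:
  assumes "X \<in> XM" "Y \<in> XM" "Z \<in> XM"
  shows "g (riem D X Y \<xi>) Z p = g X \<xi> p * g Y Z p - g Y \<xi> p * g X Z p"
proof -
  have 1: "D X (D Y \<xi>) = D X Y - (X (g Y \<xi>) \<odot> \<xi> + g Y \<xi> \<odot> (X - g X \<xi> \<odot> \<xi>))" if "X \<in> XM" "Y \<in> XM" for X Y
    using that by (simp add: D_xi D_diff_right D_fmul_right)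
  have XY: "X (g Y \<xi>) \<in> CM" "Y (g X \<xi>) \<in> CM" using assms vf_smooth by auto
  have "g (riem D X Y \<xi>) Z p = g (D X (D Y \<xi>)) Z p - g (D Y (D X \<xi>)) Z p - g (D (lie X Y) \<xi>) Z p"
    using assms by (simp add: riem_def)
  also have "\<dots> = g X \<xi> p * g Y Z p - g Y \<xi> p * g X Z p
      - (X (g Y \<xi>) p - Y (g X \<xi>) p - g (lie X Y) \<xi> p) * g \<xi> Z p
      + (g (D X Y) Z p - g (D Y X) Z p - g (lie X Y) Z p)"
    using assms XY by (simp add: 1 D_xi[OF XM_lie] algebra_simps)
  also have "g (D X Y) Z p - g (D Y X) Z p - g (lie X Y) Z p = 0"
    using assms by (simp add: D_torsion[symmetric])
  finally show ?thesis using g_lie_xi[OF assms(1,2)] by simp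
qed

lemma Riem_xi:
  assumes "X \<in> XM" "Y \<in> XM" "Z \<in> XM"
  shows "Riem g D Z \<xi> X Y p = g X \<xi> p * g Y Z p - g Y \<xi> p * g X Z p"
  using riem_xi[OF assms] by (simp add: Riem_def)

definition K where
  "K X Y Z q = g (D X (\<Phi> Y)) Z q + g (D X Y) (\<Phi> Z) q"

lemma K_eq_cov: "X \<in> XM \<Longrightarrow> Y \<in> XM \<Longrightarrow> Z \<in> XM \<Longrightarrow> K X Y Z q = g (cov_Phi D \<Phi> X Y) Z q"
  by (simp add: K_def cov_Phi_def g_Phi_skew)

lemma K_Phi_Phi:
  assumes "X \<in> XM" "Y \<in> XM" "Z \<in> XM" "g Y \<xi> q = 0"
  shows "K (\<Phi> X) (\<Phi> Y) Z q = K X Y Z q"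
proof -
  have "g (cov_Phi D \<Phi> X Y - cov_Phi D \<Phi> (\<Phi> X) (\<Phi> Y)) Z q = 0"
    using assms by (simp add: kenmotsu_eq)
  then show ?thesis using assms by (simp add: K_eq_cov) (simp add: cov_Phi_def)
qed

lemma K_Phi_swap:
  assumes "X \<in> XM" "Y \<in> XM" "Z \<in> XM" "g Y \<xi> q = 0" "g Z \<xi> q = 0"
  shows "K X (\<Phi> Y) Z q = K X Y (\<Phi> Z) q"
  using assms g_commute[of \<xi> Z] vf_smooth[OF assms(1), of "g Y \<xi>"]
  by (simp add: K_def Phi_Phi D_diff_right D_fmul_right)

lemma K_Phi_left:
  assumes "X \<in> XM" "Y \<in> XM" "Z \<in> XM" "g Y \<xi> q = 0" "g Z \<xi> q = 0"
  shows "K (\<Phi> X) Y Z q = - K X Y (\<Phi> Z) q" "K (\<Phi> X) Y (\<Phi> Z) q = K X Y Z q"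
proof -
  have "K X Y (\<Phi> Z) q = K (\<Phi> X) (\<Phi> Y) (\<Phi> Z) q" using assms by (simp add: K_Phi_Phi)
  also have "\<dots> = K (\<Phi> X) (\<Phi> (\<Phi> Y)) Z q" using assms by (simp add: K_Phi_swap)
  also have "\<dots> = - K (\<Phi> X) Y Z q"
    using assms vf_smooth[OF Phi_XM[OF assms(1)], of "g Y \<xi>"]
    by (simp add: K_def Phi_Phi Phi_diff Phi_fmul D_diff_right D_fmul_right)
  finally show "K (\<Phi> X) Y Z q = - K X Y (\<Phi> Z) q" by simp
  have "K (\<Phi> X) Y (\<Phi> Z) q = K (\<Phi> X) (\<Phi> Y) Z q" using assms by (simp add: K_Phi_swap)
  then show "K (\<Phi> X) Y (\<Phi> Z) q = K X Y Z q" using assms by (simp add: K_Phi_Phi)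
qed

definition adapted where
  "adapted k e q \<longleftrightarrow> (\<forall>a\<in>{1..k}. e a \<in> XM \<and> g (e a) \<xi> q = 0 \<and>
     (\<forall>b\<in>{1..k}. g (e a) (e b) q = (if a = b then 1 else 0) \<and> g (e a) (\<Phi> (e b)) q = 0))"

lemma adaptedD:
  assumes "adapted k e q" "a \<in> {1..k}"
  shows "e a \<in> XM" "g (e a) \<xi> q = 0" "g \<xi> (e a) q = 0"
    and "b \<in> {1..k} \<Longrightarrow> g (e a) (e b) q = (if a = b then 1 else 0)"
    and "b \<in> {1..k} \<Longrightarrow> g (e a) (\<Phi> (e b)) q = 0"
    and "b \<in> {1..k} \<Longrightarrow> g (\<Phi> (e a)) (e b) q = 0"
    and "b \<in> {1..k} \<Longrightarrow> g (\<Phi> (e a)) (\<Phi> (e b)) q = (if a = b then 1 else 0)"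
proof -
  note ad = assms(1)[unfolded adapted_def, rule_format]
  show 1: "e a \<in> XM" "g (e a) \<xi> q = 0" using ad[OF assms(2)] by blast+
  then show "g \<xi> (e a) q = 0" using g_commute[of \<xi> "e a"] by simp
  assume b: "b \<in> {1..k}"
  then show 2: "g (e a) (e b) q = (if a = b then 1 else 0)" "g (e a) (\<Phi> (e b)) q = 0"
    using ad[OF assms(2)] by blast+
  have eb: "e b \<in> XM" using ad[OF b] by blast
  show "g (\<Phi> (e a)) (e b) q = 0" using g_Phi_skew[OF 1(1) eb] 2 by simp
  show "g (\<Phi> (e a)) (\<Phi> (e b)) q = (if a = b then 1 else 0)" using g_Phi_Phi[OF 1(1) eb] 1 2 by simp
qed

lemma orthonormal_iff_adapted:
  "orthonormal_at A g q (2 * k + 1) (real_frame k \<Phi> \<xi> e) \<longleftrightarrow> adapted k e q"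
proof
  assume on: "orthonormal_at A g q (2 * k + 1) (real_frame k \<Phi> \<xi> e)"
  show "adapted k e q"
    unfolding adapted_def
  proof (intro ballI conjI)
    fix a assume a: "a \<in> {1..k}"
    then have "real_frame k \<Phi> \<xi> e a \<in> XM" "g (real_frame k \<Phi> \<xi> e a) (real_frame k \<Phi> \<xi> e 0) q = 0"
      using on unfolding orthonormal_at_def by auto
    with a show "e a \<in> XM" "g (e a) \<xi> q = 0" by (simp_all add: real_frame_def)
    fix b assume b: "b \<in> {1..k}"
    then have "g (real_frame k \<Phi> \<xi> e a) (real_frame k \<Phi> \<xi> e b) q = (if a = b then 1 else 0)"
       "g (real_frame k \<Phi> \<xi> e a) (real_frame k \<Phi> \<xi> e (b + k)) q = 0"
      using on a unfolding orthonormal_at_def by auto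
    with a b show "g (e a) (e b) q = (if a = b then 1 else 0)" "g (e a) (\<Phi> (e b)) q = 0"
      by (simp_all add: real_frame_def)
  qed
next
  assume ad: "adapted k e q"
  note adD = adaptedD[OF ad]
  have cases: "i = 0 \<or> i \<in> {1..k} \<or> (\<exists>a\<in>{1..k}. i = a + k)" if "i < 2 * k + 1" for i
  proof (cases "i \<le> k")
    case False
    with that have "i - k \<in> {1..k}" "i = (i - k) + k" by auto
    then show ?thesis by blast
  qed auto
  show "orthonormal_at A g q (2 * k + 1) (real_frame k \<Phi> \<xi> e)"
    unfolding orthonormal_at_def
  proof (intro conjI allI impI)
    fix i assume i: "i < 2 * k + 1"
    show "real_frame k \<Phi> \<xi> e i \<in> XM"
      using cases[OF i] adD(1) by (auto simp: real_frame_def)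
    fix j assume j: "j < 2 * k + 1"
    show "g (real_frame k \<Phi> \<xi> e i) (real_frame k \<Phi> \<xi> e j) q = (if i = j then 1 else 0)"
      using cases[OF i] cases[OF j] by (elim disjE bexE) (auto simp: real_frame_def adD)
  qed
qed

lemma adapted_exists:
  assumes "k \<le> n"
  obtains U e where "open U" "p \<in> U" "\<forall>q\<in>U. adapted k e q"
proof -
  from assms have "\<exists>U e. open U \<and> p \<in> U \<and> (\<forall>q\<in>U. adapted k e q)"
  proof (induction k)
    case 0
    show ?case by (rule exI[of _ UNIV]) (simp add: adapted_def)
  next
    case (Suc k)
    then obtain U e where U: "open U" "p \<in> U" and ad: "\<forall>q\<in>U. adapted k e q"
      by auto
    let ?F = "real_frame k \<Phi> \<xi> e"
    have on: "orthonormal_at A g q (2 * k + 1) ?F" if "q \<in> U" for q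
      using ad that orthonormal_iff_adapted by blast
    have FXM: "\<forall>i\<in>{..2*k}. ?F i \<in> XM"
      using on[OF U(2)] by (simp add: orthonormal_at_def)
    have eXM: "e a \<in> XM" if "a \<in> {1..k}" for a using adaptedD(1) ad U(2) that by blast
    have "card {..2*k} < DIM('b)" using Suc.prems dim by simp
    from vfield_outside_span[OF finite_atMost this FXM, of p]
    obtain Y where Y: "Y \<in> XM" and pos: "\<forall>h. (\<forall>i\<in>{..2*k}. h i \<in> CM) \<longrightarrow>
      g (Y - (\<Sum>i\<in>{..2*k}. h i \<odot> ?F i)) (Y - (\<Sum>i\<in>{..2*k}. h i \<odot> ?F i)) p > 0"
      by blast
    define Z where "Z = Y - (\<Sum>i\<in>{..2*k}. g Y (?F i) \<odot> ?F i)"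
    have Z: "Z \<in> XM" unfolding Z_def using Y FXM by (intro XM_diff XM_sum XM_fmul g_smooth) auto
    have "\<forall>i\<in>{..2*k}. g Y (?F i) \<in> CM" using Y FXM by auto
    from pos[THEN spec, THEN mp, OF this] have "g Z Z p > 0" unfolding Z_def .
    moreover have "open {q. g Z Z q > 0}" using Z by (intro open_smooth_pos) simp
    ultimately obtain \<rho> V where \<rho>: "\<rho> \<in> CM" "open V" "p \<in> V" "\<forall>q\<in>V. \<rho> q = g Z Z q powr (- 1/2)"
      by - (rule smooth_local_powr[of "g Z Z" "{q. g Z Z q > 0}" p "- 1/2"]; use Z in simp)
    have orth: "g Z (?F j) q = 0" if "q \<in> U" "j \<le> 2 * k" for q j
    proof -
      have "g Z (?F j) q = g Y (?F j) q - (\<Sum>i\<in>{..2*k}. g Y (?F i) q * g (?F i) (?F j) q)"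
      proof -
        have F: "?F i \<in> XM" if "i \<le> 2 * k" for i using FXM that by simp
        have "(\<Sum>i\<in>{..2*k}. g Y (?F i) \<odot> ?F i) \<in> XM" using Y F by (intro XM_sum) simp
        moreover have "g (\<Sum>i\<in>{..2*k}. g Y (?F i) \<odot> ?F i) (?F j) q
            = (\<Sum>i\<in>{..2*k}. g (g Y (?F i) \<odot> ?F i) (?F j) q)"
          using Y F that(2) by (intro g_sum_left) simp_all
        ultimately show ?thesis using Y F that(2) unfolding Z_def by simp
      qed
      also have "(\<Sum>i\<in>{..2*k}. g Y (?F i) q * g (?F i) (?F j) q) = (\<Sum>i\<in>{..2*k}. if i = j then g Y (?F j) q else 0)"
        using on[OF that(1)] that(2) by (intro sum.cong) (auto simp: orthonormal_at_def)
      finally show ?thesis using that(2) by simp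
    qed
    define e' where "e' = e(Suc k := \<rho> \<odot> Z)"
    let ?U = "U \<inter> V \<inter> {q. g Z Z q > 0}"
    have "adapted (Suc k) e' q" if q: "q \<in> ?U" for q
    proof -
      have adq: "adapted k e q" using ad q by blast
      note adD = adaptedD[OF adq]
      have Zxi: "g Z \<xi> q = 0" using orth[of q 0] q by (simp add: real_frame_def)
      have Ze: "g Z (e b) q = 0" "g Z (\<Phi> (e b)) q = 0" if "b \<in> {1..k}" for b
        using orth[of q b] orth[of q "b + k"] q that by (auto simp: real_frame_def)
      have eZ: "g (e b) Z q = 0" "g (e b) (\<Phi> Z) q = 0" if "b \<in> {1..k}" for b
        using Ze[OF that] g_commute[OF Z eXM[OF that]] g_Phi_skew[OF eXM[OF that] Z, of q]
          g_commute[OF Z Phi_XM[OF eXM[OF that]]] by simp_all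
      have ZZ: "g Z (\<Phi> Z) q = 0"
        using g_Phi_skew[OF Z Z, of q] g_commute[OF Z Phi_XM[OF Z]] by simp
      have "\<rho> q * (\<rho> q * g Z Z q) = (g Z Z q powr (- 1/2) * g Z Z q powr (- 1/2)) * g Z Z q powr 1"
        using q \<rho>(4) by simp
      also have "\<dots> = 1" using q by (simp add: powr_add[symmetric] del: powr_one)
      finally have norm: "\<rho> q * (\<rho> q * g Z Z q) = 1" .
      have split: "a \<in> {1..Suc k} \<longleftrightarrow> a = Suc k \<or> a \<in> {1..k} \<and> a \<noteq> Suc k" for a by auto
      show ?thesis
        unfolding adapted_def e'_def split
        using Z \<rho>(1) Zxi Ze eZ ZZ norm adD eXM by (auto simp: Phi_fmul)
    qed
    moreover have "open ?U" using U \<rho>(2) \<open>open {q. g Z Z q > 0}\<close> by auto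
    ultimately show ?case using U \<rho>(3) \<open>g Z Z p > 0\<close> by blast
  qed
  with that show thesis by blast
qed

end

section \<open>Complex-valued functions and one-forms\<close>

context smooth_manifold
begin

abbreviation "CS \<equiv> csmooth_fns A"

lemma CS_iff: "f \<in> CS \<longleftrightarrow> (\<lambda>p. Re (f p)) \<in> CM \<and> (\<lambda>p. Im (f p)) \<in> CM"
  by (simp add: csmooth_fns_def)

lemma CS_const [simp, intro]: "(\<lambda>p. c) \<in> CS"
  and CS_add [simp, intro]: "f \<in> CS \<Longrightarrow> h \<in> CS \<Longrightarrow> (\<lambda>p. f p + h p) \<in> CS"
  and CS_diff [simp, intro]: "f \<in> CS \<Longrightarrow> h \<in> CS \<Longrightarrow> (\<lambda>p. f p - h p) \<in> CS"
  and CS_mult [simp, intro]: "f \<in> CS \<Longrightarrow> h \<in> CS \<Longrightarrow> (\<lambda>p. f p * h p) \<in> CS"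
  and CS_cnj [simp, intro]: "f \<in> CS \<Longrightarrow> (\<lambda>p. cnj (f p)) \<in> CS"
  and CS_minus [simp, intro]: "f \<in> CS \<Longrightarrow> (\<lambda>p. - f p) \<in> CS"
  and CS_of_real [simp, intro]: "r \<in> CM \<Longrightarrow> (\<lambda>p. of_real (r p)) \<in> CS"
  by (auto simp: CS_iff)

lemma CS_divide [simp, intro]: "f \<in> CS \<Longrightarrow> (\<lambda>p. f p / c) \<in> CS"
  using CS_mult[OF _ CS_const, of f "inverse c"] by (simp add: divide_inverse)

lemma CS_sum [intro]: "(\<And>i. i \<in> I \<Longrightarrow> f i \<in> CS) \<Longrightarrow> (\<lambda>p. \<Sum>i\<in>I. f i p) \<in> CS"
  by (induction I rule: infinite_finite_induct) simp_all

context
  fixes X :: "'m vfield"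
  assumes X: "X \<in> XM"
begin

lemma cder_const: "cder X (\<lambda>p. c) q = 0"
  using X by (simp add: cder_def vf_const zero_complex.code)

lemma cder_add: "f \<in> CS \<Longrightarrow> h \<in> CS \<Longrightarrow> cder X (\<lambda>p. f p + h p) q = cder X f q + cder X h q"
  by (simp add: cder_def CS_iff vf_pointwise[OF X] vf_minus[OF X] complex_eq_iff)

lemma cder_diff: "f \<in> CS \<Longrightarrow> h \<in> CS \<Longrightarrow> cder X (\<lambda>p. f p - h p) q = cder X f q - cder X h q"
  by (simp add: cder_def CS_iff vf_pointwise[OF X] vf_minus[OF X] complex_eq_iff)

lemma cder_minus: "f \<in> CS \<Longrightarrow> cder X (\<lambda>p. - f p) q = - cder X f q"
  by (simp add: cder_def CS_iff vf_pointwise[OF X] vf_minus[OF X] complex_eq_iff)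

lemma cder_cnj: "f \<in> CS \<Longrightarrow> cder X (\<lambda>p. cnj (f p)) q = cnj (cder X f q)"
  by (simp add: cder_def CS_iff vf_pointwise[OF X] vf_minus[OF X] complex_eq_iff)

lemma cder_mult: "f \<in> CS \<Longrightarrow> h \<in> CS \<Longrightarrow> cder X (\<lambda>p. f p * h p) q = f q * cder X h q + h q * cder X f q"
  by (simp add: cder_def CS_iff vf_pointwise[OF X] complex_eq_iff algebra_simps)

lemma cder_cmult: "f \<in> CS \<Longrightarrow> cder X (\<lambda>p. c * f p) q = c * cder X f q"
  by (simp add: cder_mult[OF CS_const] cder_const)

lemma cder_divide: "f \<in> CS \<Longrightarrow> cder X (\<lambda>p. f p / c) q = cder X f q / c"
  using cder_cmult[of f "inverse c"] by (simp add: divide_inverse mult.commute)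

lemma cder_of_real: "r \<in> CM \<Longrightarrow> cder X (\<lambda>p. of_real (r p)) q = of_real (X r q)"
  by (simp add: cder_def vf_const[OF X] complex_eq_iff)

lemma cder_sum:
  "(\<And>i. i \<in> I \<Longrightarrow> f i \<in> CS) \<Longrightarrow> cder X (\<lambda>p. \<Sum>i\<in>I. f i p) q = (\<Sum>i\<in>I. cder X (f i) q)"
  by (induction I rule: infinite_finite_induct) (simp_all add: cder_const cder_add CS_sum)

lemma cder_local:
  assumes "f \<in> CS" "h \<in> CS" "open W" "p \<in> W" "\<And>q. q \<in> W \<Longrightarrow> f q = h q"
  shows "cder X f p = cder X h p"
proof -
  have "X (\<lambda>q. Re (f q)) p = X (\<lambda>q. Re (h q)) p" "X (\<lambda>q. Im (f q)) p = X (\<lambda>q. Im (h q)) p"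
    by (rule vf_local[OF X _ _ assms(3,4)]; use assms CS_iff in simp)+
  then show ?thesis by (simp add: cder_def)
qed

end

lemma one_formD:
  assumes "one_form A \<alpha>" "X \<in> XM"
  shows "\<alpha> X \<in> CS" "Y \<in> XM \<Longrightarrow> \<alpha> (X + Y) q = \<alpha> X q + \<alpha> Y q"
    "h \<in> CM \<Longrightarrow> \<alpha> (h \<odot> X) q = of_real (h q) * \<alpha> X q"
  using assms unfolding one_form_def by auto

lemma one_formI:
  assumes "\<And>X. X \<in> XM \<Longrightarrow> \<alpha> X \<in> CS"
    "\<And>X Y q. X \<in> XM \<Longrightarrow> Y \<in> XM \<Longrightarrow> \<alpha> (X + Y) q = \<alpha> X q + \<alpha> Y q"
    "\<And>h X q. h \<in> CM \<Longrightarrow> X \<in> XM \<Longrightarrow> \<alpha> (h \<odot> X) q = of_real (h q) * \<alpha> X q"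
  shows "one_form A \<alpha>"
  using assms unfolding one_form_def by (simp add: fun_eq_iff)

lemma ext_d_local:
  assumes "one_form A \<alpha>" "one_form A \<beta>" "open W" "p \<in> W" "X \<in> XM" "Y \<in> XM"
    "\<And>q Z. q \<in> W \<Longrightarrow> Z \<in> XM \<Longrightarrow> \<alpha> Z q = \<beta> Z q"
  shows "ext_d \<alpha> X Y p = ext_d \<beta> X Y p"
proof -
  note CS = one_formD(1)[OF assms(1)] one_formD(1)[OF assms(2)]
  have "cder X (\<alpha> Y) p = cder X (\<beta> Y) p"
    by (rule cder_local[OF assms(5) CS(1)[OF assms(6)] CS(2)[OF assms(6)] assms(3,4) assms(7)[OF _ assms(6)]])
  moreover have "cder Y (\<alpha> X) p = cder Y (\<beta> X) p"
    by (rule cder_local[OF assms(6) CS(1)[OF assms(5)] CS(2)[OF assms(5)] assms(3,4) assms(7)[OF _ assms(5)]])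
  ultimately show ?thesis using assms by (simp add: ext_d_def)
qed

end

section \<open>The A-frame\<close>

locale kenmotsu_frame = kenmotsu_manifold +
  fixes U :: "'a set" and e :: "nat \<Rightarrow> 'a vfield"
  assumes U_open: "open U" and U_nonempty: "U \<noteq> {}"
    and adapted: "q \<in> U \<Longrightarrow> adapted n e q"
begin

lemma e_XM [simp, intro]: "a \<in> {1..n} \<Longrightarrow> e a \<in> XM"
  using adaptedD(1)[OF adapted] U_nonempty by blast

lemma g_frame [simp]:
  assumes "q \<in> U" "a \<in> {1..n}"
  shows "g (e a) \<xi> q = 0" "g \<xi> (e a) q = 0"
    and "b \<in> {1..n} \<Longrightarrow> g (e a) (e b) q = (if a = b then 1 else 0)"
    and "b \<in> {1..n} \<Longrightarrow> g (e a) (\<Phi> (e b)) q = 0"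
    and "b \<in> {1..n} \<Longrightarrow> g (\<Phi> (e a)) (e b) q = 0"
    and "b \<in> {1..n} \<Longrightarrow> g (\<Phi> (e a)) (\<Phi> (e b)) q = (if a = b then 1 else 0)"
  using adaptedD[OF adapted[OF assms(1)] assms(2)] by blast+

text \<open>Values of (the complex-linear extension of) \<open>u\<close> on \<open>\<epsilon>\<^sub>a\<close> and on its conjugate.\<close>

definition dn :: "('a vfield \<Rightarrow> complex) \<Rightarrow> nat \<Rightarrow> complex" where
  "dn u a = (u (e a) - \<i> * u (\<Phi> (e a))) / of_real (sqrt 2)"

definition up :: "('a vfield \<Rightarrow> complex) \<Rightarrow> nat \<Rightarrow> complex" where
  "up u a = (u (e a) + \<i> * u (\<Phi> (e a))) / of_real (sqrt 2)"

lemma sqrt2 [simp]: "complex_of_real (sqrt 2) * complex_of_real (sqrt 2) = 2"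
  by (metis of_real_mult of_real_numeral real_sqrt_mult_self abs_numeral)

lemma dn_add: "dn (\<lambda>Z. u Z + v Z) a = dn u a + dn v a"
  and dn_diff: "dn (\<lambda>Z. u Z - v Z) a = dn u a - dn v a"
  and dn_minus: "dn (\<lambda>Z. - u Z) a = - dn u a"
  and dn_cmult: "dn (\<lambda>Z. c * u Z) a = c * dn u a"
  and dn_multc: "dn (\<lambda>Z. u Z * c) a = dn u a * c"
  and dn_cnj: "dn (\<lambda>Z. cnj (u Z)) a = cnj (up u a)"
  and up_add: "up (\<lambda>Z. u Z + v Z) a = up u a + up v a"
  and up_diff: "up (\<lambda>Z. u Z - v Z) a = up u a - up v a"
  and up_minus: "up (\<lambda>Z. - u Z) a = - up u a"
  and up_cmult: "up (\<lambda>Z. c * u Z) a = c * up u a"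
  and up_multc: "up (\<lambda>Z. u Z * c) a = up u a * c"
  and up_cnj: "up (\<lambda>Z. cnj (u Z)) a = cnj (dn u a)"
  and dn_0: "dn (\<lambda>Z. 0) a = 0"
  and up_0: "up (\<lambda>Z. 0) a = 0"
  by (simp_all add: dn_def up_def algebra_simps diff_divide_distrib add_divide_distrib)

lemma dn_sum: "dn (\<lambda>Z. \<Sum>i\<in>I. u i Z) a = (\<Sum>i\<in>I. dn (u i) a)"
  by (induction I rule: infinite_finite_induct) (simp_all add: dn_0 dn_add)

lemma up_sum: "up (\<lambda>Z. \<Sum>i\<in>I. u i Z) a = (\<Sum>i\<in>I. up (u i) a)"
  by (induction I rule: infinite_finite_induct) (simp_all add: up_0 up_add)

lemmas dn_linear = dn_add dn_diff dn_minus dn_cmult dn_multc dn_cnj dn_sum dn_0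
lemmas up_linear = up_add up_diff up_minus up_cmult up_multc up_cnj up_sum up_0

lemma dn_cong: "u (e a) = v (e a) \<Longrightarrow> u (\<Phi> (e a)) = v (\<Phi> (e a)) \<Longrightarrow> dn u a = dn v a"
  and up_cong: "u (e a) = v (e a) \<Longrightarrow> u (\<Phi> (e a)) = v (\<Phi> (e a)) \<Longrightarrow> up u a = up v a"
  by (simp_all add: dn_def up_def)

lemma dn_up_swap: "dn (\<lambda>W. up (\<lambda>Z. h Z W) a) b = up (\<lambda>Z. dn (h Z) b) a"
  and up_up_swap: "up (\<lambda>W. up (\<lambda>Z. h Z W) a) b = up (\<lambda>Z. up (h Z) b) a"
  and dn_dn_swap: "dn (\<lambda>W. dn (\<lambda>Z. h Z W) a) b = dn (\<lambda>Z. dn (h Z) b) a"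
  by (simp_all add: dn_def up_def algebra_simps diff_divide_distrib add_divide_distrib)

lemma dn_smooth: "u (e a) \<in> CS \<Longrightarrow> u (\<Phi> (e a)) \<in> CS \<Longrightarrow> (\<lambda>q. dn (\<lambda>Z. u Z q) a) \<in> CS"
  and up_smooth: "u (e a) \<in> CS \<Longrightarrow> u (\<Phi> (e a)) \<in> CS \<Longrightarrow> (\<lambda>q. up (\<lambda>Z. u Z q) a) \<in> CS"
  by (simp_all add: dn_def up_def)

lemma cder_dn:
    "X \<in> XM \<Longrightarrow> u (e a) \<in> CS \<Longrightarrow> u (\<Phi> (e a)) \<in> CS \<Longrightarrow>
      cder X (\<lambda>q. dn (\<lambda>Z. u Z q) a) p = dn (\<lambda>Z. cder X (u Z) p) a"
  and cder_up:
    "X \<in> XM \<Longrightarrow> u (e a) \<in> CS \<Longrightarrow> u (\<Phi> (e a)) \<in> CS \<Longrightarrow>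
      cder X (\<lambda>q. up (\<lambda>Z. u Z q) a) p = up (\<lambda>Z. cder X (u Z) p) a"
  by (simp_all add: dn_def up_def cder_divide cder_add cder_diff cder_cmult)

text \<open>In the notation of the structure equations, \<open>om a = \<omega>\<^sup>a\<close>, \<open>th a b X = \<omega>\<^sup>a(\<nabla>\<^sub>X \<epsilon>\<^sub>b) = -\<omega>\<^sup>a\<^sub>b(X)\<close>,
  \<open>T a b X = \<omega>\<^sup>a(\<nabla>\<^sub>X \<epsilon>)\<close> for the conjugate \<open>\<epsilon>\<close> of \<open>\<epsilon>\<^sub>b\<close>, and \<open>Bf a b c = B\<^sup>a\<^sup>b\<^sub>c\<close>. By the condition
  on the class, \<open>T a b\<close> is a combination of the \<open>\<omega>\<^sup>c\<close> alone.\<close>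

definition om :: "nat \<Rightarrow> 'a form1" where
  "om a X q = up (\<lambda>Z. of_real (g X Z q)) a"

definition eta_form :: "'a form1" where
  "eta_form X q = of_real (g X \<xi> q)"

definition th :: "nat \<Rightarrow> nat \<Rightarrow> 'a form1" where
  "th a b X q = dn (\<lambda>W. om a (D X W) q) b"

definition T :: "nat \<Rightarrow> nat \<Rightarrow> 'a form1" where
  "T a b X q = up (\<lambda>W. om a (D X W) q) b"

definition Bf :: "nat \<Rightarrow> nat \<Rightarrow> nat \<Rightarrow> 'a \<Rightarrow> complex" where
  "Bf a b c q = - dn (\<lambda>X. T a b X q) c"

lemma one_form_om: "a \<in> {1..n} \<Longrightarrow> one_form A (om a)"
  by (rule one_formI) (simp_all add: om_def[abs_def] up_smooth, simp_all add: up_def algebra_simps add_divide_distrib)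

lemma one_form_cnj_om: assumes "a \<in> {1..n}" shows "one_form A (\<lambda>X q. cnj (om a X q))"
  using one_formD[OF one_form_om[OF assms]] by (intro one_formI) simp_all

lemma one_form_eta: "one_form A eta_form"
  by (rule one_formI) (simp_all add: eta_form_def[abs_def])

lemma one_form_th: assumes "a \<in> {1..n}" "b \<in> {1..n}" shows "one_form A (th a b)"
proof (rule one_formI)
  note om = one_formD[OF one_form_om[OF assms(1)]]
  show "th a b X \<in> CS" if "X \<in> XM" for X
    unfolding th_def[abs_def] by (rule dn_smooth; rule om) (use that assms in auto)
qed (use assms in \<open>simp_all add: th_def dn_def D_add_left D_fmul_left one_formD[OF one_form_om]
    algebra_simps diff_divide_distrib add_divide_distrib\<close>)

lemma one_form_T: assumes "a \<in> {1..n}" "b \<in> {1..n}" shows "one_form A (T a b)"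
proof (rule one_formI)
  note om = one_formD[OF one_form_om[OF assms(1)]]
  show "T a b X \<in> CS" if "X \<in> XM" for X
    unfolding T_def[abs_def] by (rule up_smooth; rule om) (use that assms in auto)
qed (use assms in \<open>simp_all add: T_def up_def D_add_left D_fmul_left one_formD[OF one_form_om]
    algebra_simps add_divide_distrib\<close>)

lemma Bf_smooth: assumes "a \<in> {1..n}" "b \<in> {1..n}" "c \<in> {1..n}" shows "Bf a b c \<in> CS"
  unfolding Bf_def[abs_def]
  by (rule CS_minus[OF dn_smooth]; rule one_formD(1)[OF one_form_T[OF assms(1,2)]]) (use assms in auto)

lemma om_frame:
  assumes "q \<in> U" "a \<in> {1..n}"
  shows "om a \<xi> q = 0"
    and "c \<in> {1..n} \<Longrightarrow> dn (\<lambda>X. om a X q) c = kdelta a c"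
    and "c \<in> {1..n} \<Longrightarrow> up (\<lambda>X. om a X q) c = 0"
  using assms by (auto simp: om_def up_def dn_def kdelta_def)

lemma sum_frame_split:
  "(\<Sum>i<2 * n + 1. f i) = f 0 + (\<Sum>i=1..n. f i) + (\<Sum>i=1..n. f (i + n))"
  for f :: "nat \<Rightarrow> 'z::comm_monoid_add"
proof -
  have "{..<2 * n + 1} = insert 0 ({1..n} \<union> {n+1..n+n})" by auto
  then have "(\<Sum>i<2 * n + 1. f i) = f 0 + ((\<Sum>i=1..n. f i) + (\<Sum>i=n+1..n+n. f i))"
    by (subst sum.union_disjoint[symmetric]) auto
  moreover have "(\<Sum>i=n+1..n+n. f i) = (\<Sum>i=1..n. f (i + n))"
    using sum.shift_bounds_cl_nat_ivl[of f 1 n n] by (simp add: add.commute)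
  ultimately show ?thesis by (simp add: add.assoc)
qed

lemma frame_expansion:
  assumes q: "q \<in> U" and X: "X \<in> XM"
    and add: "\<And>X Y. X \<in> XM \<Longrightarrow> Y \<in> XM \<Longrightarrow> u (X + Y) = u X + u Y"
    and scale: "\<And>h X. h \<in> CM \<Longrightarrow> X \<in> XM \<Longrightarrow> u (h \<odot> X) = of_real (h q) * u X"
  shows "u X = eta_form X q * u \<xi> + (\<Sum>c=1..n. om c X q * dn u c + cnj (om c X q) * up u c)"
proof -
  let ?F = "real_frame n \<Phi> \<xi> e" and ?I = "{..<2 * n + 1}"
  obtain \<zeta> where \<zeta>: "\<zeta> \<in> CM" "\<zeta> q = 1" "\<forall>r. r \<notin> U \<longrightarrow> \<zeta> r = 0"
    by (rule bump[OF U_open q])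
  have on: "orthonormal_at A g r (2 * n + 1) ?F" if "r \<in> U" for r
    using adapted[OF that] orthonormal_iff_adapted by blast
  have F: "?F i \<in> XM" if "i \<in> ?I" for i
    using on[OF q] that by (simp add: orthonormal_at_def)
  let ?S = "\<Sum>i\<in>?I. (\<zeta> * g X (?F i)) \<odot> ?F i"
  have SXM: "?S \<in> XM" using X F \<zeta>(1) by (intro XM_sum XM_fmul smooth_mult g_smooth)
  have "\<zeta> \<odot> X - ?S = 0"
  proof (rule g_definite)
    show ZXM: "\<zeta> \<odot> X - ?S \<in> XM" using X \<zeta>(1) SXM by blast
    fix r
    have Zg: "g (\<zeta> \<odot> X - ?S) Y r = \<zeta> r * g X Y r - (\<Sum>i\<in>?I. \<zeta> r * g X (?F i) r * g (?F i) Y r)"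
      if "Y \<in> XM" for Y
    proof -
      have "g ?S Y r = (\<Sum>i\<in>?I. g ((\<zeta> * g X (?F i)) \<odot> ?F i) Y r)"
        using X F \<zeta>(1) that by (intro g_sum_left XM_fmul smooth_mult g_smooth)
      also have "\<dots> = (\<Sum>i\<in>?I. \<zeta> r * g X (?F i) r * g (?F i) Y r)"
        using X F \<zeta>(1) that by (intro sum.cong refl) simp
      finally show ?thesis using X SXM \<zeta>(1) that by simp
    qed
    show "g (\<zeta> \<odot> X - ?S) (\<zeta> \<odot> X - ?S) r = 0"
    proof (cases "r \<in> U")
      case True
      have "g X Y r = (\<Sum>i\<in>?I. g X (?F i) r * g Y (?F i) r)" if "Y \<in> XM" for Y
        using Parseval[of r ?F X Y] on[OF True] X that by (simp add: dim)
      moreover have "g Y (?F i) r = g (?F i) Y r" if "Y \<in> XM" "i \<in> ?I" for Y i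
        using g_commute[OF that(1) F[OF that(2)]] by simp
      ultimately have exp: "g X Y r = (\<Sum>i\<in>?I. g X (?F i) r * g (?F i) Y r)" if "Y \<in> XM" for Y
        using that by (simp only: cong: sum.cong)
      have "\<zeta> r * g X Y r - (\<Sum>i\<in>?I. \<zeta> r * g X (?F i) r * g (?F i) Y r) = 0" if "Y \<in> XM" for Y
        unfolding exp[OF that] by (simp only: sum_distrib_left mult.assoc diff_self)
      then show ?thesis unfolding Zg[OF ZXM] using ZXM by blast
    next
      case False
      then show ?thesis unfolding Zg[OF ZXM] using \<zeta>(3) by simp
    qed
  qed
  then have local: "\<zeta> \<odot> X = ?S" by simp
  have u0: "u 0 = 0" using add[OF XM_0 XM_0] by simp
  have usum: "u (\<Sum>i\<in>J. Z i) = (\<Sum>i\<in>J. u (Z i))" if "\<And>i. i \<in> J \<Longrightarrow> Z i \<in> XM" for J and Z :: "nat \<Rightarrow> 'a vfield"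
    using that
  proof (induction J rule: infinite_finite_induct)
    case (insert i J)
    then have "u (Z i + (\<Sum>i\<in>J. Z i)) = u (Z i) + u (\<Sum>i\<in>J. Z i)" by (intro add XM_sum) auto
    moreover have "(\<Sum>i\<in>insert i J. Z i) = Z i + (\<Sum>i\<in>J. Z i)"
      using insert.hyps by (rule sum.insert)
    moreover have "u (\<Sum>i\<in>J. Z i) = (\<Sum>i\<in>J. u (Z i))" using insert by blast
    ultimately have "u (\<Sum>i\<in>insert i J. Z i) = u (Z i) + (\<Sum>i\<in>J. u (Z i))" by (simp only:)
    then show ?case by (simp only: sum.insert[OF insert.hyps])
  qed (simp_all add: u0)
  have "u X = u (\<zeta> \<odot> X)" using scale[OF \<zeta>(1) X] \<zeta>(2) by simp
  also have "\<dots> = (\<Sum>i\<in>?I. u ((\<zeta> * g X (?F i)) \<odot> ?F i))"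
    unfolding local using X F \<zeta>(1) by (intro usum XM_fmul smooth_mult g_smooth)
  also have "\<dots> = (\<Sum>i\<in>?I. of_real (g X (?F i) q) * u (?F i))"
    using X F \<zeta> by (intro sum.cong refl) (simp add: scale)
  also have "\<dots> = of_real (g X \<xi> q) * u \<xi> + (\<Sum>c=1..n. of_real (g X (e c) q) * u (e c))
      + (\<Sum>c=1..n. of_real (g X (\<Phi> (e c)) q) * u (\<Phi> (e c)))"
    unfolding sum_frame_split by (simp add: real_frame_def cong: sum.cong_simp)
  also have "\<dots> = of_real (g X \<xi> q) * u \<xi> + (\<Sum>c=1..n. om c X q * dn u c + cnj (om c X q) * up u c)"
  proof -
    have "om c X q * dn u c + cnj (om c X q) * up u c
        = of_real (g X (e c) q) * u (e c) + of_real (g X (\<Phi> (e c)) q) * u (\<Phi> (e c))" for c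
    proof -
      let ?x = "complex_of_real (g X (e c) q)" and ?y = "complex_of_real (g X (\<Phi> (e c)) q)"
      have "om c X q * dn u c + cnj (om c X q) * up u c
          = ((?x + \<i> * ?y) * (u (e c) - \<i> * u (\<Phi> (e c))) + (?x - \<i> * ?y) * (u (e c) + \<i> * u (\<Phi> (e c)))) / 2"
        by (simp add: om_def up_def dn_def flip: add_divide_distrib)
      also have "(?x + \<i> * ?y) * (u (e c) - \<i> * u (\<Phi> (e c))) + (?x - \<i> * ?y) * (u (e c) + \<i> * u (\<Phi> (e c)))
          = 2 * (?x * u (e c) + ?y * u (\<Phi> (e c)))"
        by (simp add: algebra_simps)
      also have "\<dots> / 2 = ?x * u (e c) + ?y * u (\<Phi> (e c))" by (rule nonzero_mult_div_cancel_left) simp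
      finally show ?thesis .
    qed
    then show ?thesis by (simp add: sum.distrib[symmetric] add.assoc)
  qed
  finally show ?thesis by (simp add: eta_form_def)
qed

end

section \<open>Structure equations\<close>

context kenmotsu_frame
begin

lemma form_expansion:
  assumes "one_form A \<alpha>" "q \<in> U" "X \<in> XM"
  shows "\<alpha> X q = eta_form X q * \<alpha> \<xi> q
    + (\<Sum>c=1..n. om c X q * dn (\<lambda>Z. \<alpha> Z q) c + cnj (om c X q) * up (\<lambda>Z. \<alpha> Z q) c)"
  using frame_expansion[OF assms(2,3), of "\<lambda>Z. \<alpha> Z q"] one_formD[OF assms(1)] by simp

lemma up_g: "c \<in> {1..n} \<Longrightarrow> Q \<in> XM \<Longrightarrow> up (\<lambda>X. of_real (g X Q q)) c = om c Q q"
  and dn_g: "c \<in> {1..n} \<Longrightarrow> Q \<in> XM \<Longrightarrow> dn (\<lambda>X. of_real (g X Q q)) c = cnj (om c Q q)"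
  using g_commute[of Q "e c"] g_commute[of Q "\<Phi> (e c)"] by (simp_all add: om_def up_def dn_def)

lemma g_expansion:
  assumes "q \<in> U" "P \<in> XM" "Q \<in> XM"
  shows "of_real (g P Q q) = eta_form P q * eta_form Q q
    + (\<Sum>c=1..n. om c P q * cnj (om c Q q) + cnj (om c P q) * om c Q q)"
proof -
  have "of_real (g P Q q) = eta_form P q * of_real (g \<xi> Q q)
    + (\<Sum>c=1..n. om c P q * dn (\<lambda>X. of_real (g X Q q)) c + cnj (om c P q) * up (\<lambda>X. of_real (g X Q q)) c)"
    by (rule frame_expansion[OF assms(1,2)])
      (simp_all only: g_add_left g_fmul_left assms(3) of_real_add of_real_mult)
  also have "g \<xi> Q q = g Q \<xi> q" using g_commute[OF xi_XM assms(3)] by simp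
  finally show ?thesis using assms(3) by (simp add: eta_form_def up_g dn_g cong: sum.cong_simp)
qed

lemma D_frame_skew:
  assumes "q \<in> U" "X \<in> XM" "E \<in> XM" "F \<in> XM" "\<And>r. r \<in> U \<Longrightarrow> g E F r = k"
  shows "g (D X E) F q = - g (D X F) E q"
proof -
  have "X (g E F) q = X (\<lambda>_. k) q"
    by (rule vf_local[OF assms(2) _ _ U_open assms(1)]) (use assms in simp_all)
  then have "X (g E F) q = 0" by (simp add: vf_const[OF assms(2)])
  moreover have "g E (D X F) q = g (D X F) E q" using g_commute[of E "D X F"] assms by simp
  ultimately show ?thesis using D_metric[OF assms(3,4,2)] by simp
qed

lemma D_frame_xi:
  assumes "q \<in> U" "X \<in> XM" "E \<in> XM" "\<And>r. r \<in> U \<Longrightarrow> g E \<xi> r = 0"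
  shows "g (D X E) \<xi> q = - g X E q"
  using D_frame_skew[OF assms(1-3) xi_XM assms(4)] assms by (simp add: D_xi g_commute[of \<xi> E])

lemma th_eq: "th a b X q = (of_real (g (D X (e b)) (e a) q + g (D X (\<Phi> (e b))) (\<Phi> (e a)) q)
    + \<i> * of_real (g (D X (e b)) (\<Phi> (e a)) q - g (D X (\<Phi> (e b))) (e a) q)) / 2"
  by (simp add: th_def om_def dn_def up_def algebra_simps diff_divide_distrib add_divide_distrib)

lemma T_eq: "T a b X q = (of_real (g (D X (e b)) (e a) q - g (D X (\<Phi> (e b))) (\<Phi> (e a)) q)
    + \<i> * of_real (g (D X (e b)) (\<Phi> (e a)) q + g (D X (\<Phi> (e b))) (e a) q)) / 2"
  by (simp add: T_def om_def dn_def up_def algebra_simps diff_divide_distrib add_divide_distrib)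

context
  fixes q a b
  assumes q: "q \<in> U" and a: "a \<in> {1..n}" and b: "b \<in> {1..n}"
begin

lemma frame_skews:
  assumes "X \<in> XM"
  shows "g (D X (e b)) (e a) q = - g (D X (e a)) (e b) q"
    "g (D X (\<Phi> (e b))) (\<Phi> (e a)) q = - g (D X (\<Phi> (e a))) (\<Phi> (e b)) q"
    "g (D X (e b)) (\<Phi> (e a)) q = - g (D X (\<Phi> (e a))) (e b) q"
    "g (D X (\<Phi> (e b))) (e a) q = - g (D X (e a)) (\<Phi> (e b)) q"
  by (rule D_frame_skew[OF q assms]; use a b in force)+

lemma th_skew: "X \<in> XM \<Longrightarrow> cnj (th a b X q) = - th b a X q"
  unfolding th_eq by (simp add: frame_skews complex_eq_iff) (simp add: field_simps)

lemma T_skew: "X \<in> XM \<Longrightarrow> T a b X q = - T b a X q"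
  unfolding T_eq by (simp add: frame_skews complex_eq_iff) (simp add: field_simps)

lemma T_K: "X \<in> XM \<Longrightarrow> T a b X q = (- of_real (K X (e b) (\<Phi> (e a)) q) + \<i> * of_real (K X (e b) (e a) q)) / 2"
  unfolding T_eq K_def using q a b by (simp add: Phi_Phi complex_eq_iff)

lemma T_Phi: "X \<in> XM \<Longrightarrow> T a b X q + \<i> * T a b (\<Phi> X) q = 0"
  using K_Phi_left[of X "e b" "e a" q] q a b by (simp add: T_K complex_eq_iff)

lemma T_xi: "T a b \<xi> q = 0"
  using T_Phi[OF xi_XM] a b by (simp add: T_eq)

lemma T_up: "c \<in> {1..n} \<Longrightarrow> up (\<lambda>X. T a b X q) c = 0"
  using T_Phi[of "e c"] by (simp add: up_def)

lemma T_expand: "X \<in> XM \<Longrightarrow> T a b X q = - (\<Sum>c=1..n. Bf a b c q * om c X q)"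
  using form_expansion[OF one_form_T[OF a b] q]
  by (simp add: T_xi T_up Bf_def sum_negf mult.commute cong: sum.cong_simp)

lemma Bf_skew: "c \<in> {1..n} \<Longrightarrow> Bf a b c q = - Bf b a c q"
  by (simp add: Bf_def dn_minus[symmetric]) (rule dn_cong; simp add: T_skew)

end

lemma dn_eta: "q \<in> U \<Longrightarrow> b \<in> {1..n} \<Longrightarrow> X \<in> XM \<Longrightarrow> dn (\<lambda>W. eta_form (D X W) q) b = - cnj (om b X q)"
  and up_eta: "q \<in> U \<Longrightarrow> b \<in> {1..n} \<Longrightarrow> X \<in> XM \<Longrightarrow> up (\<lambda>W. eta_form (D X W) q) b = - om b X q"
  using D_frame_xi[of q X "e b"] D_frame_xi[of q X "\<Phi> (e b)"]
  by (simp_all add: dn_def up_def om_def eta_form_def field_simps)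

lemma up_g_D:
  assumes q: "q \<in> U" and a: "a \<in> {1..n}" and X: "X \<in> XM" and Y: "Y \<in> XM"
  shows "up (\<lambda>E. of_real (g Y (D X E) q)) a = - eta_form Y q * om a X q
    - (\<Sum>c=1..n. th a c X q * om c Y q)
    + (\<Sum>c=1..n. \<Sum>d=1..n. Bf a c d q * (om d X q * cnj (om c Y q)))"
proof -
  have "up (\<lambda>E. of_real (g Y (D X E) q)) a
      = up (\<lambda>E. eta_form Y q * eta_form (D X E) q
        + (\<Sum>c=1..n. om c Y q * cnj (om c (D X E) q) + cnj (om c Y q) * om c (D X E) q)) a"
    by (rule up_cong; rule g_expansion[OF q Y]; use X a in simp)
  also have "\<dots> = eta_form Y q * up (\<lambda>E. eta_form (D X E) q) a
      + (\<Sum>c=1..n. om c Y q * cnj (th c a X q) + cnj (om c Y q) * T c a X q)"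
    by (simp add: up_linear th_def T_def)
  also have "(\<Sum>c=1..n. om c Y q * cnj (th c a X q) + cnj (om c Y q) * T c a X q)
      = (\<Sum>c=1..n. - (th a c X q * om c Y q) + (\<Sum>d=1..n. Bf a c d q * (om d X q * cnj (om c Y q))))"
  proof (rule sum.cong[OF refl])
    fix c assume c: "c \<in> {1..n}"
    have "T c a X q = (\<Sum>d=1..n. Bf a c d q * om d X q)"
      using T_skew[OF q c a X] T_expand[OF q a c X] by simp
    then show "om c Y q * cnj (th c a X q) + cnj (om c Y q) * T c a X q
        = - (th a c X q * om c Y q) + (\<Sum>d=1..n. Bf a c d q * (om d X q * cnj (om c Y q)))"
      by (simp add: th_skew[OF q c a X] sum_distrib_left algebra_simps)
  qed
  finally show ?thesis
    by (simp add: up_eta[OF q a X] sum.distrib sum_negf sum_subtractf)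
qed

lemma cder_om:
  assumes "a \<in> {1..n}" "X \<in> XM" "P \<in> XM"
  shows "cder X (om a P) p = up (\<lambda>Z. of_real (X (g P Z) p)) a"
proof -
  have "cder X (om a P) p = up (\<lambda>Z. cder X (\<lambda>q. of_real (g P Z q)) p) a"
    unfolding om_def[abs_def] using assms by (intro cder_up) auto
  also have "\<dots> = up (\<lambda>Z. of_real (X (g P Z) p)) a"
    by (rule up_cong; rule cder_of_real; use assms in simp)
  finally show ?thesis .
qed

lemma ext_d_om:
  assumes p: "p \<in> U" and a: "a \<in> {1..n}" and X: "X \<in> XM" and Y: "Y \<in> XM"
  shows "ext_d (om a) X Y p = (\<Sum>b=1..n. wedge (\<lambda>X q. - th a b X q) (om b) X Y p)
    + (\<Sum>b=1..n. \<Sum>c=1..n. Bf a b c p * wedge (om c) (\<lambda>X q. cnj (om b X q)) X Y p)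
    - wedge (om a) eta_form X Y p"
proof -
  have "X (g Y E) p - Y (g X E) p - g (lie X Y) E p = g Y (D X E) p - g X (D Y E) p" if "E \<in> XM" for E
    using D_metric[OF Y that X] D_metric[OF X that Y] X Y that by (simp add: D_torsion[symmetric])
  then have "up (\<lambda>E. of_real (X (g Y E) p - Y (g X E) p - g (lie X Y) E p)) a
      = up (\<lambda>E. of_real (g Y (D X E) p - g X (D Y E) p)) a"
    using a by (intro up_cong) simp_all
  then have "ext_d (om a) X Y p = up (\<lambda>E. of_real (g Y (D X E) p)) a - up (\<lambda>E. of_real (g X (D Y E) p)) a"
    using a X Y by (simp add: ext_d_def cder_om om_def[of a "lie X Y"] up_diff)
  then show ?thesis
    unfolding up_g_D[OF p a X Y] up_g_D[OF p a Y X]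
    by (simp add: wedge_def sum.distrib sum_subtractf algebra_simps sum_negf)
qed

lemma ext_d_cnj:
  assumes "one_form A \<alpha>" "X \<in> XM" "Y \<in> XM"
  shows "ext_d (\<lambda>X q. cnj (\<alpha> X q)) X Y p = cnj (ext_d \<alpha> X Y p)"
  using assms one_formD(1)[OF assms(1)] by (simp add: ext_d_def cder_cnj)

lemma ext_d_eta:
  assumes "X \<in> XM" "Y \<in> XM" shows "ext_d eta_form X Y p = 0"
  unfolding ext_d_def eta_form_def[abs_def] using assms g_lie_xi[OF assms, of p]
  by (simp add: cder_of_real flip: of_real_diff)

text \<open>The curvature forms \<open>R\<^sup>a\<^sub>b\<close> and \<open>R\<^sup>a\<^sub>j\<close>, where \<open>j = hat n b\<close>.\<close>

definition Om where
  "Om a b X Y q = dn (\<lambda>W. up (\<lambda>Z. of_real (Riem g D Z W X Y q)) a) b"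

definition Oa where
  "Oa a b X Y q = up (\<lambda>W. up (\<lambda>Z. of_real (Riem g D Z W X Y q)) a) b"

lemma curvature_identity:
  assumes "X \<in> XM" "Y \<in> XM" "Z \<in> XM" "W \<in> XM"
  shows "X (g (D Y W) Z) p - Y (g (D X W) Z) p - g (D (lie X Y) W) Z p
    = Riem g D Z W X Y p + g (D Y W) (D X Z) p - g (D X W) (D Y Z) p"
  using D_metric[of "D Y W" Z X] D_metric[of "D X W" Z Y] assms by (simp add: Riem_def riem_def)

lemma cder_om_D:
  assumes p: "p \<in> U" and a: "a \<in> {1..n}" and X: "X \<in> XM" and Y: "Y \<in> XM" and W: "W \<in> XM"
  shows "cder X (om a (D Y W)) p - cder Y (om a (D X W)) p - om a (D (lie X Y) W) p
    = up (\<lambda>Z. of_real (Riem g D Z W X Y p)) a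
      + up (\<lambda>Z. of_real (g (D Y W) (D X Z) p)) a - up (\<lambda>Z. of_real (g (D X W) (D Y Z) p)) a"
proof -
  have "cder X (om a (D Y W)) p - cder Y (om a (D X W)) p - om a (D (lie X Y) W) p
      = up (\<lambda>Z. of_real (X (g (D Y W) Z) p - Y (g (D X W) Z) p - g (D (lie X Y) W) Z p)) a"
    using a X Y W by (simp add: cder_om om_def[of a "D (lie X Y) W"] up_diff)
  also have "\<dots> = up (\<lambda>Z. of_real (Riem g D Z W X Y p + g (D Y W) (D X Z) p - g (D X W) (D Y Z) p)) a"
    by (rule up_cong; rule arg_cong[where f=of_real]; rule curvature_identity; use a X Y W in simp)
  finally show ?thesis by (simp add: up_add up_diff)
qed

lemma up_g_DD:
  assumes q: "q \<in> U" and a: "a \<in> {1..n}" and X: "X \<in> XM" and P: "P \<in> XM"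
  shows "up (\<lambda>Z. of_real (g P (D X Z) q)) a = - eta_form P q * om a X q
    + (\<Sum>c=1..n. om c P q * cnj (th c a X q) + cnj (om c P q) * T c a X q)"
proof -
  have "up (\<lambda>E. of_real (g P (D X E) q)) a
      = up (\<lambda>E. eta_form P q * eta_form (D X E) q
        + (\<Sum>c=1..n. om c P q * cnj (om c (D X E) q) + cnj (om c P q) * om c (D X E) q)) a"
    by (rule up_cong; rule g_expansion[OF q P]; use X a in simp)
  then show ?thesis
    by (simp add: up_linear up_eta[OF q a X] flip: th_def T_def)
qed

lemma ext_d_th:
  assumes p: "p \<in> U" and a: "a \<in> {1..n}" and b: "b \<in> {1..n}" and X: "X \<in> XM" and Y: "Y \<in> XM"
  shows "ext_d (th a b) X Y p = Om a b X Y p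
    + (om a X p * cnj (om b Y p) + (\<Sum>c=1..n. th c b Y p * cnj (th c a X p) + cnj (T c b Y p) * T c a X p))
    - (om a Y p * cnj (om b X p) + (\<Sum>c=1..n. th c b X p * cnj (th c a Y p) + cnj (T c b X p) * T c a Y p))"
proof -
  have CS: "om a (D P W) \<in> CS" if "P \<in> XM" "W \<in> XM" for P W
    using one_formD(1)[OF one_form_om[OF a]] that by simp
  have cder: "cder P (th a b Q) p = dn (\<lambda>W. cder P (om a (D Q W)) p) b" if "P \<in> XM" "Q \<in> XM" for P Q
    unfolding th_def[abs_def] using that b by (intro cder_dn CS) auto
  have gDD: "dn (\<lambda>W. up (\<lambda>Z. of_real (g (D Q W) (D P Z) p)) a) b
      = om a P p * cnj (om b Q p) + (\<Sum>c=1..n. th c b Q p * cnj (th c a P p) + cnj (T c b Q p) * T c a P p)"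
    if PQ: "P \<in> XM" "Q \<in> XM" for P Q
  proof -
    have "dn (\<lambda>W. up (\<lambda>Z. of_real (g (D Q W) (D P Z) p)) a) b
      = dn (\<lambda>W. - eta_form (D Q W) p * om a P p
        + (\<Sum>c=1..n. om c (D Q W) p * cnj (th c a P p) + cnj (om c (D Q W) p) * T c a P p)) b"
      by (rule dn_cong; rule up_g_DD[OF p a]; use PQ b in simp)
    then show ?thesis
      by (simp add: dn_linear dn_eta[OF p b PQ(2)] flip: th_def T_def)
  qed
  have "ext_d (th a b) X Y p
    = dn (\<lambda>W. cder X (om a (D Y W)) p - cder Y (om a (D X W)) p - om a (D (lie X Y) W) p) b"
    using X Y by (simp add: ext_d_def cder dn_diff th_def[of a b "lie X Y"])
  also have "\<dots> = dn (\<lambda>W. up (\<lambda>Z. of_real (Riem g D Z W X Y p)) a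
      + up (\<lambda>Z. of_real (g (D Y W) (D X Z) p)) a - up (\<lambda>Z. of_real (g (D X W) (D Y Z) p)) a) b"
    by (rule dn_cong; rule cder_om_D[OF p a X Y]; use b in simp)
  finally show ?thesis by (simp add: dn_add dn_diff Om_def gDD X Y)
qed

lemma ext_d_T:
  assumes p: "p \<in> U" and a: "a \<in> {1..n}" and b: "b \<in> {1..n}" and X: "X \<in> XM" and Y: "Y \<in> XM"
  shows "ext_d (T a b) X Y p = Oa a b X Y p
    + (om a X p * om b Y p + (\<Sum>c=1..n. T c b Y p * cnj (th c a X p) + cnj (th c b Y p) * T c a X p))
    - (om a Y p * om b X p + (\<Sum>c=1..n. T c b X p * cnj (th c a Y p) + cnj (th c b X p) * T c a Y p))"
proof -
  have CS: "om a (D P W) \<in> CS" if "P \<in> XM" "W \<in> XM" for P W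
    using one_formD(1)[OF one_form_om[OF a]] that by simp
  have cder: "cder P (T a b Q) p = up (\<lambda>W. cder P (om a (D Q W)) p) b" if "P \<in> XM" "Q \<in> XM" for P Q
    unfolding T_def[abs_def] using that b by (intro cder_up CS) auto
  have gDD: "up (\<lambda>W. up (\<lambda>Z. of_real (g (D Q W) (D P Z) p)) a) b
      = om a P p * om b Q p + (\<Sum>c=1..n. T c b Q p * cnj (th c a P p) + cnj (th c b Q p) * T c a P p)"
    if PQ: "P \<in> XM" "Q \<in> XM" for P Q
  proof -
    have "up (\<lambda>W. up (\<lambda>Z. of_real (g (D Q W) (D P Z) p)) a) b
      = up (\<lambda>W. - eta_form (D Q W) p * om a P p
        + (\<Sum>c=1..n. om c (D Q W) p * cnj (th c a P p) + cnj (om c (D Q W) p) * T c a P p)) b"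
      by (rule up_cong; rule up_g_DD[OF p a]; use PQ b in simp)
    then show ?thesis
      by (simp add: up_linear up_eta[OF p b PQ(2)] flip: th_def T_def)
  qed
  have "ext_d (T a b) X Y p
    = up (\<lambda>W. cder X (om a (D Y W)) p - cder Y (om a (D X W)) p - om a (D (lie X Y) W) p) b"
    using X Y by (simp add: ext_d_def cder up_diff T_def[of a b "lie X Y"])
  also have "\<dots> = up (\<lambda>W. up (\<lambda>Z. of_real (Riem g D Z W X Y p)) a
      + up (\<lambda>Z. of_real (g (D Y W) (D X Z) p)) a - up (\<lambda>Z. of_real (g (D X W) (D Y Z) p)) a) b"
    by (rule up_cong; rule cder_om_D[OF p a X Y]; use b in simp)
  finally show ?thesis by (simp add: up_add up_diff Oa_def gDD X Y)
qed

definition conn :: "nat \<Rightarrow> nat \<Rightarrow> 'a form1" where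
  "conn a b X q = - th a b X q"

text \<open>\<open>LB a b c\<close> is the covariant differential of \<open>B\<^sup>a\<^sup>b\<^sub>c\<close>.\<close>

definition LB :: "nat \<Rightarrow> nat \<Rightarrow> nat \<Rightarrow> 'a form1" where
  "LB a b c X q = cder X (Bf a b c) q + (\<Sum>h=1..n. Bf a b h q * conn h c X q)
    - (\<Sum>h=1..n. Bf h b c q * conn a h X q) - (\<Sum>h=1..n. Bf a h c q * conn b h X q)"

abbreviation wedge_sum where
  "wedge_sum P \<alpha> \<beta> X Y p \<equiv> \<Sum>c=1..n. \<Sum>d=1..n. P c d * wedge (\<alpha> c) (\<beta> d) X Y p"

abbreviation "cnj_om a \<equiv> \<lambda>X q. cnj (om a X q)"

lemma conn_eq: "conn a b = (\<lambda>X q. - th a b X q)"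
  by (simp add: conn_def fun_eq_iff)

lemma one_form_conn: assumes "a \<in> {1..n}" "b \<in> {1..n}" shows "one_form A (conn a b)"
  unfolding conn_eq using one_formD[OF one_form_th[OF assms]] by (intro one_formI) simp_all

lemma conn_skew:
  "q \<in> U \<Longrightarrow> a \<in> {1..n} \<Longrightarrow> b \<in> {1..n} \<Longrightarrow> X \<in> XM \<Longrightarrow> cnj (conn a b X q) = - conn b a X q"
  by (simp add: conn_def th_skew)

lemma T_swap_expand:
  assumes "q \<in> U" "a \<in> {1..n}" "b \<in> {1..n}" "X \<in> XM"
  shows "T b a X q = (\<Sum>c=1..n. Bf a b c q * om c X q)"
  using T_skew[OF assms(1,3,2,4)] T_expand[OF assms] by simp

lemma wedge_sums:
  "(\<Sum>c\<in>I. u c * wedge (\<alpha> c) (\<beta> c) X Y p)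
    = (\<Sum>c\<in>I. u c * (\<alpha> c X p * \<beta> c Y p)) - (\<Sum>c\<in>I. u c * (\<alpha> c Y p * \<beta> c X p))"
  "(\<Sum>c\<in>I. \<Sum>d\<in>J. v c d * wedge (\<gamma> c d) (\<delta> c d) X Y p)
    = (\<Sum>c\<in>I. \<Sum>d\<in>J. v c d * (\<gamma> c d X p * \<delta> c d Y p)) - (\<Sum>c\<in>I. \<Sum>d\<in>J. v c d * (\<gamma> c d Y p * \<delta> c d X p))"
  "(\<Sum>c\<in>I. wedge (\<alpha> c) (\<beta> c) X Y p)
    = (\<Sum>c\<in>I. \<alpha> c X p * \<beta> c Y p) - (\<Sum>c\<in>I. \<alpha> c Y p * \<beta> c X p)"
  by (simp_all add: wedge_def right_diff_distrib sum_subtractf)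

lemma T_T_expand:
  assumes "p \<in> U" "a \<in> {1..n}" "b \<in> {1..n}" "X \<in> XM" "Y \<in> XM"
  shows "(\<Sum>h=1..n. cnj (T h b Y p) * T h a X p)
    = (\<Sum>c=1..n. \<Sum>d=1..n. (\<Sum>h=1..n. Bf a h c p * cnj (Bf b h d p)) * (om c X p * cnj (om d Y p)))"
proof -
  have "(\<Sum>h=1..n. cnj (T h b Y p) * T h a X p)
    = (\<Sum>h=1..n. \<Sum>c=1..n. \<Sum>d=1..n. Bf a h c p * cnj (Bf b h d p) * (om c X p * cnj (om d Y p)))"
  proof (rule sum.cong[OF refl])
    fix h assume h: "h \<in> {1..n}"
    have "cnj (T h b Y p) * T h a X p
        = (\<Sum>c=1..n. Bf a h c p * om c X p) * (\<Sum>d=1..n. cnj (Bf b h d p) * cnj (om d Y p))"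
      using T_swap_expand[OF assms(1,2) h assms(4)] T_swap_expand[OF assms(1,3) h assms(5)]
      by (simp add: mult.commute)
    then show "cnj (T h b Y p) * T h a X p
        = (\<Sum>c=1..n. \<Sum>d=1..n. Bf a h c p * cnj (Bf b h d p) * (om c X p * cnj (om d Y p)))"
      by (simp add: sum_product mult_ac)
  qed
  also have "\<dots> = (\<Sum>c=1..n. \<Sum>h=1..n. \<Sum>d=1..n. Bf a h c p * cnj (Bf b h d p) * (om c X p * cnj (om d Y p)))"
    by (rule sum.swap)
  also have "\<dots> = (\<Sum>c=1..n. \<Sum>d=1..n. \<Sum>h=1..n. Bf a h c p * cnj (Bf b h d p) * (om c X p * cnj (om d Y p)))"
    by (intro sum.cong[OF refl] sum.swap)
  finally show ?thesis by (simp add: sum_distrib_right)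
qed

lemma ext_d_conn:
  assumes p: "p \<in> U" and a: "a \<in> {1..n}" and b: "b \<in> {1..n}" and X: "X \<in> XM" and Y: "Y \<in> XM"
  shows "ext_d (conn a b) X Y p = (\<Sum>c=1..n. wedge (conn a c) (conn c b) X Y p) - Om a b X Y p
    - wedge_sum (\<lambda>c d. \<Sum>h=1..n. Bf a h c p * cnj (Bf b h d p)) om cnj_om X Y p
    - wedge (om a) (cnj_om b) X Y p"
proof -
  have th: "(\<Sum>c=1..n. th c b Q p * cnj (th c a P p)) = - (\<Sum>c=1..n. conn a c P p * conn c b Q p)"
    if "P \<in> XM" for P Q
    using that a by (simp add: th_skew[OF p _ a] conn_def sum_negf[symmetric] mult.commute cong: sum.cong_simp)
  have "ext_d (conn a b) X Y p = - ext_d (th a b) X Y p"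
    using X Y one_formD(1)[OF one_form_th[OF a b]] by (simp add: conn_eq ext_d_def cder_minus)
  then show ?thesis
    unfolding ext_d_th[OF p a b X Y] sum.distrib th[OF X] th[OF Y]
      T_T_expand[OF p a b X Y] T_T_expand[OF p a b Y X] wedge_sums(2,3)
    by (simp add: wedge_def)
qed

lemma Oa_eq:
  assumes p: "p \<in> U" and a: "a \<in> {1..n}" and b: "b \<in> {1..n}" and X: "X \<in> XM" and Y: "Y \<in> XM"
  shows "Oa a b X Y p = - (\<Sum>c=1..n. wedge (LB a b c) (om c) X Y p)
    - wedge_sum (\<lambda>c d. \<Sum>h=1..n. Bf a b h p * Bf h d c p) om cnj_om X Y p
    + (\<Sum>c=1..n. Bf a b c p * wedge (om c) eta_form X Y p) - wedge (om a) (om b) X Y p"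
proof -
  define N where "N d P = (\<Sum>h=1..n. Bf a b h p * conn h d P p)" for d P
  define M1 where "M1 d P = (\<Sum>h=1..n. Bf h b d p * conn a h P p)" for d P
  define M2 where "M2 d P = (\<Sum>h=1..n. Bf a h d p * conn b h P p)" for d P
  have S1: "(\<Sum>c=1..n. T c b Q p * cnj (th c a P p)) = - (\<Sum>d=1..n. M1 d P * om d Q p)"
    if PQ: "P \<in> XM" "Q \<in> XM" for P Q
  proof -
    have "(\<Sum>c=1..n. T c b Q p * cnj (th c a P p))
        = (\<Sum>c=1..n. \<Sum>d=1..n. - (Bf c b d p * conn a c P p * om d Q p))"
      by (intro sum.cong refl)
        (simp add: T_expand[OF p _ b PQ(2)] th_skew[OF p _ a PQ(1)] conn_def sum_distrib_left sum_negf mult_ac)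
    also have "\<dots> = (\<Sum>d=1..n. \<Sum>c=1..n. - (Bf c b d p * conn a c P p * om d Q p))" by (rule sum.swap)
    finally show ?thesis by (simp add: M1_def sum_distrib_right sum_negf)
  qed
  have S2: "(\<Sum>c=1..n. cnj (th c b Q p) * T c a P p) = (\<Sum>d=1..n. M2 d Q * om d P p)"
    if PQ: "P \<in> XM" "Q \<in> XM" for P Q
  proof -
    have "(\<Sum>c=1..n. cnj (th c b Q p) * T c a P p)
        = (\<Sum>c=1..n. \<Sum>d=1..n. Bf a c d p * conn b c Q p * om d P p)"
      by (intro sum.cong refl)
        (simp add: T_swap_expand[OF p a _ PQ(1)] th_skew[OF p _ b PQ(2)] conn_def sum_distrib_left sum_negf mult_ac)
    also have "\<dots> = (\<Sum>d=1..n. \<Sum>c=1..n. Bf a c d p * conn b c Q p * om d P p)" by (rule sum.swap)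
    finally show ?thesis by (simp add: M2_def sum_distrib_right)
  qed
  let ?T = "\<lambda>X q. - (\<Sum>c=1..n. Bf a b c q * om c X q)"
  have omCS: "om c P \<in> CS" if "c \<in> {1..n}" "P \<in> XM" for c P
    by (rule one_formD(1)[OF one_form_om[OF that(1)] that(2)])
  note BCS = Bf_smooth[OF a b]
  have TCS: "?T P \<in> CS" if "P \<in> XM" for P
    using BCS omCS that by (intro CS_minus CS_sum CS_mult)
  have T: "one_form A ?T"
  proof (rule one_formI[OF TCS])
    show "?T (P + Q) q = ?T P q + ?T Q q" if "P \<in> XM" "Q \<in> XM" for P Q q
      using one_formD(2)[OF one_form_om that] by (simp add: sum.distrib distrib_left cong: sum.cong_simp)
    show "?T (h \<odot> P) q = of_real (h q) * ?T P q" if "h \<in> CM" "P \<in> XM" for h P q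
      using one_formD(3)[OF one_form_om that(2,1)] by (simp add: sum_distrib_left mult_ac cong: sum.cong_simp)
  qed
  have e1: "ext_d (T a b) X Y p = ext_d ?T X Y p"
    by (rule ext_d_local[OF one_form_T[OF a b] T U_open p X Y]) (rule T_expand[OF _ a b])
  have e2: "ext_d ?T X Y p = - (\<Sum>c=1..n. cder X (Bf a b c) p * om c Y p - cder Y (Bf a b c) p * om c X p
      + Bf a b c p * ext_d (om c) X Y p)"
  proof -
    have 1: "cder P (?T Q) p = - (\<Sum>c=1..n. Bf a b c p * cder P (om c Q) p + om c Q p * cder P (Bf a b c) p)"
      if PQ: "P \<in> XM" "Q \<in> XM" for P Q
    proof -
      have "cder P (?T Q) p = - cder P (\<lambda>q. \<Sum>c=1..n. Bf a b c q * om c Q q) p"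
        by (rule cder_minus[OF PQ(1)]) (intro CS_sum CS_mult BCS omCS PQ)
      also have "cder P (\<lambda>q. \<Sum>c=1..n. Bf a b c q * om c Q q) p
          = (\<Sum>c=1..n. cder P (\<lambda>q. Bf a b c q * om c Q q) p)"
        by (rule cder_sum[OF PQ(1)]) (intro CS_mult BCS omCS PQ)
      also have "\<dots> = (\<Sum>c=1..n. Bf a b c p * cder P (om c Q) p + om c Q p * cder P (Bf a b c) p)"
        by (intro sum.cong refl cder_mult[OF PQ(1)] BCS omCS PQ)
      finally show ?thesis .
    qed
    show ?thesis
      unfolding ext_d_def 1[OF X Y] 1[OF Y X]
      by (simp add: sum.distrib sum_subtractf algebra_simps)
  qed
  have e3: "(\<Sum>c=1..n. cder X (Bf a b c) p * om c Y p - cder Y (Bf a b c) p * om c X p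
      + Bf a b c p * ext_d (om c) X Y p)
    = (\<Sum>c=1..n. cder X (Bf a b c) p * om c Y p) - (\<Sum>c=1..n. cder Y (Bf a b c) p * om c X p)
      + (\<Sum>c=1..n. Bf a b c p * ext_d (om c) X Y p)"
    by (simp add: sum.distrib sum_subtractf)
  have e4: "(\<Sum>c=1..n. Bf a b c p * ext_d (om c) X Y p)
    = (\<Sum>d=1..n. N d X * om d Y p) - (\<Sum>d=1..n. N d Y * om d X p)
      + wedge_sum (\<lambda>c d. \<Sum>h=1..n. Bf a b h p * Bf h d c p) om cnj_om X Y p
      - (\<Sum>c=1..n. Bf a b c p * wedge (om c) eta_form X Y p)"
  proof -
    have N: "(\<Sum>h=1..n. Bf a b h p * (\<Sum>d=1..n. conn h d P p * om d Q p)) = (\<Sum>d=1..n. N d P * om d Q p)" for P Q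
    proof -
      have "(\<Sum>h=1..n. Bf a b h p * (\<Sum>d=1..n. conn h d P p * om d Q p))
          = (\<Sum>h=1..n. \<Sum>d=1..n. Bf a b h p * conn h d P p * om d Q p)"
        by (simp add: sum_distrib_left mult.assoc)
      also have "\<dots> = (\<Sum>d=1..n. \<Sum>h=1..n. Bf a b h p * conn h d P p * om d Q p)" by (rule sum.swap)
      finally show ?thesis by (simp add: N_def sum_distrib_right)
    qed
    have BB: "(\<Sum>h=1..n. Bf a b h p * (\<Sum>d=1..n. \<Sum>c=1..n. Bf h d c p * wedge (om c) (cnj_om d) X Y p))
      = wedge_sum (\<lambda>c d. \<Sum>h=1..n. Bf a b h p * Bf h d c p) om cnj_om X Y p"
      (is "?L = _")
    proof -
      let ?t = "\<lambda>h d c. Bf a b h p * Bf h d c p * wedge (om c) (cnj_om d) X Y p"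
      have "?L = (\<Sum>h=1..n. \<Sum>d=1..n. \<Sum>c=1..n. ?t h d c)" by (simp add: sum_distrib_left mult.assoc)
      also have "\<dots> = (\<Sum>d=1..n. \<Sum>h=1..n. \<Sum>c=1..n. ?t h d c)" by (rule sum.swap)
      also have "\<dots> = (\<Sum>d=1..n. \<Sum>c=1..n. \<Sum>h=1..n. ?t h d c)" by (intro sum.cong refl sum.swap)
      also have "\<dots> = (\<Sum>c=1..n. \<Sum>d=1..n. \<Sum>h=1..n. ?t h d c)" by (rule sum.swap)
      finally show ?thesis by (simp add: sum_distrib_right)
    qed
    have "(\<Sum>c=1..n. Bf a b c p * ext_d (om c) X Y p)
      = (\<Sum>c=1..n. Bf a b c p * (\<Sum>d=1..n. conn c d X p * om d Y p))
        - (\<Sum>c=1..n. Bf a b c p * (\<Sum>d=1..n. conn c d Y p * om d X p))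
        + (\<Sum>h=1..n. Bf a b h p * (\<Sum>d=1..n. \<Sum>c=1..n. Bf h d c p * wedge (om c) (cnj_om d) X Y p))
        - (\<Sum>c=1..n. Bf a b c p * wedge (om c) eta_form X Y p)"
      unfolding sum.distrib[symmetric] sum_subtractf[symmetric]
      by (intro sum.cong refl)
        (simp add: ext_d_om[OF p _ X Y] wedge_sums(3) distrib_left right_diff_distrib flip: conn_eq)
    then show ?thesis unfolding N BB .
  qed
  have ext: "ext_d (T a b) X Y p =
    - ((\<Sum>c=1..n. cder X (Bf a b c) p * om c Y p) - (\<Sum>c=1..n. cder Y (Bf a b c) p * om c X p)
      + ((\<Sum>d=1..n. N d X * om d Y p) - (\<Sum>d=1..n. N d Y * om d X p)
      + wedge_sum (\<lambda>c d. \<Sum>h=1..n. Bf a b h p * Bf h d c p) om cnj_om X Y p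
      - (\<Sum>c=1..n. Bf a b c p * wedge (om c) eta_form X Y p)))"
    by (simp only: e1 e2 e3 e4)
  have LB: "LB a b c P p * z = cder P (Bf a b c) p * z + N c P * z - M1 c P * z - M2 c P * z" for c P z
    by (simp add: LB_def N_def M1_def M2_def algebra_simps)
  have LBsum: "(\<Sum>c=1..n. wedge (LB a b c) (om c) X Y p)
    = ((\<Sum>c=1..n. cder X (Bf a b c) p * om c Y p) + (\<Sum>c=1..n. N c X * om c Y p)
        - (\<Sum>c=1..n. M1 c X * om c Y p) - (\<Sum>c=1..n. M2 c X * om c Y p))
      - ((\<Sum>c=1..n. cder Y (Bf a b c) p * om c X p) + (\<Sum>c=1..n. N c Y * om c X p)
        - (\<Sum>c=1..n. M1 c Y * om c X p) - (\<Sum>c=1..n. M2 c Y * om c X p))"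
    unfolding wedge_sums(3) LB by (simp add: sum.distrib sum_subtractf)
  have "Oa a b X Y p = ext_d (T a b) X Y p
    - (om a X p * om b Y p + (\<Sum>c=1..n. T c b Y p * cnj (th c a X p) + cnj (th c b Y p) * T c a X p))
    + (om a Y p * om b X p + (\<Sum>c=1..n. T c b X p * cnj (th c a Y p) + cnj (th c b X p) * T c a Y p))"
    using ext_d_T[OF p a b X Y] by simp
  then show ?thesis
    unfolding ext LBsum sum.distrib S1[OF X Y] S1[OF Y X] S2[OF X Y] S2[OF Y X]
    by (simp add: wedge_def[of "om a" "om b"])
qed

lemma dn_wedge:
  "dn (\<lambda>Y. wedge \<alpha> \<beta> X Y q) d = \<alpha> X q * dn (\<lambda>Y. \<beta> Y q) d - dn (\<lambda>Y. \<alpha> Y q) d * \<beta> X q"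
  "up (\<lambda>Y. wedge \<alpha> \<beta> X Y q) d = \<alpha> X q * up (\<lambda>Y. \<beta> Y q) d - up (\<lambda>Y. \<alpha> Y q) d * \<beta> X q"
  by (simp_all add: wedge_def dn_linear up_linear)

lemma cnj_om_frame:
  assumes "q \<in> U" "a \<in> {1..n}" "c \<in> {1..n}"
  shows "dn (\<lambda>X. cnj (om a X q)) c = 0" "up (\<lambda>X. cnj (om a X q)) c = kdelta a c"
  using om_frame[OF assms(1,2)] assms(3) by (simp_all add: dn_cnj up_cnj kdelta_def)

lemma sum_kdelta:
  assumes "c \<in> {1..n}"
  shows "(\<Sum>i=1..n. f i * kdelta i c) = f c" "(\<Sum>i=1..n. kdelta i c * f i) = f c"
proof -
  show "(\<Sum>i=1..n. f i * kdelta i c) = f c"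
    using assms by (simp add: kdelta_def if_distrib cong: if_cong)
  then show "(\<Sum>i=1..n. kdelta i c * f i) = f c" by (simp add: mult.commute)
qed

lemma sum_kdelta2:
  assumes "c \<in> {1..n}" "d \<in> {1..n}"
  shows "(\<Sum>i=1..n. \<Sum>j=1..n. P i j * (kdelta i c * kdelta j d)) = P c d"
proof -
  have "(\<Sum>i=1..n. \<Sum>j=1..n. P i j * (kdelta i c * kdelta j d))
      = (\<Sum>i=1..n. kdelta i c * (\<Sum>j=1..n. P i j * kdelta j d))"
    by (simp add: sum_distrib_left mult_ac)
  then show ?thesis by (simp only: sum_kdelta[OF assms(1)] sum_kdelta[OF assms(2)])
qed

lemma two_form_eval:
  fixes P :: "nat \<Rightarrow> nat \<Rightarrow> complex"
  shows "dn (\<lambda>X. dn (\<lambda>Y. \<Sum>i\<in>I. \<Sum>j\<in>I. P i j * wedge (\<alpha> i) (\<beta> j) X Y q) d) c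
      = (\<Sum>i\<in>I. \<Sum>j\<in>I. P i j * (dn (\<lambda>X. \<alpha> i X q) c * dn (\<lambda>X. \<beta> j X q) d
          - dn (\<lambda>X. \<alpha> i X q) d * dn (\<lambda>X. \<beta> j X q) c))"
    and "dn (\<lambda>X. up (\<lambda>Y. \<Sum>i\<in>I. \<Sum>j\<in>I. P i j * wedge (\<alpha> i) (\<beta> j) X Y q) d) c
      = (\<Sum>i\<in>I. \<Sum>j\<in>I. P i j * (dn (\<lambda>X. \<alpha> i X q) c * up (\<lambda>X. \<beta> j X q) d
          - up (\<lambda>X. \<alpha> i X q) d * dn (\<lambda>X. \<beta> j X q) c))"
    and "up (\<lambda>X. up (\<lambda>Y. \<Sum>i\<in>I. \<Sum>j\<in>I. P i j * wedge (\<alpha> i) (\<beta> j) X Y q) d) c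
      = (\<Sum>i\<in>I. \<Sum>j\<in>I. P i j * (up (\<lambda>X. \<alpha> i X q) c * up (\<lambda>X. \<beta> j X q) d
          - up (\<lambda>X. \<alpha> i X q) d * up (\<lambda>X. \<beta> j X q) c))"
  by (simp_all add: dn_sum up_sum dn_cmult up_cmult dn_wedge dn_diff up_diff dn_multc up_multc)

lemma two_form_coefficients:
  assumes q: "q \<in> U" and c: "c \<in> {1..n}" and d: "d \<in> {1..n}"
    and eq: "\<And>X Y. X \<in> XM \<Longrightarrow> Y \<in> XM \<Longrightarrow>
      wedge_sum P om om X Y q
      + wedge_sum Q om cnj_om X Y q
      + wedge_sum S cnj_om cnj_om X Y q = F X Y"
  shows "dn (\<lambda>X. dn (F X) d) c = P c d - P d c"
    and "dn (\<lambda>X. up (F X) d) c = Q c d"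
    and "up (\<lambda>X. up (F X) d) c = S c d - S d c"
proof -
  let ?G = "\<lambda>X Y. (wedge_sum P om om X Y q)
      + wedge_sum Q om cnj_om X Y q
      + wedge_sum S cnj_om cnj_om X Y q"
  have F: "F X Y = ?G X Y" if "X \<in> XM" "Y \<in> XM" for X Y using eq[OF that] by simp
  have dnF: "dn (F X) d = dn (?G X) d" and upF: "up (F X) d = up (?G X) d" if "X \<in> XM" for X
    by (rule dn_cong up_cong; rule F; use that d in simp)+
  note eval = two_form_eval om_frame(2,3)[OF q] cnj_om_frame[OF q] right_diff_distrib sum_subtractf
    sum_kdelta2[OF c d, unfolded One_nat_def] sum_kdelta2[OF d c, unfolded One_nat_def]
  have "dn (\<lambda>X. dn (F X) d) c = dn (\<lambda>X. dn (?G X) d) c"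
    by (rule dn_cong; rule dnF; use c in simp)
  also have "\<dots> = P c d - P d c"
    using c d by (simp add: dn_add up_add eval cong: sum.cong_simp)
  finally show "dn (\<lambda>X. dn (F X) d) c = P c d - P d c" .
  have "dn (\<lambda>X. up (F X) d) c = dn (\<lambda>X. up (?G X) d) c"
    by (rule dn_cong; rule upF; use c in simp)
  also have "\<dots> = Q c d"
    using c d by (simp add: dn_add up_add eval cong: sum.cong_simp)
  finally show "dn (\<lambda>X. up (F X) d) c = Q c d" .
  have "up (\<lambda>X. up (F X) d) c = up (\<lambda>X. up (?G X) d) c"
    by (rule up_cong; rule upF; use c in simp)
  also have "\<dots> = S c d - S d c"
    using c d by (simp add: dn_add up_add eval cong: sum.cong_simp)
  finally show "up (\<lambda>X. up (F X) d) c = S c d - S d c" .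
qed

lemma one_form_0: "one_form A \<alpha> \<Longrightarrow> \<alpha> 0 q = 0"
  using one_formD(2)[OF _ XM_0 XM_0, of \<alpha> q] by simp

lemma clin_A_frame:
  assumes "one_form A \<alpha>" "c \<in> {1..n}"
  shows "clin \<alpha> (A_frame n \<Phi> \<xi> e 0) q = \<alpha> \<xi> q"
    and "clin \<alpha> (A_frame n \<Phi> \<xi> e c) q = dn (\<lambda>Z. \<alpha> Z q) c"
    and "clin \<alpha> (A_frame n \<Phi> \<xi> e (c + n)) q = up (\<lambda>Z. \<alpha> Z q) c"
  using assms(2) one_formD(3)[OF assms(1)] one_form_0[OF assms(1)]
  by (simp_all add: clin_def A_frame_def dn_def up_def field_simps)

lemma hat_eq: "a \<in> {1..n} \<Longrightarrow> hat n a = a + n"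
  by (simp add: hat_def)

lemma dual_coframe_eq:
  assumes w: "dual_coframe n A \<Phi> \<xi> U e w" and q: "q \<in> U" and X: "X \<in> XM"
  shows "w 0 X q = eta_form X q"
    and "a \<in> {1..n} \<Longrightarrow> w a X q = om a X q"
    and "a \<in> {1..n} \<Longrightarrow> w (hat n a) X q = cnj (om a X q)"
proof -
  have exp: "w i X q = eta_form X q * kdelta i 0
      + (\<Sum>c=1..n. om c X q * kdelta i c + cnj (om c X q) * kdelta i (c + n))" if i: "i \<le> 2 * n" for i
  proof -
    have form: "one_form A (w i)" and k: "\<And>j. j \<le> 2 * n \<Longrightarrow> clin (w i) (A_frame n \<Phi> \<xi> e j) q = kdelta i j"
      using w i q unfolding dual_coframe_def by blast+
    have c: "w i \<xi> q = kdelta i 0" "c \<in> {1..n} \<Longrightarrow> dn (\<lambda>Z. w i Z q) c = kdelta i c"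
      "c \<in> {1..n} \<Longrightarrow> up (\<lambda>Z. w i Z q) c = kdelta i (c + n)" for c
      using k[of 0] k[of c] k[of "c + n"] clin_A_frame[OF form, of c q] by (auto simp: clin_def A_frame_def one_form_0[OF form])
    show ?thesis
      unfolding form_expansion[OF form q X] c(1) by (intro arg_cong2[where f="(+)"] refl sum.cong) (simp_all only: c)
  qed
  have n0: "kdelta (c + n) 0 = 0" "kdelta c 0 = 0" "kdelta 0 c = 0" "kdelta 0 (c + n) = 0" if "c \<in> {1..n}" for c
    using that by (auto simp: kdelta_def)
  have n1: "kdelta (a + n) c = 0" "kdelta a (c + n) = 0" "kdelta (a + n) (c + n) = kdelta a c"
    if "a \<in> {1..n}" "c \<in> {1..n}" for a c
    using that by (auto simp: kdelta_def)
  have comm: "kdelta i j = kdelta j i" for i j by (simp add: kdelta_def)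
  show "w 0 X q = eta_form X q"
    using exp[of 0] by (simp add: n0 kdelta_def[of 0 0] cong: sum.cong_simp)
  assume a: "a \<in> {1..n}"
  have s: "(\<Sum>c=1..n. f c * kdelta a c) = f a" for f :: "nat \<Rightarrow> complex"
    using sum_kdelta(1)[OF a, of f] by (simp only: comm[of a])
  have "w a X q = (\<Sum>c=1..n. om c X q * kdelta a c)"
    using exp[of a] a by (simp add: n0 n1 cong: sum.cong_simp)
  then show "w a X q = om a X q" unfolding s .
  have "w (a + n) X q = (\<Sum>c=1..n. cnj (om c X q) * kdelta a c)"
    using exp[of "a + n"] a by (simp add: n0 n1 cong: sum.cong_simp)
  then show "w (hat n a) X q = cnj (om a X q)" unfolding s hat_eq[OF a] .
qed

lemma dn_eq_0: "u (e a) = 0 \<Longrightarrow> u (\<Phi> (e a)) = 0 \<Longrightarrow> dn u a = 0"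
  and up_eq_0: "u (e a) = 0 \<Longrightarrow> u (\<Phi> (e a)) = 0 \<Longrightarrow> up u a = 0"
  by (simp_all add: dn_def up_def)

lemma cnj_kdelta [simp]: "cnj (kdelta i j) = kdelta i j"
  by (simp add: kdelta_def)

lemma wedge_diff_left: "wedge \<alpha> \<beta> X Y q - wedge \<gamma> \<beta> X Y q = wedge (\<lambda>X q. \<alpha> X q - \<gamma> X q) \<beta> X Y q"
  by (simp add: wedge_def algebra_simps)

lemma ext_d_om_conn:
  assumes "p \<in> U" "a \<in> {1..n}" "X \<in> XM" "Y \<in> XM"
  shows "ext_d (om a) X Y p = (\<Sum>b=1..n. wedge (conn a b) (om b) X Y p)
    + (\<Sum>b=1..n. \<Sum>c=1..n. Bf a b c p * wedge (om c) (cnj_om b) X Y p)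
    - wedge (om a) eta_form X Y p"
  using ext_d_om[OF assms] by (simp add: conn_eq)

lemma ext_d_cnj_om:
  assumes "p \<in> U" "a \<in> {1..n}" "X \<in> XM" "Y \<in> XM"
  shows "ext_d (cnj_om a) X Y p = - (\<Sum>b=1..n. wedge (conn b a) (cnj_om b) X Y p)
    + (\<Sum>b=1..n. \<Sum>c=1..n. cnj (Bf a b c p) * wedge (cnj_om c) (om b) X Y p)
    - wedge (cnj_om a) eta_form X Y p"
proof -
  have "ext_d (cnj_om a) X Y p = cnj (ext_d (om a) X Y p)"
    by (rule ext_d_cnj[OF one_form_om[OF assms(2)] assms(3,4)])
  moreover have "cnj (wedge (conn a b) (om b) X Y p) = - wedge (conn b a) (cnj_om b) X Y p" if "b \<in> {1..n}" for b
    using that conn_skew[OF assms(1,2) that] assms(3,4) by (simp add: wedge_def)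
  moreover have "cnj (wedge (om a) eta_form X Y p) = wedge (cnj_om a) eta_form X Y p"
    by (simp add: wedge_def eta_form_def)
  moreover have "cnj (wedge (om c) (cnj_om b) X Y p) = wedge (cnj_om c) (om b) X Y p" for b c
    by (simp add: wedge_def)
  ultimately show ?thesis
    unfolding ext_d_om_conn[OF assms] by (simp add: sum_negf cong: sum.cong_simp)
qed

lemma structure_eqs1_unique:
  assumes w: "dual_coframe n A \<Phi> \<xi> U e w" and eqs: "structure_eqs1 n A U w w1 B" and q: "q \<in> U"
  shows "a \<in> {1..n} \<Longrightarrow> b \<in> {1..n} \<Longrightarrow> X \<in> XM \<Longrightarrow> w1 a b X q = conn a b X q"
    and "a \<in> {1..n} \<Longrightarrow> b \<in> {1..n} \<Longrightarrow> c \<in> {1..n} \<Longrightarrow> B a b c q = Bf a b c q"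
proof -
  note weq = dual_coframe_eq[OF w]
  have w1: "one_form A (w1 a b)" if "a \<in> {1..n}" "b \<in> {1..n}" for a b
    using eqs that unfolding structure_eqs1_def by blast
  have wform: "one_form A (w i)" if "i \<le> 2 * n" for i
    using w that unfolding dual_coframe_def by blast
  define \<delta> where "\<delta> a b = (\<lambda>X r. w1 a b X r - conn a b X r)" for a b
  define \<beta> where "\<beta> a b c = B a b c q - Bf a b c q" for a b c
  have aux: "P - Q + (R - S) = 0" if "R - Q = S - P" for P Q R S :: complex
  proof -
    have "P - Q + (R - S) = (R - Q) - (S - P)" by simp
    with that show ?thesis by simp
  qed
  have E1: "(\<Sum>b=1..n. wedge (\<delta> a b) (om b) X Y q)
      + (\<Sum>b=1..n. \<Sum>c=1..n. \<beta> a b c * wedge (om c) (cnj_om b) X Y q) = 0"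
    if a: "a \<in> {1..n}" and X: "X \<in> XM" and Y: "Y \<in> XM" for a X Y
  proof -
    have "ext_d (w a) X Y q = ext_d (om a) X Y q"
      by (rule ext_d_local[OF wform one_form_om[OF a] U_open q X Y weq(2)[OF _ _ a]]) (use a in auto)
    moreover have "ext_d (w a) X Y q = (\<Sum>b=1..n. wedge (w1 a b) (w b) X Y q)
        + (\<Sum>b=1..n. \<Sum>c=1..n. B a b c q * wedge (w c) (w (hat n b)) X Y q) - wedge (w a) (w 0) X Y q"
      using eqs q a X Y unfolding structure_eqs1_def by blast
    moreover have "\<dots> = (\<Sum>b=1..n. wedge (w1 a b) (om b) X Y q)
        + (\<Sum>b=1..n. \<Sum>c=1..n. B a b c q * wedge (om c) (cnj_om b) X Y q) - wedge (om a) eta_form X Y q"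
      using weq[OF q X] weq[OF q Y] a by (simp add: wedge_def cong: sum.cong_simp)
    ultimately have "(\<Sum>b=1..n. wedge (w1 a b) (om b) X Y q)
        + (\<Sum>b=1..n. \<Sum>c=1..n. B a b c q * wedge (om c) (cnj_om b) X Y q)
      = (\<Sum>b=1..n. wedge (conn a b) (om b) X Y q)
        + (\<Sum>b=1..n. \<Sum>c=1..n. Bf a b c q * wedge (om c) (cnj_om b) X Y q)"
      using ext_d_om_conn[OF q a X Y] by simp
    then show ?thesis
      by (simp add: \<delta>_def \<beta>_def sum_subtractf left_diff_distrib
          flip: wedge_diff_left add_diff_add)
  qed
  have E2: "- (\<Sum>b=1..n. wedge (\<delta> b a) (cnj_om b) X Y q)
      + (\<Sum>b=1..n. \<Sum>c=1..n. cnj (\<beta> a b c) * wedge (cnj_om c) (om b) X Y q) = 0"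
    if a: "a \<in> {1..n}" and X: "X \<in> XM" and Y: "Y \<in> XM" for a X Y
  proof -
    have "ext_d (w (hat n a)) X Y q = ext_d (cnj_om a) X Y q"
      by (rule ext_d_local[OF wform one_form_cnj_om[OF a] U_open q X Y weq(3)[OF _ _ a]])
        (use a in \<open>auto simp: hat_def\<close>)
    moreover have "ext_d (w (hat n a)) X Y q = - (\<Sum>b=1..n. wedge (w1 b a) (w (hat n b)) X Y q)
        + (\<Sum>b=1..n. \<Sum>c=1..n. cnj (B a b c q) * wedge (w (hat n c)) (w b) X Y q) - wedge (w (hat n a)) (w 0) X Y q"
      using eqs q a X Y unfolding structure_eqs1_def by blast
    moreover have "\<dots> = - (\<Sum>b=1..n. wedge (w1 b a) (cnj_om b) X Y q)
        + (\<Sum>b=1..n. \<Sum>c=1..n. cnj (B a b c q) * wedge (cnj_om c) (om b) X Y q) - wedge (cnj_om a) eta_form X Y q"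
      using weq[OF q X] weq[OF q Y] a by (simp add: wedge_def cong: sum.cong_simp)
    ultimately have "- (\<Sum>b=1..n. wedge (w1 b a) (cnj_om b) X Y q)
        + (\<Sum>b=1..n. \<Sum>c=1..n. cnj (B a b c q) * wedge (cnj_om c) (om b) X Y q)
      = - (\<Sum>b=1..n. wedge (conn b a) (cnj_om b) X Y q)
        + (\<Sum>b=1..n. \<Sum>c=1..n. cnj (Bf a b c q) * wedge (cnj_om c) (om b) X Y q)"
      using ext_d_cnj_om[OF q a X Y] by simp
    then show ?thesis
      by (simp add: \<delta>_def \<beta>_def sum_subtractf left_diff_distrib flip: wedge_diff_left) (erule aux)
  qed
  note frame = om_frame[OF q] cnj_om_frame[OF q]
  note lin = dn_linear up_linear dn_wedge
  let ?E1 = "\<lambda>a X Y. (\<Sum>b=1..n. wedge (\<delta> a b) (om b) X Y q)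
      + (\<Sum>b=1..n. \<Sum>c=1..n. \<beta> a b c * wedge (om c) (cnj_om b) X Y q)"
  let ?E2 = "\<lambda>a X Y. - (\<Sum>b=1..n. wedge (\<delta> b a) (cnj_om b) X Y q)
      + (\<Sum>b=1..n. \<Sum>c=1..n. cnj (\<beta> a b c) * wedge (cnj_om c) (om b) X Y q)"
  have \<delta>_xi: "\<delta> a b \<xi> q = 0" if a: "a \<in> {1..n}" and b: "b \<in> {1..n}" for a b
  proof -
    have "dn (?E1 a \<xi>) b = 0"
      by (rule dn_eq_0; rule E1[OF a]; use b in simp)
    moreover have "dn (?E1 a \<xi>) b = (\<Sum>b'=1..n. \<delta> a b' \<xi> q * kdelta b' b)"
      using b by (simp add: lin frame cong: sum.cong_simp)
    ultimately show ?thesis by (simp only: sum_kdelta[OF b])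
  qed
  have up_\<delta>: "up (\<lambda>X. \<delta> a c X q) b = \<beta> a b c"
    if a: "a \<in> {1..n}" and b: "b \<in> {1..n}" and c: "c \<in> {1..n}" for a b c
  proof -
    have H: "dn (?E1 a X) c = 0" if "X \<in> XM" for X
      by (rule dn_eq_0; rule E1[OF a]; use c that in simp)
    have "up (\<lambda>X. dn (?E1 a X) c) b = 0"
      by (intro up_eq_0[OF H H]) (use b in simp_all)
    moreover have "up (\<lambda>X. dn (?E1 a X) c) b = (\<Sum>b'=1..n. up (\<lambda>X. \<delta> a b' X q) b * kdelta b' c)
        - (\<Sum>b'=1..n. \<Sum>c'=1..n. \<beta> a b' c' * (kdelta b' b * kdelta c' c))"
      using b c by (simp add: lin frame sum_negf mult.commute[of "kdelta _ c" "kdelta _ b"] cong: sum.cong_simp)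
    ultimately show ?thesis by (simp only: sum_kdelta[OF c] sum_kdelta2[OF b c]) simp
  qed
  have up_\<delta>_sym: "up (\<lambda>X. \<delta> c a X q) b = up (\<lambda>X. \<delta> b a X q) c"
    if a: "a \<in> {1..n}" and b: "b \<in> {1..n}" and c: "c \<in> {1..n}" for a b c
  proof -
    have H: "up (?E2 a X) c = 0" if "X \<in> XM" for X
      by (rule up_eq_0; rule E2[OF a]; use c that in simp)
    have "up (\<lambda>X. up (?E2 a X) c) b = 0"
      by (intro up_eq_0[OF H H]) (use b in simp_all)
    moreover have "up (\<lambda>X. up (?E2 a X) c) b = - ((\<Sum>b'=1..n. up (\<lambda>X. \<delta> b' a X q) b * kdelta b' c)
        - (\<Sum>b'=1..n. up (\<lambda>X. \<delta> b' a X q) c * kdelta b' b))"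
      using b c by (simp add: lin frame sum_subtractf cong: sum.cong_simp)
    ultimately show ?thesis by (simp only: sum_kdelta[OF c] sum_kdelta[OF b]) simp
  qed
  have \<beta>_0: "\<beta> a b c = 0" if a: "a \<in> {1..n}" and b: "b \<in> {1..n}" and c: "c \<in> {1..n}" for a b c
  proof -
    have "\<beta> a b c = \<beta> b a c" using up_\<delta>[OF a b c] up_\<delta>[OF b a c] up_\<delta>_sym[OF c b a] by simp
    moreover have "B a b c q = - B b a c q" using eqs q a b c unfolding structure_eqs1_def by blast
    then have "\<beta> a b c = - \<beta> b a c" using Bf_skew[OF q a b c] by (simp add: \<beta>_def)
    ultimately show ?thesis by simp
  qed
  have dn_\<delta>: "dn (\<lambda>X. \<delta> b a X q) c = 0"
    if a: "a \<in> {1..n}" and b: "b \<in> {1..n}" and c: "c \<in> {1..n}" for a b c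
  proof -
    have H: "up (?E2 a X) b = 0" if "X \<in> XM" for X
      by (rule up_eq_0; rule E2[OF a]; use b that in simp)
    have "dn (\<lambda>X. up (?E2 a X) b) c = 0"
      by (intro dn_eq_0[OF H H]) (use c in simp_all)
    moreover have "dn (\<lambda>X. up (?E2 a X) b) c = - (\<Sum>b'=1..n. dn (\<lambda>X. \<delta> b' a X q) c * kdelta b' b)"
      using a b c by (simp add: lin frame \<beta>_0 cong: sum.cong_simp)
    ultimately show ?thesis by (simp only: sum_kdelta[OF b]) simp
  qed
  show "w1 a b X q = conn a b X q" if a: "a \<in> {1..n}" and b: "b \<in> {1..n}" and X: "X \<in> XM"
  proof -
    have \<delta>: "one_form A (\<delta> a b)"
      unfolding \<delta>_def using one_formD[OF w1[OF a b]] one_formD[OF one_form_conn[OF a b]]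
      by (intro one_formI) (simp_all add: algebra_simps)
    have "\<delta> a b X q = 0"
      using form_expansion[OF \<delta> q X] a b
      by (simp add: \<delta>_xi up_\<delta> \<beta>_0 dn_\<delta> cong: sum.cong_simp)
    then show ?thesis by (simp add: \<delta>_def)
  qed
  show "B a b c q = Bf a b c q" if "a \<in> {1..n}" "b \<in> {1..n}" "c \<in> {1..n}"
    using \<beta>_0[OF that] by (simp add: \<beta>_def)
qed

lemma wedge_kdelta:
  assumes "a \<in> {1..n}" "b \<in> {1..n}"
  shows "wedge (\<alpha> a) (\<beta> b) X Y p = (\<Sum>c=1..n. \<Sum>d=1..n. kdelta c a * kdelta d b * wedge (\<alpha> c) (\<beta> d) X Y p)"
  using sum_kdelta2[OF assms, of "\<lambda>c d. wedge (\<alpha> c) (\<beta> d) X Y p"] by (simp add: mult.commute)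

lemma Om_from_ext_d_conn:
  assumes p: "p \<in> U" and a: "a \<in> {1..n}" and b: "b \<in> {1..n}" and X: "X \<in> XM" and Y: "Y \<in> XM"
  shows "ext_d (conn a b) X Y p = (\<Sum>c=1..n. wedge (conn a c) (conn c b) X Y p)
      - wedge_sum (\<lambda>c d. A1 a b c d p) om om X Y p
      - wedge_sum (\<lambda>c d. A2 a d b c p) om cnj_om X Y p
      + wedge_sum (\<lambda>c d. cnj (A1 b a c d p)) cnj_om cnj_om X Y p
    \<longleftrightarrow> Om a b X Y p = wedge_sum (\<lambda>c d. A1 a b c d p) om om X Y p
      + wedge_sum (\<lambda>c d. A2 a d b c p - (\<Sum>h=1..n. Bf a h c p * cnj (Bf b h d p)) - kdelta c a * kdelta d b) om cnj_om X Y p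
      + wedge_sum (\<lambda>c d. - cnj (A1 b a c d p)) cnj_om cnj_om X Y p"
proof -
  have arith: "W - O' - BB - K = W - P - Q + S \<longleftrightarrow> O' = P + (Q - BB - K) + - S"
    for W O' BB K P Q S :: complex
    by (auto simp: algebra_simps)
  show ?thesis
    unfolding ext_d_conn[OF p a b X Y] wedge_kdelta[OF a b, of om cnj_om]
      left_diff_distrib sum_subtractf mult_minus_left sum_negf
    by (rule arith)
qed

lemma Oa_from_LB:
  assumes p: "p \<in> U" and a: "a \<in> {1..n}" and b: "b \<in> {1..n}" and X: "X \<in> XM" and Y: "Y \<in> XM"
    and LB: "\<And>c Z. c \<in> {1..n} \<Longrightarrow> Z \<in> XM \<Longrightarrow> LB a b c Z p = (\<Sum>d=1..n. B2 a b c d p * om d Z p)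
      + (\<Sum>d=1..n. B3 a b d c p * cnj (om d Z p)) - Bf a b c p * eta_form Z p"
  shows "Oa a b X Y p = wedge_sum (\<lambda>c d. B2 a b c d p - kdelta c a * kdelta d b) om om X Y p
      + wedge_sum (\<lambda>c d. B3 a b d c p - (\<Sum>h=1..n. Bf a b h p * Bf h d c p)) om cnj_om X Y p"
proof -
  have "(\<Sum>c=1..n. wedge (LB a b c) (om c) X Y p)
    = (\<Sum>c=1..n. - (\<Sum>d=1..n. B2 a b c d p * wedge (om c) (om d) X Y p)
      - (\<Sum>d=1..n. B3 a b d c p * wedge (om c) (cnj_om d) X Y p) + Bf a b c p * wedge (om c) eta_form X Y p)"
    by (intro sum.cong refl)
      (simp add: wedge_def LB X Y sum_distrib_left sum_subtractf algebra_simps)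
  also have "\<dots> = - wedge_sum (\<lambda>c d. B2 a b c d p) om om X Y p
      - wedge_sum (\<lambda>c d. B3 a b d c p) om cnj_om X Y p
      + (\<Sum>c=1..n. Bf a b c p * wedge (om c) eta_form X Y p)"
    by (simp add: sum.distrib sum_subtractf sum_negf)
  finally show ?thesis
    unfolding Oa_eq[OF p a b X Y] wedge_kdelta[OF a b, of om om] left_diff_distrib sum_subtractf
    by simp
qed

lemma structure_functions_curvature:
  assumes w: "dual_coframe n A \<Phi> \<xi> U e w" and eqs1: "structure_eqs1 n A U w w1 B"
    and eqs2: "structure_eqs2 n A U w w1 B A1 A2 B2 B3"
    and p: "p \<in> U" and a: "a \<in> {1..n}" and b: "b \<in> {1..n}" and X: "X \<in> XM" and Y: "Y \<in> XM"
  shows "Om a b X Y p = wedge_sum (\<lambda>c d. A1 a b c d p) om om X Y p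
      + wedge_sum (\<lambda>c d. A2 a d b c p - (\<Sum>h=1..n. Bf a h c p * cnj (Bf b h d p)) - kdelta c a * kdelta d b) om cnj_om X Y p
      + wedge_sum (\<lambda>c d. - cnj (A1 b a c d p)) cnj_om cnj_om X Y p" (is ?Om)
    and "Oa a b X Y p = wedge_sum (\<lambda>c d. B2 a b c d p - kdelta c a * kdelta d b) om om X Y p
      + wedge_sum (\<lambda>c d. B3 a b d c p - (\<Sum>h=1..n. Bf a b h p * Bf h d c p)) om cnj_om X Y p" (is ?Oa)
proof -
  note weq = dual_coframe_eq[OF w p]
  note uniq = structure_eqs1_unique[OF w eqs1]
  have w1: "one_form A (w1 a b)" and B: "c \<in> {1..n} \<Longrightarrow> B a b c \<in> CS" for c
    using eqs1 a b unfolding structure_eqs1_def by blast+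
  have "ext_d (conn a b) X Y p = ext_d (w1 a b) X Y p"
    by (rule ext_d_local[OF one_form_conn[OF a b] w1 U_open p X Y uniq(1)[OF _ a b, symmetric]])
  also have "\<dots> = (\<Sum>c=1..n. wedge (w1 a c) (w1 c b) X Y p)
      - wedge_sum (\<lambda>c d. A1 a b c d p) w w X Y p
      - (\<Sum>c=1..n. \<Sum>d=1..n. A2 a d b c p * wedge (w c) (w (hat n d)) X Y p)
      + (\<Sum>c=1..n. \<Sum>d=1..n. cnj (A1 b a c d p) * wedge (w (hat n c)) (w (hat n d)) X Y p)"
    using eqs2 p a b X Y unfolding structure_eqs2_def by blast
  also have "\<dots> = (\<Sum>c=1..n. wedge (conn a c) (conn c b) X Y p)
      - wedge_sum (\<lambda>c d. A1 a b c d p) om om X Y p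
      - wedge_sum (\<lambda>c d. A2 a d b c p) om cnj_om X Y p
      + wedge_sum (\<lambda>c d. cnj (A1 b a c d p)) cnj_om cnj_om X Y p"
    using weq[OF X] weq[OF Y] uniq(1)[OF p] a b X Y by (simp add: wedge_def cong: sum.cong_simp)
  finally show ?Om
    unfolding Om_from_ext_d_conn[OF p a b X Y] .
  show ?Oa
  proof (rule Oa_from_LB[OF p a b X Y])
    fix c Z assume c: "c \<in> {1..n}" and Z: "Z \<in> XM"
    have "cder Z (Bf a b c) p = cder Z (B a b c) p"
      by (rule cder_local[OF Z Bf_smooth[OF a b c] B[OF c] U_open p uniq(2)[OF _ a b c, symmetric]])
    then have "LB a b c Z p = cder Z (B a b c) p
            + (\<Sum>h=1..n. B a b h p * w1 h c Z p)
            - (\<Sum>h=1..n. B h b c p * w1 a h Z p)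
            - (\<Sum>h=1..n. B a h c p * w1 b h Z p)"
      using uniq[OF p] a b c Z by (simp add: LB_def cong: sum.cong_simp)
    also have "\<dots> = (\<Sum>d=1..n. B2 a b c d p * w d Z p)
            + (\<Sum>d=1..n. B3 a b d c p * w (hat n d) Z p) - B a b c p * w 0 Z p"
      using eqs2 p a b c Z unfolding structure_eqs2_def by blast
    also have "\<dots> = (\<Sum>d=1..n. B2 a b c d p * om d Z p)
      + (\<Sum>d=1..n. B3 a b d c p * cnj (om d Z p)) - Bf a b c p * eta_form Z p"
      using weq[OF Z] uniq(2)[OF p a b c] by (simp cong: sum.cong_simp)
    finally show "LB a b c Z p = (\<Sum>d=1..n. B2 a b c d p * om d Z p)
      + (\<Sum>d=1..n. B3 a b d c p * cnj (om d Z p)) - Bf a b c p * eta_form Z p" .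
  qed
qed

lemma two_form_half:
  assumes "\<And>c d. P d c = - P c d"
  shows "(\<Sum>c=1..n. \<Sum>d=1..n. P c d / 2 * wedge (\<alpha> c) (\<alpha> d) X Y q)
    = (\<Sum>c=1..n. \<Sum>d=1..n. P c d * (\<alpha> c X q * \<alpha> d Y q))"
proof -
  have "(\<Sum>c=1..n. \<Sum>d=1..n. P c d * (\<alpha> c Y q * \<alpha> d X q)) = (\<Sum>d=1..n. \<Sum>c=1..n. P c d * (\<alpha> c Y q * \<alpha> d X q))"
    by (rule sum.swap)
  also have "\<dots> = - (\<Sum>c=1..n. \<Sum>d=1..n. P c d * (\<alpha> c X q * \<alpha> d Y q))"
    unfolding sum_negf[symmetric] by (intro sum.cong refl) (subst assms, simp)
  finally have s: "(\<Sum>c=1..n. \<Sum>d=1..n. P c d * (\<alpha> c Y q * \<alpha> d X q))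
    = - (\<Sum>c=1..n. \<Sum>d=1..n. P c d * (\<alpha> c X q * \<alpha> d Y q))" .
  have "(\<Sum>c=1..n. \<Sum>d=1..n. P c d / 2 * wedge (\<alpha> c) (\<alpha> d) X Y q)
    = ((\<Sum>c=1..n. \<Sum>d=1..n. P c d * (\<alpha> c X q * \<alpha> d Y q))
      - (\<Sum>c=1..n. \<Sum>d=1..n. P c d * (\<alpha> c Y q * \<alpha> d X q))) / 2"
    by (simp add: wedge_def right_diff_distrib sum_subtractf diff_divide_distrib sum_divide_distrib)
  then show ?thesis unfolding s by simp
qed

lemma two_form_expansion:
  fixes F :: "'a vfield \<Rightarrow> 'a vfield \<Rightarrow> complex"
  assumes q: "q \<in> U" and X: "X \<in> XM" and Y: "Y \<in> XM"
    and anti: "\<And>X Y. X \<in> XM \<Longrightarrow> Y \<in> XM \<Longrightarrow> F Y X = - F X Y"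
    and add: "\<And>X X' Y. X \<in> XM \<Longrightarrow> X' \<in> XM \<Longrightarrow> Y \<in> XM \<Longrightarrow> F (X + X') Y = F X Y + F X' Y"
    and scale: "\<And>h X Y. h \<in> CM \<Longrightarrow> X \<in> XM \<Longrightarrow> Y \<in> XM \<Longrightarrow> F (h \<odot> X) Y = of_real (h q) * F X Y"
    and xi: "\<And>Y. Y \<in> XM \<Longrightarrow> F \<xi> Y = 0"
  shows "F X Y = wedge_sum (\<lambda>c d. dn (\<lambda>X. dn (F X) d) c / 2) om om X Y q
      + wedge_sum (\<lambda>c d. dn (\<lambda>X. up (F X) d) c) om cnj_om X Y q
      + wedge_sum (\<lambda>c d. up (\<lambda>X. up (F X) d) c / 2) cnj_om cnj_om X Y q"
proof -
  define G where "G X Y = (if X \<in> XM \<and> Y \<in> XM then F X Y else 0)" for X Y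
  have G: "G X Y = F X Y" if "X \<in> XM" "Y \<in> XM" for X Y using that by (simp add: G_def)
  have G_anti: "G Y X = - G X Y" for X Y using anti[of X Y] by (auto simp: G_def)
  define PP where "PP c d = dn (\<lambda>X. dn (G X) d) c" for c d
  define QQ where "QQ c d = dn (\<lambda>X. up (G X) d) c" for c d
  define SS where "SS c d = up (\<lambda>X. up (G X) d) c" for c d
  have PP: "PP d c = - PP c d" and SS: "SS d c = - SS c d"
    and Q': "up (\<lambda>X. dn (G X) d) c = - QQ d c" for c d
  proof -
    have dn_G: "dn (\<lambda>W. G W Z) b = - dn (G Z) b" for Z b
      unfolding dn_minus[symmetric] by (rule dn_cong; rule G_anti)
    have up_G: "up (\<lambda>W. G W Z) b = - up (G Z) b" for Z b
      unfolding up_minus[symmetric] by (rule up_cong; rule G_anti)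
    have "PP d c = dn (\<lambda>Z. dn (\<lambda>W. G W Z) d) c"
      unfolding PP_def by (rule dn_dn_swap)
    then show "PP d c = - PP c d" by (simp only: dn_G dn_minus PP_def)
    have "SS d c = up (\<lambda>Z. up (\<lambda>W. G W Z) d) c"
      unfolding SS_def by (rule up_up_swap)
    then show "SS d c = - SS c d" by (simp only: up_G up_minus SS_def)
    have "dn (\<lambda>Z. up (\<lambda>W. G W Z) c) d = up (\<lambda>X. dn (G X) d) c"
      by (rule dn_up_swap)
    then show "up (\<lambda>X. dn (G X) d) c = - QQ d c" by (simp only: up_G dn_minus QQ_def)
  qed
  have coef: "dn (\<lambda>X. dn (F X) d) c = PP c d" "dn (\<lambda>X. up (F X) d) c = QQ c d"
    "up (\<lambda>X. up (F X) d) c = SS c d" if "c \<in> {1..n}" "d \<in> {1..n}" for c d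
    using that by (simp_all add: PP_def QQ_def SS_def dn_def up_def G)
  have second: "G X' Y = (\<Sum>d=1..n. om d Y q * dn (G X') d + cnj (om d Y q) * up (G X') d)" if X': "X' \<in> XM" for X'
  proof -
    have "G X' Y = eta_form Y q * G X' \<xi> + (\<Sum>d=1..n. om d Y q * dn (G X') d + cnj (om d Y q) * up (G X') d)"
    proof (rule frame_expansion[OF q Y])
      fix Z Z' assume "Z \<in> XM" "Z' \<in> XM"
      then show "G X' (Z + Z') = G X' Z + G X' Z'"
        using anti[of "Z + Z'" X'] anti[of Z X'] anti[of Z' X'] add[of Z Z' X'] X' G[of X'] by simp
    next
      fix h Z assume "h \<in> CM" "Z \<in> XM"
      then show "G X' (h \<odot> Z) = of_real (h q) * G X' Z"
        using anti[of "h \<odot> Z" X'] anti[of Z X'] scale[of h Z X'] X' G[of X'] by simp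
    qed
    moreover have "G X' \<xi> = 0" using anti[of \<xi> X'] xi[OF X'] X' by (simp add: G)
    ultimately show ?thesis by simp
  qed
  have dnY: "dn (\<lambda>X. G X Y) c = (\<Sum>d=1..n. om d Y q * PP c d + cnj (om d Y q) * QQ c d)"
    and upY: "up (\<lambda>X. G X Y) c = (\<Sum>d=1..n. om d Y q * - QQ d c + cnj (om d Y q) * SS c d)"
    if c: "c \<in> {1..n}" for c
  proof -
    have "dn (\<lambda>X. G X Y) c = dn (\<lambda>X. \<Sum>d=1..n. om d Y q * dn (G X) d + cnj (om d Y q) * up (G X) d) c"
      by (rule dn_cong; rule second; use c in simp)
    then show "dn (\<lambda>X. G X Y) c = (\<Sum>d=1..n. om d Y q * PP c d + cnj (om d Y q) * QQ c d)"
      by (simp add: dn_linear PP_def QQ_def)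
    have "up (\<lambda>X. G X Y) c = up (\<lambda>X. \<Sum>d=1..n. om d Y q * dn (G X) d + cnj (om d Y q) * up (G X) d) c"
      by (rule up_cong; rule second; use c in simp)
    then show "up (\<lambda>X. G X Y) c = (\<Sum>d=1..n. om d Y q * - QQ d c + cnj (om d Y q) * SS c d)"
      by (simp add: up_linear SS_def Q')
  qed
  have s1: "G X Y = eta_form X q * G \<xi> Y + (\<Sum>c=1..n. om c X q * dn (\<lambda>X. G X Y) c + cnj (om c X q) * up (\<lambda>X. G X Y) c)"
  proof (rule frame_expansion[OF q X])
    show "G (Z + Z') Y = G Z Y + G Z' Y" if "Z \<in> XM" "Z' \<in> XM" for Z Z'
      using add[OF that Y] G[OF that(1) Y] G[OF that(2) Y] G[OF XM_add[OF that] Y] by (simp only:)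
    show "G (h \<odot> Z) Y = of_real (h q) * G Z Y" if "h \<in> CM" "Z \<in> XM" for h Z
      using scale[OF that Y] G[OF that(2) Y] G[OF XM_fmul[OF that] Y] by (simp only:)
  qed
  have s2: "G \<xi> Y = 0" using xi[OF Y] Y by (simp add: G)
  have s3: "(\<Sum>c=1..n. om c X q * dn (\<lambda>X. G X Y) c + cnj (om c X q) * up (\<lambda>X. G X Y) c)
     = (\<Sum>c=1..n. (\<Sum>d=1..n. PP c d * (om c X q * om d Y q)) + (\<Sum>d=1..n. QQ c d * (om c X q * cnj (om d Y q)))
        - (\<Sum>d=1..n. QQ d c * (cnj (om c X q) * om d Y q)) + (\<Sum>d=1..n. SS c d * (cnj (om c X q) * cnj (om d Y q))))"
    by (simp add: dnY upY sum.distrib sum_distrib_left sum_subtractf algebra_simps sum_negf cong: sum.cong_simp)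
  have s4:  "(\<Sum>c=1..n. (\<Sum>d=1..n. PP c d * (om c X q * om d Y q)) + (\<Sum>d=1..n. QQ c d * (om c X q * cnj (om d Y q)))
        - (\<Sum>d=1..n. QQ d c * (cnj (om c X q) * om d Y q)) + (\<Sum>d=1..n. SS c d * (cnj (om c X q) * cnj (om d Y q))))
      = (\<Sum>c=1..n. \<Sum>d=1..n. PP c d * (om c X q * om d Y q))
      + (\<Sum>c=1..n. \<Sum>d=1..n. QQ c d * (om c X q * cnj (om d Y q)))
      - (\<Sum>c=1..n. \<Sum>d=1..n. QQ d c * (cnj (om c X q) * om d Y q))
      + (\<Sum>c=1..n. \<Sum>d=1..n. SS c d * (cnj (om c X q) * cnj (om d Y q)))"
    by (simp add: sum.distrib sum_subtractf)
  have s5: "(\<Sum>c=1..n. \<Sum>d=1..n. QQ d c * (cnj (om c X q) * om d Y q))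
      = (\<Sum>c=1..n. \<Sum>d=1..n. QQ c d * (om c Y q * cnj (om d X q)))"
    by (subst sum.swap) (simp add: mult.commute[of "cnj _"])
  have s6: "wedge_sum QQ om cnj_om X Y q
      = (\<Sum>c=1..n. \<Sum>d=1..n. QQ c d * (om c X q * cnj (om d Y q)))
      - (\<Sum>c=1..n. \<Sum>d=1..n. QQ c d * (om c Y q * cnj (om d X q)))"
    by (simp add: wedge_def right_diff_distrib sum_subtractf)
  have "G X Y = wedge_sum (\<lambda>c d. PP c d / 2) om om X Y q
      + wedge_sum QQ om cnj_om X Y q
      + wedge_sum (\<lambda>c d. SS c d / 2) cnj_om cnj_om X Y q"
    unfolding two_form_half[of PP, OF PP] two_form_half[of SS, OF SS] s1 s2 s3 s4 s5 s6 by simp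
  then show ?thesis using G[OF X Y] by (simp add: coef cong: sum.cong_simp)
qed

end

context levi_civita_manifold
begin

lemma Riem_add3: "X \<in> XM \<Longrightarrow> Y \<in> XM \<Longrightarrow> Z \<in> XM \<Longrightarrow> Z' \<in> XM \<Longrightarrow> W \<in> XM \<Longrightarrow>
    Riem g D X Y (Z + Z') W p = Riem g D X Y Z W p + Riem g D X Y Z' W p"
  using Riem_add1[of Z Z' W X Y p] Riem_pair[of X Y _ W p] by simp

lemma Riem_fmul3: "h \<in> CM \<Longrightarrow> X \<in> XM \<Longrightarrow> Y \<in> XM \<Longrightarrow> Z \<in> XM \<Longrightarrow> W \<in> XM \<Longrightarrow>
    Riem g D X Y (h \<odot> Z) W p = h p * Riem g D X Y Z W p"
  using Riem_fmul1[of h Z W X Y p] Riem_pair[of X Y _ W p] by simp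

end

context kenmotsu_frame
begin

lemma Riem_frame_xi:
  assumes "Z \<in> XM" "W \<in> XM" "Y \<in> XM" "g Z \<xi> q = 0" "g W \<xi> q = 0"
  shows "Riem g D Z W \<xi> Y q = 0"
  using Riem_pair[of Z W \<xi> Y q] Riem_skew12[of Y \<xi> Z W q] Riem_xi[of Z W Y q] assms by simp

context
  fixes a b X Y
  assumes a: "a \<in> {1..n}" and b: "b \<in> {1..n}" and X: "X \<in> XM" and Y: "Y \<in> XM"
begin

lemma Om_skew: "Om a b Y X q = - Om a b X Y q"
  using a b X Y
  by (simp add: Om_def dn_def up_def Riem_skew34[of _ _ X Y] add_divide_distrib diff_divide_distrib
      algebra_simps)

lemma Om_add: "X' \<in> XM \<Longrightarrow> Om a b (X + X') Y q = Om a b X Y q + Om a b X' Y q"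
  using a b X Y
  by (simp add: Om_def dn_def up_def Riem_add3 add_divide_distrib diff_divide_distrib algebra_simps)

lemma Om_fmul: "h \<in> CM \<Longrightarrow> Om a b (h \<odot> X) Y q = of_real (h q) * Om a b X Y q"
  using a b X Y
  by (simp add: Om_def dn_def up_def Riem_fmul3 add_divide_distrib diff_divide_distrib algebra_simps)

lemma Om_xi: "q \<in> U \<Longrightarrow> Om a b \<xi> Y q = 0"
  and Oa_xi: "q \<in> U \<Longrightarrow> Oa a b \<xi> Y q = 0"
  using a b Y by (simp_all add: Om_def Oa_def dn_def up_def Riem_frame_xi)

lemma cnj_Om: "cnj (Om a b X Y q) = - Om b a X Y q"
  using a b X Y Riem_skew12[of "e b" "e a" X Y q] Riem_skew12[of "\<Phi> (e b)" "e a" X Y q]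
    Riem_skew12[of "e b" "\<Phi> (e a)" X Y q] Riem_skew12[of "\<Phi> (e b)" "\<Phi> (e a)" X Y q]
  by (simp add: Om_def dn_def up_def complex_eq_iff) (simp add: field_simps)

end

definition A1c where "A1c a b c d q = dn (\<lambda>X. dn (\<lambda>Y. Om a b X Y q) d) c / 2"

definition A2c where "A2c a d b c q = dn (\<lambda>X. up (\<lambda>Y. Om a b X Y q) d) c
    + (\<Sum>h=1..n. Bf a h c q * cnj (Bf b h d q)) + kdelta c a * kdelta d b"

definition B2c where "B2c a b c d q = dn (\<lambda>X. LB a b c X q) d"

definition B3c where "B3c a b d c q = up (\<lambda>X. LB a b c X q) d"

definition coframe where
  "coframe i = (if i = 0 then eta_form else if i \<le> n then om i else cnj_om (i - n))"

lemma coframe_simps: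
  "coframe 0 = eta_form"
  "a \<in> {1..n} \<Longrightarrow> coframe a = om a"
  "a \<in> {1..n} \<Longrightarrow> coframe (hat n a) = cnj_om a"
  by (auto simp: coframe_def hat_def)

lemma index_cases:
  assumes "i \<le> 2 * n"
  obtains "i = 0" | "i \<in> {1..n}" | a where "a \<in> {1..n}" "i = a + n"
proof (cases "i \<le> n")
  case False
  with assms have "i - n \<in> {1..n}" "i = (i - n) + n" by auto
  then show ?thesis using that(3) by blast
qed (use that in force)

lemma dual_coframe_coframe: "dual_coframe n A \<Phi> \<xi> U e coframe"
  unfolding dual_coframe_def
proof (intro conjI allI impI ballI)
  fix i assume i: "i \<le> 2 * n"
  show form: "one_form A (coframe i)"
    using i by (cases rule: index_cases)
      (auto simp: coframe_def intro: one_form_eta one_form_om one_form_cnj_om)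
  fix j q assume j: "j \<le> 2 * n" and q: "q \<in> U"
  note clin = clin_A_frame[OF form]
  have eta: "dn (\<lambda>Z. eta_form Z q) c = 0" "up (\<lambda>Z. eta_form Z q) c = 0" if "c \<in> {1..n}" for c
    using that q by (simp_all add: dn_def up_def eta_form_def)
  have eta0: "eta_form \<xi> q = 1" by (simp add: eta_form_def)
  note frame = om_frame[OF q] cnj_om_frame[OF q] eta eta0
  have clin0: "clin (coframe i) (A_frame n \<Phi> \<xi> e 0) q = coframe i \<xi> q"
    using one_form_0[OF form] by (simp add: clin_def A_frame_def)
  from j show "clin (coframe i) (A_frame n \<Phi> \<xi> e j) q = kdelta i j"
  proof (cases rule: index_cases)
    case 1
    show ?thesis unfolding 1 clin0
      using i by (cases rule: index_cases) (use frame in \<open>auto simp: coframe_def kdelta_def\<close>)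
  next
    case 2
    show ?thesis unfolding clin(2)[OF 2]
      using i 2 by (cases rule: index_cases) (use frame in \<open>auto simp: coframe_def kdelta_def\<close>)
  next
    case (3 c)
    show ?thesis unfolding 3(2) clin(3)[OF 3(1)]
      using i 3 by (cases rule: index_cases) (use frame in \<open>auto simp: coframe_def kdelta_def\<close>)
  qed
qed

lemma structure_eqs1_conn: "structure_eqs1 n A U coframe conn Bf"
  unfolding structure_eqs1_def
proof (intro conjI ballI)
  fix q X Y assume q: "q \<in> U" and X: "X \<in> XM" and Y: "Y \<in> XM"
  show "ext_d (coframe 0) X Y q = 0"
    unfolding coframe_simps by (rule ext_d_eta[OF X Y])
  fix a assume a: "a \<in> {1..n}"
  show "ext_d (coframe a) X Y q = (\<Sum>b=1..n. wedge (conn a b) (coframe b) X Y q)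
               + (\<Sum>b=1..n. \<Sum>c=1..n. Bf a b c q * wedge (coframe c) (coframe (hat n b)) X Y q)
               - wedge (coframe a) (coframe 0) X Y q"
    using ext_d_om_conn[OF q a X Y] a by (simp add: coframe_simps cong: sum.cong_simp)
  show "ext_d (coframe (hat n a)) X Y q = - (\<Sum>b=1..n. wedge (conn b a) (coframe (hat n b)) X Y q)
               + (\<Sum>b=1..n. \<Sum>c=1..n. cnj (Bf a b c q) * wedge (coframe (hat n c)) (coframe b) X Y q)
               - wedge (coframe (hat n a)) (coframe 0) X Y q"
    using ext_d_cnj_om[OF q a X Y] a by (simp add: coframe_simps cong: sum.cong_simp)
qed (use one_form_conn Bf_smooth Bf_skew in blast)+

lemma Om_expansion:
  assumes q: "q \<in> U" and a: "a \<in> {1..n}" and b: "b \<in> {1..n}" and X: "X \<in> XM" and Y: "Y \<in> XM"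
  shows "Om a b X Y q = wedge_sum (\<lambda>c d. A1c a b c d q) om om X Y q
      + wedge_sum (\<lambda>c d. A2c a d b c q - (\<Sum>h=1..n. Bf a h c q * cnj (Bf b h d q)) - kdelta c a * kdelta d b) om cnj_om X Y q
      + wedge_sum (\<lambda>c d. - cnj (A1c b a c d q)) cnj_om cnj_om X Y q"
proof -
  have "up (\<lambda>X. up (\<lambda>Y. Om a b X Y q) d) c / 2 = - cnj (A1c b a c d q)" if "c \<in> {1..n}" "d \<in> {1..n}" for c d
  proof -
    have "cnj (A1c b a c d q) = up (\<lambda>X. up (\<lambda>Y. cnj (Om b a X Y q)) d) c / 2"
      by (simp add: A1c_def up_cnj)
    also have "up (\<lambda>X. up (\<lambda>Y. cnj (Om b a X Y q)) d) c = up (\<lambda>X. up (\<lambda>Y. - Om a b X Y q) d) c"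
      by (rule up_cong; rule up_cong; rule cnj_Om[OF b a]; use that in simp)
    finally show ?thesis by (simp add: up_minus)
  qed
  moreover have "Om a b X Y q = wedge_sum (\<lambda>c d. dn (\<lambda>X. dn (\<lambda>Y. Om a b X Y q) d) c / 2) om om X Y q
      + wedge_sum (\<lambda>c d. dn (\<lambda>X. up (\<lambda>Y. Om a b X Y q) d) c) om cnj_om X Y q
      + wedge_sum (\<lambda>c d. up (\<lambda>X. up (\<lambda>Y. Om a b X Y q) d) c / 2) cnj_om cnj_om X Y q"
    by (rule two_form_expansion[OF q X Y, of "\<lambda>X Y. Om a b X Y q"])
      (rule Om_skew[OF a b] Om_add[OF a b] Om_fmul[OF a b] Om_xi[OF a b _ _ q]; assumption)+
  ultimately show ?thesis
    by (simp add: A1c_def A2c_def cong: sum.cong_simp)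
qed

lemma LB_expansion:
  assumes q: "q \<in> U" and a: "a \<in> {1..n}" and b: "b \<in> {1..n}" and c: "c \<in> {1..n}" and X: "X \<in> XM"
  shows "LB a b c X q = (\<Sum>d=1..n. B2c a b c d q * om d X q) + (\<Sum>d=1..n. B3c a b d c q * cnj (om d X q))
      - Bf a b c q * eta_form X q"
proof -
  have xi: "LB a b c \<xi> q = - Bf a b c q" if c: "c \<in> {1..n}" for c
  proof -
    have *: "(\<Sum>c=1..n. (LB a b c \<xi> q + Bf a b c q) * om c Y q) = 0" if Y: "Y \<in> XM" for Y
      using Oa_eq[OF q a b xi_XM Y] Oa_xi[OF a b _ Y q, OF Y] om_frame(1)[OF q] a b
      by (simp add: wedge_def eta_form_def sum.distrib distrib_right sum_negf add_eq_0_iff cong: sum.cong_simp)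
    have "dn (\<lambda>Y. \<Sum>c=1..n. (LB a b c \<xi> q + Bf a b c q) * om c Y q) c = 0"
      by (rule dn_eq_0; rule *; use c in simp)
    then have "(\<Sum>d=1..n. (LB a b d \<xi> q + Bf a b d q) * kdelta d c) = 0"
      using om_frame(2)[OF q _ c] by (simp add: dn_sum dn_cmult cong: sum.cong_simp)
    then have "LB a b c \<xi> q + Bf a b c q = 0" unfolding sum_kdelta[OF c] .
    then show ?thesis by (simp add: add_eq_0_iff2)
  qed
  have CS: "Bf a b c \<in> CS" by (rule Bf_smooth[OF a b c])
  have "LB a b c X q = eta_form X q * LB a b c \<xi> q
      + (\<Sum>d=1..n. om d X q * dn (\<lambda>Z. LB a b c Z q) d + cnj (om d X q) * up (\<lambda>Z. LB a b c Z q) d)"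
  proof (rule frame_expansion[OF q X])
    fix Z Z' assume Z: "Z \<in> XM" "Z' \<in> XM"
    have "cder (Z + Z') f q = cder Z f q + cder Z' f q" for f
      by (simp add: cder_def complex_eq_iff)
    then show "LB a b c (Z + Z') q = LB a b c Z q + LB a b c Z' q"
      using one_formD(2)[OF one_form_conn _ Z(2)] Z a b c
      by (simp add: LB_def distrib_left sum.distrib cong: sum.cong_simp)
  next
    fix h Z assume h: "h \<in> CM" and Z: "Z \<in> XM"
    have "cder (h \<odot> Z) f q = of_real (h q) * cder Z f q" for f
      by (simp add: cder_def fmul_def complex_eq_iff)
    then show "LB a b c (h \<odot> Z) q = of_real (h q) * LB a b c Z q"
      using one_formD(3)[OF one_form_conn Z h] a b c
      by (simp add: LB_def right_diff_distrib distrib_left sum_distrib_left mult.left_commute cong: sum.cong_simp)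
  qed
  then show ?thesis
    by (simp add: xi[OF c] B2c_def B3c_def sum.distrib mult.commute)
qed

lemma structure_functions_exist: "structure_functions n A \<Phi> \<xi> g U e Bf A1c A2c B2c B3c"
  unfolding structure_functions_def
proof (intro conjI exI)
  show "AG_section n A \<Phi> \<xi> g U e"
    unfolding AG_section_def orthonormal_iff_adapted using U_open adapted by blast
  show "dual_coframe n A \<Phi> \<xi> U e coframe" by (rule dual_coframe_coframe)
  show "structure_eqs1 n A U coframe conn Bf" by (rule structure_eqs1_conn)
  show "structure_eqs2 n A U coframe conn Bf A1c A2c B2c B3c"
    unfolding structure_eqs2_def
  proof (intro ballI conjI)
    fix q a b assume q: "q \<in> U" and a: "a \<in> {1..n}" and b: "b \<in> {1..n}"
    show "A1c a b c d q = - A1c a b d c q" if "c \<in> {1..n}" "d \<in> {1..n}" for c d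
    proof -
      have "dn (\<lambda>X. dn (\<lambda>Y. Om a b X Y q) d) c = dn (\<lambda>X. dn (\<lambda>Y. - Om a b Y X q) d) c"
        by (rule dn_cong; rule dn_cong; rule Om_skew[OF a b]; use that in simp)
      also have "\<dots> = - dn (\<lambda>Y. dn (\<lambda>X. Om a b Y X q) c) d"
        unfolding dn_minus by (simp only: dn_dn_swap[of "\<lambda>Z W. Om a b Z W q"])
      finally show ?thesis by (simp add: A1c_def)
    qed
    show "ext_d (conn a b) X Y q = (\<Sum>c=1..n. wedge (conn a c) (conn c b) X Y q)
      - wedge_sum (\<lambda>c d. A1c a b c d q) coframe coframe X Y q
      - (\<Sum>c=1..n. \<Sum>d=1..n. A2c a d b c q * wedge (coframe c) (coframe (hat n d)) X Y q)
      + (\<Sum>c=1..n. \<Sum>d=1..n. cnj (A1c b a c d q) * wedge (coframe (hat n c)) (coframe (hat n d)) X Y q)"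
      if "X \<in> XM" "Y \<in> XM" for X Y
      using Om_expansion[OF q a b that] unfolding Om_from_ext_d_conn[OF q a b that, symmetric]
      by (simp add: coframe_simps cong: sum.cong_simp)
    show "cder X (Bf a b c) q
            + (\<Sum>h=1..n. Bf a b h q * conn h c X q)
            - (\<Sum>h=1..n. Bf h b c q * conn a h X q)
            - (\<Sum>h=1..n. Bf a h c q * conn b h X q) =
            (\<Sum>d=1..n. B2c a b c d q * coframe d X q)
            + (\<Sum>d=1..n. B3c a b d c q * coframe (hat n d) X q)
            - Bf a b c q * coframe 0 X q"
      if "X \<in> XM" "c \<in> {1..n}" for X c
      using LB_expansion[OF q a b that(2,1)] by (simp add: LB_def coframe_simps cong: sum.cong_simp)
  qed
qed

end

section \<open>Constant generalized curvature\<close>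

context kenmotsu_manifold
begin

text \<open>The curvature that constancy of the generalized curvature forces, with \<open>k = (a\<^sub>1 / a\<^sub>0) \<mu>\<close>.\<close>

definition model_curv :: "real \<Rightarrow> 'a vfield \<Rightarrow> 'a vfield \<Rightarrow> 'a vfield \<Rightarrow> 'a vfield \<Rightarrow> 'a \<Rightarrow> real" where
  "model_curv k Z W X Y p = (k - 1) * (g Z X p * g W Y p - g Z Y p * g W X p)
    - k * (g Z X p * g W \<xi> p * g Y \<xi> p - g Z Y p * g W \<xi> p * g X \<xi> p
         + g Z \<xi> p * g X \<xi> p * g W Y p - g Z \<xi> p * g Y \<xi> p * g W X p)"

lemma model_curv_linear:
  assumes "Z \<in> XM" "W \<in> XM" "X \<in> XM" "Y \<in> XM"
  shows "Z' \<in> XM \<Longrightarrow> model_curv k (Z + Z') W X Y p = model_curv k Z W X Y p + model_curv k Z' W X Y p"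
    and "W' \<in> XM \<Longrightarrow> model_curv k Z (W + W') X Y p = model_curv k Z W X Y p + model_curv k Z W' X Y p"
    and "h \<in> CM \<Longrightarrow> model_curv k (h \<odot> Z) W X Y p = h p * model_curv k Z W X Y p"
    and "h \<in> CM \<Longrightarrow> model_curv k Z (h \<odot> W) X Y p = h p * model_curv k Z W X Y p"
  using assms by (simp_all add: model_curv_def algebra_simps)

lemma some_frame: "orthonormal_at A g p DIM('b) (some_frame_at A g p)"
proof -
  obtain U e where "p \<in> U" "\<forall>q\<in>U. adapted n e q" using adapted_exists[OF order_refl, of p] by metis
  then have "orthonormal_at A g p DIM('b) (real_frame n \<Phi> \<xi> e)"
    using orthonormal_iff_adapted[of p n e] dim by metis
  then show ?thesis unfolding some_frame_at_def by (rule someI[of "orthonormal_at A g p DIM('b)"])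
qed

lemma Ric_xi:
  assumes Y: "Y \<in> XM"
  shows "Ric A g D Y \<xi> p = - 2 * real n * g Y \<xi> p" "Ric A g D \<xi> Y p = - 2 * real n * g Y \<xi> p"
proof -
  let ?E = "some_frame_at A g p"
  have E: "?E i \<in> XM" "g (?E i) (?E i) p = 1" if "i \<in> {..<DIM('b)}" for i
    using some_frame[of p] that by (simp_all add: orthonormal_at_def)
  have "Riem g D (?E i) \<xi> (?E i) Y p = g \<xi> (?E i) p * g Y (?E i) p - g Y \<xi> p" if i: "i \<in> {..<DIM('b)}" for i
    using Riem_xi[OF E(1)[OF i] Y E(1)[OF i], of p] g_commute[OF xi_XM E(1)[OF i]] E(2)[OF i] by simp
  then have "Ric A g D \<xi> Y p = (\<Sum>i<DIM('b). g \<xi> (?E i) p * g Y (?E i) p - g Y \<xi> p)"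
    unfolding Ric_def by (intro sum.cong refl)
  also have "\<dots> = g \<xi> Y p - real DIM('b) * g Y \<xi> p"
    using Parseval[OF some_frame xi_XM Y] by (simp add: sum_subtractf)
  also have "\<dots> = - 2 * real n * g Y \<xi> p"
    using g_commute[OF xi_XM Y] by (simp add: dim algebra_simps)
  finally show "Ric A g D \<xi> Y p = - 2 * real n * g Y \<xi> p" .
  moreover have "Ric A g D Y \<xi> p = Ric A g D \<xi> Y p"
    unfolding Ric_def by (intro sum.cong refl Riem_pair E xi_XM Y)
  ultimately show "Ric A g D Y \<xi> p = - 2 * real n * g Y \<xi> p" by simp
qed

lemma constant_imp_Ric:
  assumes "a1 \<noteq> 0" and c: "constant_gen_curv A g D a0 a1 a2 \<kappa>" and X: "X \<in> XM" and Z: "Z \<in> XM"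
    and l: "l = 1 / a1 * (a0 + 2 * real n * a1 - 2 * a2 * scal A g D p + \<kappa>)"
  shows "Ric A g D X Z p = l * g X Z p + - (2 * real n + l) * g X \<xi> p * g Z \<xi> p"
proof -
  have "gen_curv A g D a0 a1 a2 X \<xi> Z \<xi> p = \<kappa> * (g X Z p * g \<xi> \<xi> p - g X \<xi> p * g \<xi> Z p)"
    using c X Z unfolding constant_gen_curv_def by blast
  then have "a1 * Ric A g D X Z p
      = a1 * l * g X Z p + - (2 * real n * a1 + a1 * l) * g X \<xi> p * g Z \<xi> p"
    using Riem_xi[of Z \<xi> X p] Ric_xi[OF X, of p] Ric_xi[OF Z, of p] Ric_xi[OF xi_XM, of p]
      g_commute[OF xi_XM X] g_commute[OF xi_XM Z] g_commute[OF X Z] X Z assms(1)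
    by (simp add: gen_curv_def l algebra_simps)
  then have "a1 * Ric A g D X Z p = a1 * (l * g X Z p + - (2 * real n + l) * g X \<xi> p * g Z \<xi> p)"
    by (simp add: algebra_simps)
  with assms(1) show ?thesis by simp
qed

lemma gen_curv_iff_model:
  assumes "a0 \<noteq> 0" "a1 \<noteq> 0" and X: "X \<in> XM" and Y: "Y \<in> XM" and Z: "Z \<in> XM" and W: "W \<in> XM"
    and l: "l = 1 / a1 * (a0 + 2 * real n * a1 - 2 * a2 * scal A g D p + \<kappa>)"
    and Ric: "\<And>X Z. X \<in> XM \<Longrightarrow> Z \<in> XM \<Longrightarrow>
      Ric A g D X Z p = l * g X Z p + - (2 * real n + l) * g X \<xi> p * g Z \<xi> p"
  shows "gen_curv A g D a0 a1 a2 Z W X Y p = \<kappa> * (g Z X p * g W Y p - g Z Y p * g W X p)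
    \<longleftrightarrow> Riem g D Z W X Y p = model_curv (a1 / a0 * - (2 * real n + l)) Z W X Y p"
proof -
  define m where "m = - (2 * real n + l)"
  define G where "G = g Z X p * g W Y p - g Z Y p * g W X p"
  define H where "H = g Z X p * g W \<xi> p * g Y \<xi> p - g Z Y p * g W \<xi> p * g X \<xi> p
         + g Z \<xi> p * g X \<xi> p * g W Y p - g Z \<xi> p * g Y \<xi> p * g W X p"
  have al: "a1 * l = a0 + 2 * real n * a1 - 2 * a2 * scal A g D p + \<kappa>" using assms(2) l by simp
  have "gen_curv A g D a0 a1 a2 Z W X Y p
      = a0 * Riem g D Z W X Y p + 2 * (a1 * l) * G + a1 * m * H + 2 * a2 * scal A g D p * G"
    using X Y Z W by (simp add: gen_curv_def Ric G_def H_def m_def algebra_simps)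
  then have "gen_curv A g D a0 a1 a2 Z W X Y p - \<kappa> * G
      = a0 * Riem g D Z W X Y p + (2 * (a1 * l) + 2 * a2 * scal A g D p - \<kappa>) * G + a1 * m * H"
    by (simp add: algebra_simps)
  also have "2 * (a1 * l) + 2 * a2 * scal A g D p - \<kappa> = a0 - a1 * m"
    using al by (simp add: m_def algebra_simps)
  finally have "gen_curv A g D a0 a1 a2 Z W X Y p - \<kappa> * G
      = a0 * Riem g D Z W X Y p - ((a1 * m - a0) * G - a1 * m * H)"
    by (simp add: algebra_simps)
  also have "\<dots> = a0 * (Riem g D Z W X Y p - model_curv (a1 / a0 * m) Z W X Y p)"
  proof -
    have model: "model_curv (a1 / a0 * m) Z W X Y p = (a1 / a0 * m - 1) * G - a1 / a0 * m * H"
      by (simp only: model_curv_def G_def H_def)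
    show ?thesis unfolding model using assms(1) by (simp add: field_simps)
  qed
  finally have "gen_curv A g D a0 a1 a2 Z W X Y p = \<kappa> * G
      \<longleftrightarrow> a0 * (Riem g D Z W X Y p - model_curv (a1 / a0 * m) Z W X Y p) = 0"
    by (metis right_minus_eq)
  then show ?thesis using assms(1) by (simp add: G_def m_def)
qed

end

context kenmotsu_frame
begin

lemma model_curv_mixed:
  assumes "p \<in> U" "a \<in> {1..n}" "b \<in> {1..n}" "X \<in> XM" "Y \<in> XM"
  shows "dn (\<lambda>W. up (\<lambda>Z. of_real (model_curv k Z W X Y p)) a) b
      = of_real (k - 1) * wedge (om a) (cnj_om b) X Y p"
    and "up (\<lambda>W. up (\<lambda>Z. of_real (model_curv k Z W X Y p)) a) b
      = of_real (k - 1) * wedge (om a) (om b) X Y p"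
proof -
  let ?f = "\<lambda>Z W. of_real (k - 1) * (complex_of_real (g Z X p) * of_real (g W Y p)
      - of_real (g Z Y p) * of_real (g W X p))"
  have f: "complex_of_real (model_curv k Z W X Y p) = ?f Z W" if "g Z \<xi> p = 0" "g W \<xi> p = 0" for Z W
    using that by (simp add: model_curv_def)
  have "dn (\<lambda>W. up (\<lambda>Z. of_real (model_curv k Z W X Y p)) a) b = dn (\<lambda>W. up (\<lambda>Z. ?f Z W) a) b"
    by (rule dn_cong; rule up_cong; rule f; use assms in simp)
  then show "dn (\<lambda>W. up (\<lambda>Z. of_real (model_curv k Z W X Y p)) a) b
      = of_real (k - 1) * wedge (om a) (cnj_om b) X Y p"
    using assms by (simp only: up_linear dn_linear up_g dn_g wedge_def)
  have "up (\<lambda>W. up (\<lambda>Z. of_real (model_curv k Z W X Y p)) a) b = up (\<lambda>W. up (\<lambda>Z. ?f Z W) a) b"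
    by (rule up_cong; rule up_cong; rule f; use assms in simp)
  then show "up (\<lambda>W. up (\<lambda>Z. of_real (model_curv k Z W X Y p)) a) b
      = of_real (k - 1) * wedge (om a) (om b) X Y p"
    using assms by (simp only: up_linear up_g wedge_def)
qed

lemma frame_components_zero:
  fixes h :: "'a vfield \<Rightarrow> 'a vfield \<Rightarrow> real"
  assumes "dn (\<lambda>W. up (\<lambda>Z. of_real (h Z W)) a) b = 0" "up (\<lambda>W. up (\<lambda>Z. of_real (h Z W)) a) b = 0"
  shows "h (e a) (e b) = 0" "h (e a) (\<Phi> (e b)) = 0" "h (\<Phi> (e a)) (e b) = 0" "h (\<Phi> (e a)) (\<Phi> (e b)) = 0"
  using assms by (auto simp: dn_def up_def complex_eq_iff)

context
  fixes w w1 B A1 A2 B2 B3 p and k :: real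
  assumes w: "dual_coframe n A \<Phi> \<xi> U e w" and eqs1: "structure_eqs1 n A U w w1 B"
    and eqs2: "structure_eqs2 n A U w w1 B A1 A2 B2 B3" and p: "p \<in> U"
begin

private lemmas curv = structure_functions_curvature[OF w eqs1 eqs2 p]

lemma model_imp_structure_functions:
  assumes R: "\<And>X Y Z W. X \<in> XM \<Longrightarrow> Y \<in> XM \<Longrightarrow> Z \<in> XM \<Longrightarrow> W \<in> XM \<Longrightarrow>
      Riem g D Z W X Y p = model_curv k Z W X Y p"
    and a: "a \<in> {1..n}" and b: "b \<in> {1..n}" and c: "c \<in> {1..n}" and d: "d \<in> {1..n}"
  shows "A1 a b c d p = 0"
    and "A2 a d b c p = (\<Sum>h=1..n. B a h c p * cnj (B b h d p)) + of_real k * kdelta a c * kdelta d b"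
    and "alt2 (\<lambda>c d. B2 a b c d p) c d = of_real k * alt2 (\<lambda>c d. kdelta a c * kdelta b d) c d"
proof -
  have comm: "kdelta i j = kdelta j i" for i j by (simp add: kdelta_def)
  have Om: "Om a b X Y p = wedge_sum (\<lambda>c d. 0) om om X Y p
      + wedge_sum (\<lambda>c d. of_real (k - 1) * (kdelta c a * kdelta d b)) om cnj_om X Y p
      + wedge_sum (\<lambda>c d. 0) cnj_om cnj_om X Y p" if X: "X \<in> XM" and Y: "Y \<in> XM" for X Y
  proof -
    have "Om a b X Y p = dn (\<lambda>W. up (\<lambda>Z. of_real (model_curv k Z W X Y p)) a) b"
      unfolding Om_def by (rule dn_cong; rule up_cong; rule arg_cong[where f=of_real]; rule R; use X Y a b in simp)
    then show ?thesis
      unfolding model_curv_mixed[OF p a b X Y] wedge_kdelta[OF a b, of om cnj_om]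
      by (simp add: sum_distrib_left mult.assoc)
  qed
  have Oa: "Oa a b X Y p = wedge_sum (\<lambda>c d. of_real (k - 1) * (kdelta c a * kdelta d b)) om om X Y p
      + wedge_sum (\<lambda>c d. 0) om cnj_om X Y p
      + wedge_sum (\<lambda>c d. 0) cnj_om cnj_om X Y p" if X: "X \<in> XM" and Y: "Y \<in> XM" for X Y
  proof -
    have "Oa a b X Y p = up (\<lambda>W. up (\<lambda>Z. of_real (model_curv k Z W X Y p)) a) b"
      unfolding Oa_def by (rule up_cong; rule up_cong; rule arg_cong[where f=of_real]; rule R; use X Y a b in simp)
    then show ?thesis
      unfolding model_curv_mixed[OF p a b X Y] wedge_kdelta[OF a b, of om om]
      by (simp add: sum_distrib_left mult.assoc)
  qed
  have Oa': "wedge_sum (\<lambda>c d. B2 a b c d p - kdelta c a * kdelta d b) om om X Y p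
      + wedge_sum (\<lambda>c d. B3 a b d c p - (\<Sum>h=1..n. Bf a b h p * Bf h d c p)) om cnj_om X Y p
      + wedge_sum (\<lambda>c d. 0) cnj_om cnj_om X Y p = Oa a b X Y p"
    if "X \<in> XM" "Y \<in> XM" for X Y
    using curv(2)[OF a b that] by simp
  note Om1 = two_form_coefficients[OF p c d curv(1)[OF a b, symmetric]]
  note Om2 = two_form_coefficients[OF p c d Om[symmetric]]
  note Oa1 = two_form_coefficients[OF p c d Oa']
  note Oa2 = two_form_coefficients[OF p c d Oa[symmetric]]
  have "A1 a b c d p - A1 a b d c p = 0 - 0"
    using Om1(1) Om2(1) by simp
  moreover have "A1 a b c d p = - A1 a b d c p"
    using eqs2 p a b c d unfolding structure_eqs2_def by blast
  ultimately show "A1 a b c d p = 0" by simp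
  have "A2 a d b c p - (\<Sum>h=1..n. Bf a h c p * cnj (Bf b h d p)) - kdelta c a * kdelta d b
      = of_real (k - 1) * (kdelta c a * kdelta d b)"
    using Om1(2) Om2(2) by simp
  then have "A2 a d b c p = (\<Sum>h=1..n. Bf a h c p * cnj (Bf b h d p)) + of_real k * kdelta a c * kdelta d b"
    by (simp add: comm[of c a] algebra_simps)
  moreover have "B a h c p = Bf a h c p" "B b h d p = Bf b h d p" if "h \<in> {1..n}" for h
    using structure_eqs1_unique(2)[OF w eqs1 p] a b c d that by blast+
  ultimately show "A2 a d b c p = (\<Sum>h=1..n. B a h c p * cnj (B b h d p)) + of_real k * kdelta a c * kdelta d b"
    by (simp cong: sum.cong_simp)
  have "(B2 a b c d p - kdelta c a * kdelta d b) - (B2 a b d c p - kdelta d a * kdelta c b)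
      = of_real (k - 1) * (kdelta c a * kdelta d b) - of_real (k - 1) * (kdelta d a * kdelta c b)"
    using Oa1(1) Oa2(1) by simp
  then have "B2 a b c d p - B2 a b d c p = of_real k * (kdelta a c * kdelta b d - kdelta a d * kdelta b c)"
    by (simp add: comm[of c a] comm[of d b] comm[of d a] comm[of c b] algebra_simps)
  then show "alt2 (\<lambda>c d. B2 a b c d p) c d = of_real k * alt2 (\<lambda>c d. kdelta a c * kdelta b d) c d"
    by (simp add: alt2_def)
qed

lemma structure_functions_imp_model:
  assumes cond: "\<And>a b c d. a \<in> {1..n} \<Longrightarrow> b \<in> {1..n} \<Longrightarrow> c \<in> {1..n} \<Longrightarrow> d \<in> {1..n} \<Longrightarrow>
      A1 a b c d p = 0 \<and>
      A2 a d b c p = (\<Sum>h=1..n. B a h c p * cnj (B b h d p)) + of_real k * kdelta a c * kdelta d b \<and>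
      alt2 (\<lambda>c d. B2 a b c d p) c d = of_real k * alt2 (\<lambda>c d. kdelta a c * kdelta b d) c d"
    and X: "X \<in> XM" and Y: "Y \<in> XM" and Z: "Z \<in> XM" and W: "W \<in> XM"
  shows "Riem g D Z W X Y p = model_curv k Z W X Y p"
proof -
  have comm: "kdelta i j = kdelta j i" for i j by (simp add: kdelta_def)
  have Om: "Om a b X Y p = of_real (k - 1) * wedge (om a) (cnj_om b) X Y p"
    if a: "a \<in> {1..n}" and b: "b \<in> {1..n}" and X: "X \<in> XM" and Y: "Y \<in> XM" for a b X Y
  proof -
    have "A2 a d b c p - (\<Sum>h=1..n. Bf a h c p * cnj (Bf b h d p)) - kdelta c a * kdelta d b
        = of_real (k - 1) * (kdelta c a * kdelta d b)" if c: "c \<in> {1..n}" and d: "d \<in> {1..n}" for c d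
    proof -
      have "B a h c p = Bf a h c p" "B b h d p = Bf b h d p" if "h \<in> {1..n}" for h
        using structure_eqs1_unique(2)[OF w eqs1 p] a b c d that by blast+
      then have "A2 a d b c p = (\<Sum>h=1..n. Bf a h c p * cnj (Bf b h d p)) + of_real k * kdelta a c * kdelta d b"
        using cond[OF a b c d] by (simp cong: sum.cong_simp)
      then show ?thesis by (simp add: comm[of c a] algebra_simps)
    qed
    moreover have "A1 a b c d p = 0" "A1 b a c d p = 0" if "c \<in> {1..n}" "d \<in> {1..n}" for c d
      using cond a b that by blast+
    ultimately have "Om a b X Y p = wedge_sum (\<lambda>c d. of_real (k - 1) * (kdelta c a * kdelta d b)) om cnj_om X Y p"
      using curv(1)[OF a b X Y] by (simp cong: sum.cong_simp)
    then show ?thesis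
      unfolding wedge_kdelta[OF a b, of om cnj_om] by (simp add: sum_distrib_left mult.assoc)
  qed
  have Oa: "Oa a b X Y p = of_real (k - 1) * wedge (om a) (om b) X Y p"
    if a: "a \<in> {1..n}" and b: "b \<in> {1..n}" and X: "X \<in> XM" and Y: "Y \<in> XM" for a b X Y
  proof -
    define P where "P c d = B2 a b c d p - kdelta c a * kdelta d b" for c d
    have Oa': "wedge_sum P om om X Y p
      + wedge_sum (\<lambda>c d. B3 a b d c p - (\<Sum>h=1..n. Bf a b h p * Bf h d c p)) om cnj_om X Y p
      + wedge_sum (\<lambda>c d. 0) cnj_om cnj_om X Y p = Oa a b X Y p"
      if "X \<in> XM" "Y \<in> XM" for X Y
      using curv(2)[OF a b that] by (simp add: P_def)
    have Q: "B3 a b d c p - (\<Sum>h=1..n. Bf a b h p * Bf h d c p) = 0" if c: "c \<in> {1..n}" and d: "d \<in> {1..n}" for c d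
    proof -
      have R: "Riem g D Z W X Y p = - Riem g D Y X Z W p"
        if "X \<in> XM" "Y \<in> XM" "Z \<in> XM" "W \<in> XM" for X Y Z W
        using Riem_pair[of Z W X Y p] Riem_skew12[of Y X Z W p] that by simp
      have "B3 a b d c p - (\<Sum>h=1..n. Bf a b h p * Bf h d c p) = dn (\<lambda>X. up (\<lambda>Y. Oa a b X Y p) d) c"
        using two_form_coefficients(2)[OF p c d Oa'] by simp
      also have "\<dots> = dn (\<lambda>X. up (\<lambda>Y. up (\<lambda>W. up (\<lambda>Z. of_real (- Riem g D Y X Z W p)) a) b) d) c"
        unfolding Oa_def
        by (rule dn_cong; rule up_cong; rule up_cong; rule up_cong; rule arg_cong[where f=of_real]; rule R;
            use a b c d in simp)
      also have "\<dots> = - up (\<lambda>W. up (\<lambda>Z. Om d c Z W p) a) b"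
        unfolding Om_def
        by (simp add: up_minus dn_minus dn_up_swap[where b=c] up_up_swap[where b=d and a=b]
             up_up_swap[where b=d and a=a])
      also have "up (\<lambda>W. up (\<lambda>Z. Om d c Z W p) a) b = up (\<lambda>W. up (\<lambda>Z. of_real (k - 1) * wedge (om d) (cnj_om c) Z W p) a) b"
        by (rule up_cong; rule up_cong; rule Om; use a b c d in simp)
      also have "\<dots> = 0"
        using om_frame(3)[OF p d] a b by (simp add: wedge_def up_linear)
      finally show ?thesis by simp
    qed
    have P: "P c d - P d c = of_real (k - 1) * (kdelta c a * kdelta d b - kdelta d a * kdelta c b)"
      if c: "c \<in> {1..n}" and d: "d \<in> {1..n}" for c d
    proof -
      have "B2 a b c d p - B2 a b d c p = of_real k * (kdelta a c * kdelta b d - kdelta a d * kdelta b c)"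
      proof -
        have half: "x / 2 = z * (y / 2) \<Longrightarrow> x = z * y" for x y z :: complex by simp
        have "(B2 a b c d p - B2 a b d c p) / 2 = of_real k * ((kdelta a c * kdelta b d - kdelta a d * kdelta b c) / 2)"
          using cond[OF a b c d] by (simp only: alt2_def)
        then show ?thesis by (rule half)
      qed
      then show ?thesis
        by (simp add: P_def comm[of c a] comm[of d b] comm[of d a] comm[of c b] algebra_simps)
    qed
    have sw: "wedge_sum (\<lambda>c d. f d c) om om X Y p
        = - wedge_sum (\<lambda>c d. f c d) om om X Y p" for f :: "nat \<Rightarrow> nat \<Rightarrow> complex"
      unfolding sum_negf[symmetric]
      by (subst sum.swap) (intro sum.cong refl, simp add: wedge_def algebra_simps)
    have "2 * Oa a b X Y p = wedge_sum P om om X Y p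
        - wedge_sum (\<lambda>c d. P d c) om om X Y p"
    proof -
      have "wedge_sum (\<lambda>c d. B3 a b d c p - (\<Sum>h=1..n. Bf a b h p * Bf h d c p)) om cnj_om X Y p = 0"
        by (intro sum.neutral ballI) (simp only: Q mult_zero_left)
      then show ?thesis using Oa'[OF X Y, symmetric] sw[of P] by simp
    qed
    also have "\<dots> = wedge_sum (\<lambda>c d. P c d - P d c) om om X Y p"
      by (simp add: left_diff_distrib sum_subtractf)
    also have "\<dots> = of_real (k - 1) * ((wedge_sum (\<lambda>c d. kdelta c a * kdelta d b) om om X Y p)
        - wedge_sum (\<lambda>c d. kdelta d a * kdelta c b) om om X Y p)"
      by (simp add: P sum_distrib_left left_diff_distrib right_diff_distrib sum_subtractf mult.assoc cong: sum.cong_simp)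
    also have "\<dots> = of_real (k - 1) * (2 * wedge (om a) (om b) X Y p)"
      unfolding sw[of "\<lambda>c d. kdelta c a * kdelta d b"] wedge_kdelta[OF a b, of om om] by simp
    finally show ?thesis by simp
  qed
  define S where "S Z W = Riem g D Z W X Y p - model_curv k Z W X Y p" for Z W
  have S_frame: "S (e a) (e b) = 0" "S (e a) (\<Phi> (e b)) = 0" "S (\<Phi> (e a)) (e b) = 0" "S (\<Phi> (e a)) (\<Phi> (e b)) = 0"
    if a: "a \<in> {1..n}" and b: "b \<in> {1..n}" for a b
  proof -
    have "dn (\<lambda>W. up (\<lambda>Z. of_real (S Z W)) a) b = 0"
      using Om[OF a b X Y] model_curv_mixed(1)[OF p a b X Y, of k]
      by (simp add: S_def up_diff dn_diff Om_def)
    moreover have "up (\<lambda>W. up (\<lambda>Z. of_real (S Z W)) a) b = 0"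
      using Oa[OF a b X Y] model_curv_mixed(2)[OF p a b X Y, of k]
      by (simp add: S_def up_diff Oa_def)
    ultimately show "S (e a) (e b) = 0" "S (e a) (\<Phi> (e b)) = 0" "S (\<Phi> (e a)) (e b) = 0" "S (\<Phi> (e a)) (\<Phi> (e b)) = 0"
      by (rule frame_components_zero)+
  qed
  have S_xi: "S Z \<xi> = 0" "S \<xi> Z = 0" if Z: "Z \<in> XM" for Z
    using Riem_xi[OF X Y Z, of p] Riem_skew12[OF Z xi_XM X Y, of p] Z
      g_commute[OF X Z] g_commute[OF Y Z] g_commute[OF xi_XM X] g_commute[OF xi_XM Y] g_commute[OF xi_XM Z]
    by (simp_all add: S_def model_curv_def algebra_simps)
  have S_right: "S Z W = 0"
    if Z: "Z \<in> XM" and 0: "\<And>b. b \<in> {1..n} \<Longrightarrow> S Z (e b) = 0 \<and> S Z (\<Phi> (e b)) = 0" and W: "W \<in> XM" for Z W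
  proof -
    have "complex_of_real (S Z W) = eta_form W p * of_real (S Z \<xi>)
        + (\<Sum>c=1..n. om c W p * dn (\<lambda>W. of_real (S Z W)) c + cnj (om c W p) * up (\<lambda>W. of_real (S Z W)) c)"
    proof (rule frame_expansion[OF p W])
      show "complex_of_real (S Z (V + V')) = of_real (S Z V) + of_real (S Z V')" if "V \<in> XM" "V' \<in> XM" for V V'
        unfolding S_def Riem_add2[OF Z that(2,1) X Y] model_curv_linear(2)[OF Z that(1) X Y that(2)] by simp
      show "complex_of_real (S Z (h \<odot> V)) = of_real (h p) * of_real (S Z V)" if "h \<in> CM" "V \<in> XM" for h V
        unfolding S_def Riem_fmul2[OF that(1) Z that(2) X Y] model_curv_linear(4)[OF Z that(2) X Y that(1)]
        by (simp add: algebra_simps)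
    qed
    then show ?thesis using 0 S_xi(1)[OF Z] by (simp add: dn_def up_def cong: sum.cong_simp)
  qed
  have S_e: "S (e a) W = 0" "S (\<Phi> (e a)) W = 0" if "a \<in> {1..n}" for a
    by (rule S_right; use S_frame that W in simp)+
  have "complex_of_real (S Z W) = eta_form Z p * of_real (S \<xi> W)
      + (\<Sum>c=1..n. om c Z p * dn (\<lambda>Z. of_real (S Z W)) c + cnj (om c Z p) * up (\<lambda>Z. of_real (S Z W)) c)"
  proof (rule frame_expansion[OF p Z])
    show "complex_of_real (S (V + V') W) = of_real (S V W) + of_real (S V' W)" if "V \<in> XM" "V' \<in> XM" for V V'
      unfolding S_def Riem_add1[OF that W X Y] model_curv_linear(1)[OF that(1) W X Y that(2)] by simp
    show "complex_of_real (S (h \<odot> V) W) = of_real (h p) * of_real (S V W)" if "h \<in> CM" "V \<in> XM" for h V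
      unfolding S_def Riem_fmul1[OF that W X Y] model_curv_linear(3)[OF that(2) W X Y that(1)]
      by (simp add: algebra_simps)
  qed
  then have "S Z W = 0" using S_e S_xi(2)[OF W] by (simp add: dn_def up_def cong: sum.cong_simp)
  then show ?thesis by (simp add: S_def)
qed

end

end

theorem theorem4p6:
  fixes A :: "('m::{t2_space,second_countable_topology}, 'e::euclidean_space) atlas"
    and \<Phi> :: "'m vfield \<Rightarrow> 'm vfield" and \<xi> :: "'m vfield"
    and \<eta> :: "'m vfield \<Rightarrow> 'm \<Rightarrow> real" and g :: "'m metric" and D :: "'m connection"
    and n :: nat and a0 a1 a2 \<kappa> :: real
  assumes "acr_manifold n A \<Phi> \<xi> \<eta> g"
    and "levi_civita A g D"
    and "kenmotsu_type A \<Phi> \<eta> D"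
    and "a0 \<noteq> 0" and "a1 \<noteq> 0"
  shows "constant_gen_curv A g D a0 a1 a2 \<kappa> \<longleftrightarrow>
    (let l = (\<lambda>p. 1 / a1 * (a0 + 2 * real n * a1 - 2 * a2 * scal A g D p + \<kappa>));
         m = (\<lambda>p. - (2 * real n + l p))
     in eta_Einstein A g \<eta> D l m \<and>
        (\<forall>U e B A1 A2 B2 B3. structure_functions n A \<Phi> \<xi> g U e B A1 A2 B2 B3 \<longrightarrow>
          (\<forall>p\<in>U. \<forall>a\<in>{1..n}. \<forall>b\<in>{1..n}. \<forall>c\<in>{1..n}. \<forall>d\<in>{1..n}.
             A1 a b c d p = 0 \<and>
             A2 a d b c p = (\<Sum>h=1..n. B a h c p * cnj (B b h d p))
               + of_real (a1 / a0 * m p) * kdelta a c * kdelta d b \<and>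
             alt2 (\<lambda>c d. B2 a b c d p) c d =
               of_real (a1 / a0 * m p) * alt2 (\<lambda>c d. kdelta a c * kdelta b d) c d)))"
proof -
  have "smooth_atlas A" "riemannian_metric A g"
    using assms(1) unfolding acr_manifold_def by blast+
  then interpret kenmotsu_manifold A g D n \<Phi> \<xi> \<eta>
    by unfold_locales (use assms in blast)+
  define l where "l p = 1 / a1 * (a0 + 2 * real n * a1 - 2 * a2 * scal A g D p + \<kappa>)" for p
  define m where "m p = - (2 * real n + l p)" for p
  define model where "model p \<longleftrightarrow> (\<forall>X\<in>XM. \<forall>Y\<in>XM. \<forall>Z\<in>XM. \<forall>W\<in>XM.
      Riem g D Z W X Y p = model_curv (a1 / a0 * m p) Z W X Y p)" for p
  define cond where "cond B A1 A2 B2 p \<longleftrightarrow> (\<forall>a\<in>{1..n}. \<forall>b\<in>{1..n}. \<forall>c\<in>{1..n}. \<forall>d\<in>{1..n}.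
             A1 a b c d p = 0 \<and>
             A2 a d b c p = (\<Sum>h=1..n. B a h c p * cnj (B b h d p))
               + of_real (a1 / a0 * m p) * kdelta a c * kdelta d b \<and>
             alt2 (\<lambda>c d. B2 a b c d p) c d =
               of_real (a1 / a0 * m p) * alt2 (\<lambda>c d. kdelta a c * kdelta b d) c d)"
    for B :: "nat \<Rightarrow> nat \<Rightarrow> nat \<Rightarrow> 'm \<Rightarrow> complex" and A1 A2 B2 :: "nat \<Rightarrow> nat \<Rightarrow> nat \<Rightarrow> nat \<Rightarrow> 'm \<Rightarrow> complex" and p
  have Ricci: "Ric A g D X Z p = l p * g X Z p + m p * \<eta> X p * \<eta> Z p
      \<longleftrightarrow> Ric A g D X Z p = l p * g X Z p + - (2 * real n + l p) * g X \<xi> p * g Z \<xi> p"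
    if "X \<in> XM" "Z \<in> XM" for X Z p
    using that by (simp add: eta m_def)
  have gen: "constant_gen_curv A g D a0 a1 a2 \<kappa> \<longleftrightarrow> (\<forall>p. model p)" if E: "eta_Einstein A g \<eta> D l m"
  proof -
    have "gen_curv A g D a0 a1 a2 Z W X Y p = \<kappa> * (g Z X p * g W Y p - g Z Y p * g W X p)
        \<longleftrightarrow> Riem g D Z W X Y p = model_curv (a1 / a0 * m p) Z W X Y p"
      if "X \<in> XM" "Y \<in> XM" "Z \<in> XM" "W \<in> XM" for X Y Z W p
      unfolding m_def
    proof (rule gen_curv_iff_model[OF assms(4,5) that l_def])
      fix X Z assume "X \<in> XM" "Z \<in> XM"
      then show "Ric A g D X Z p = l p * g X Z p + - (2 * real n + l p) * g X \<xi> p * g Z \<xi> p"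
        using E Ricci[of X Z p] unfolding eta_Einstein_def by blast
    qed
    then show ?thesis unfolding constant_gen_curv_def model_def by blast
  qed
  have frame: "kenmotsu_frame A g D n \<Phi> \<xi> \<eta> U e" if "open U" "p \<in> U" "\<forall>q\<in>U. adapted n e q" for U e p
    by unfold_locales (use that in auto)
  have model_cond: "cond B A1 A2 B2 p"
    if "model p" and sf: "structure_functions n A \<Phi> \<xi> g U e B A1 A2 B2 B3" and p: "p \<in> U" for U e B A1 A2 B2 B3 p
  proof -
    have "open U" "\<forall>q\<in>U. adapted n e q"
      using sf unfolding structure_functions_def AG_section_def orthonormal_iff_adapted by blast+
    then interpret kenmotsu_frame A g D n \<Phi> \<xi> \<eta> U e using frame p by blast
    obtain w w1 where "dual_coframe n A \<Phi> \<xi> U e w" "structure_eqs1 n A U w w1 B"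
        "structure_eqs2 n A U w w1 B A1 A2 B2 B3"
      using sf unfolding structure_functions_def by blast
    note mod = model_imp_structure_functions[OF this p, where k="a1 / a0 * m p"]
    show ?thesis
      unfolding cond_def
      by (intro ballI conjI; rule mod; use \<open>model p\<close>[unfolded model_def] in blast)
  qed
  have cond_model: "model p"
    if sf: "\<And>U e B A1 A2 B2 B3. structure_functions n A \<Phi> \<xi> g U e B A1 A2 B2 B3 \<Longrightarrow> p \<in> U \<Longrightarrow> cond B A1 A2 B2 p" for p
  proof -
    obtain U e where U: "open U" "p \<in> U" "\<forall>q\<in>U. adapted n e q"
      by (rule adapted_exists[OF order_refl])
    interpret kenmotsu_frame A g D n \<Phi> \<xi> \<eta> U e by (rule frame[OF U])
    have c: "cond Bf A1c A2c B2c p" by (rule sf[OF structure_functions_exist U(2)])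
    obtain w w1 where w: "dual_coframe n A \<Phi> \<xi> U e w" "structure_eqs1 n A U w w1 Bf"
        "structure_eqs2 n A U w w1 Bf A1c A2c B2c B3c"
      using structure_functions_exist unfolding structure_functions_def by blast
    show ?thesis
      unfolding model_def
    proof (intro ballI)
      fix X Y Z W assume XM: "X \<in> XM" "Y \<in> XM" "Z \<in> XM" "W \<in> XM"
      show "Riem g D Z W X Y p = model_curv (a1 / a0 * m p) Z W X Y p"
        by (rule structure_functions_imp_model[OF w U(2) _ XM])
          (rule c[unfolded cond_def, THEN bspec, THEN bspec, THEN bspec, THEN bspec]; assumption)
    qed
  qed
  have "constant_gen_curv A g D a0 a1 a2 \<kappa> \<longleftrightarrow> eta_Einstein A g \<eta> D l m \<and>
        (\<forall>U e B A1 A2 B2 B3. structure_functions n A \<Phi> \<xi> g U e B A1 A2 B2 B3 \<longrightarrow> (\<forall>p\<in>U. cond B A1 A2 B2 p))"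
    (is "?C \<longleftrightarrow> ?E \<and> ?S")
  proof
    assume C: ?C
    have E: ?E
      unfolding eta_Einstein_def
    proof (intro ballI allI)
      fix X Z p assume XZ: "X \<in> XM" "Z \<in> XM"
      show "Ric A g D X Z p = l p * g X Z p + m p * \<eta> X p * \<eta> Z p"
        unfolding Ricci[OF XZ] by (rule constant_imp_Ric[OF assms(5) C XZ l_def])
    qed
    have "\<forall>p. model p" using gen[OF E] C by blast
    then have ?S using model_cond by (intro allI impI ballI) blast
    with E show "?E \<and> ?S" ..
  next
    assume ES: "?E \<and> ?S"
    have "model p" for p by (rule cond_model) (use ES in blast)
    then show ?C using gen ES by blast
  qed
  then show ?thesis
    unfolding Let_def cond_def m_def l_def .
qed

end
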